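(* There is an absolute constant $C>0$ such that the following holds. Let $n\ge 1$, $[n]=\{1,\dots,n\}$, and let $\{X_i: i\in[n]\}$ be real-valued random variables with $\mathbb{E}X_i=0$. Assume that for every $i\in[n]$ there is a set $A_i\subset[n]$ such that $X_i$ is independent of $\{X_j: j\notin A_i\}$, and that for every $i\in[n]$ and $j\in A_i$ there is a set $A_{ij}\supset A_i$, $A_{ij}\subset[n]$, such that $\{X_i,X_j\}$ is independent of $\{X_k:k\notin A_{ij}\}$. Let $S=\sum_{i\in[n]}X_i$, $\sigma^2=\mathrm{Var}(S)\in(0,\infty)$, and let $$V=\sqrt{\Big(\sum_{i\in[n]}(X_iY_i-\bar X\bar Y)\Big)_+},\qquad W_2=S/V,$$ where $Y_i=\sum_{k\in A_i}X_k$, $\bar X=\frac1n\sum_{i\in[n]}X_i$, $\bar Y=\frac1n\sum_{i\in[n]}Y_i$. Then $$\sup_{z\in\mathbb{R}}|\mathbb{P}(W_2\le z)-\Phi(z)|\le C\lambda\Big(\frac{\kappa^2}{\sigma^3}\sum_{i\in[n]}\|X_i\|_4^3+\frac{\kappa^{1/2}(\kappa+\tau^{1/2})}{\sigma^2}\Big(\sum_{i\in[n]}\|X_i\|_4^4\Big)^{1/2}\Big),$$ where $\lambda=\kappa\sum_{i\in[n]}\|X_i\|_2^2/\sigma^2$.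
   Context: $\Phi$ is the standard normal distribution function, $(x)_+=\max(x,0)$, $\|X\|_p=(\mathbb{E}|X|^p)^{1/p}$, and $|A|$ is the cardinality of a set $A$. For $i\in[n]$ put $N_i=\{k\in[n]: i\in A_k\}$ and $D_i=\{(k,l): k\in[n],\ l\in A_k,\ i\in A_{kl}\}$. The constants are $$\kappa=\max\Big\{\sup_{i\in[n]}|N_i|,\ \sup_{i\in[n],\,j\in A_i}|A_{ij}|\Big\},\qquad \tau=\sup_{i\in[n]}|D_i|.$$ On the event $\{V=0\}$ the value of $W_2$ may be fixed by any convention (e.g. $W_2=0$). *)

theory Defs
  imports "HOL-Probability.Probability"
begin

text \<open>Throughout, \<open>A i\<close> stands for the set $A_i$ and \<open>A2 i j\<close> for the set $A_{ij}$; the latter is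
  only relevant for \<open>j \<in> A i\<close>.\<close>

definition sum_X :: "nat \<Rightarrow> (nat \<Rightarrow> 'a \<Rightarrow> real) \<Rightarrow> 'a \<Rightarrow> real" where
  "sum_X n X \<omega> = (\<Sum>i\<in>{1..n}. X i \<omega>)"

definition variance_S :: "'a measure \<Rightarrow> nat \<Rightarrow> (nat \<Rightarrow> 'a \<Rightarrow> real) \<Rightarrow> real" where
  "variance_S M n X = (LINT \<omega>|M. (sum_X n X \<omega> - (LINT \<omega>'|M. sum_X n X \<omega>'))\<^sup>2)"

definition sd_S :: "'a measure \<Rightarrow> nat \<Rightarrow> (nat \<Rightarrow> 'a \<Rightarrow> real) \<Rightarrow> real" where
  "sd_S M n X = sqrt (variance_S M n X)"

text \<open>Independence of finite families is independence of the corresponding random vectors, i.e.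
  of the \<sigma>-algebras the families generate.  \<open>indep_var\<close> requires both sides to have the same value type, so the single
  variable \<open>X i\<close> is written as a family over \<open>{i}\<close>.  An empty family gives the trivial \<sigma>-algebra.
  No moments beyond those needed for $E X_i = 0$ and $\mathrm{Var}(S) < \infty$ are assumed.\<close>

locale local_dependence = prob_space M
  for M :: "'a measure" and n :: nat and X :: "nat \<Rightarrow> 'a \<Rightarrow> real"
    and A :: "nat \<Rightarrow> nat set" and A2 :: "nat \<Rightarrow> nat \<Rightarrow> nat set" +
  assumes n_ge_1: "1 \<le> n"
    and X_random_variable: "\<And>i. i \<in> {1..n} \<Longrightarrow> random_variable borel (X i)"
    and X_integrable: "\<And>i. i \<in> {1..n} \<Longrightarrow> integrable M (X i)"
    and X_centered: "\<And>i. i \<in> {1..n} \<Longrightarrow> expectation (X i) = 0"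
    and A_subset: "\<And>i. i \<in> {1..n} \<Longrightarrow> A i \<subseteq> {1..n}"
    and A_indep: "\<And>i. i \<in> {1..n} \<Longrightarrow>
      indep_var (PiM {i} (\<lambda>_. borel)) (\<lambda>\<omega>. \<lambda>k\<in>{i}. X k \<omega>)
        (PiM ({1..n} - A i) (\<lambda>_. borel)) (\<lambda>\<omega>. \<lambda>k\<in>{1..n} - A i. X k \<omega>)"
    and A2_supset: "\<And>i j. i \<in> {1..n} \<Longrightarrow> j \<in> A i \<Longrightarrow> A i \<subseteq> A2 i j"
    and A2_subset: "\<And>i j. i \<in> {1..n} \<Longrightarrow> j \<in> A i \<Longrightarrow> A2 i j \<subseteq> {1..n}"
    and A2_indep: "\<And>i j. i \<in> {1..n} \<Longrightarrow> j \<in> A i \<Longrightarrow>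
      indep_var (PiM {i, j} (\<lambda>_. borel)) (\<lambda>\<omega>. \<lambda>k\<in>{i, j}. X k \<omega>)
        (PiM ({1..n} - A2 i j) (\<lambda>_. borel)) (\<lambda>\<omega>. \<lambda>k\<in>{1..n} - A2 i j. X k \<omega>)"
    and variance_finite: "integrable M (\<lambda>\<omega>. (sum_X n X \<omega>)\<^sup>2)"
    and variance_pos: "0 < variance_S M n X"

definition nbhd_sum :: "(nat \<Rightarrow> 'a \<Rightarrow> real) \<Rightarrow> (nat \<Rightarrow> nat set) \<Rightarrow> nat \<Rightarrow> 'a \<Rightarrow> real" where
  "nbhd_sum X A i \<omega> = (\<Sum>k\<in>A i. X k \<omega>)"

definition mean_of :: "nat \<Rightarrow> (nat \<Rightarrow> 'a \<Rightarrow> real) \<Rightarrow> 'a \<Rightarrow> real" where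
  "mean_of n Z \<omega> = (1 / real n) * (\<Sum>i\<in>{1..n}. Z i \<omega>)"

definition self_normalizer ::
    "nat \<Rightarrow> (nat \<Rightarrow> 'a \<Rightarrow> real) \<Rightarrow> (nat \<Rightarrow> nat set) \<Rightarrow> 'a \<Rightarrow> real" where
  "self_normalizer n X A \<omega> =
     sqrt (max (\<Sum>i\<in>{1..n}. X i \<omega> * nbhd_sum X A i \<omega>
                   - mean_of n X \<omega> * mean_of n (nbhd_sum X A) \<omega>) 0)"

text \<open>\<open>W\<close> is a version of the statistic $W_2 = S/V$: its values on the event $V = 0$ are left
  arbitrary, subject to measurability.\<close>

definition is_self_normalized_sum ::
    "'a measure \<Rightarrow> nat \<Rightarrow> (nat \<Rightarrow> 'a \<Rightarrow> real) \<Rightarrow> (nat \<Rightarrow> nat set) \<Rightarrow> ('a \<Rightarrow> real) \<Rightarrow> bool" where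
  "is_self_normalized_sum M n X A W \<longleftrightarrow>
     W \<in> borel_measurable M \<and>
     (\<forall>\<omega>\<in>space M. self_normalizer n X A \<omega> \<noteq> 0 \<longrightarrow>
        W \<omega> = sum_X n X \<omega> / self_normalizer n X A \<omega>)"

definition N_set :: "nat \<Rightarrow> (nat \<Rightarrow> nat set) \<Rightarrow> nat \<Rightarrow> nat set" where
  "N_set n A i = {k \<in> {1..n}. i \<in> A k}"

definition D_set ::
    "nat \<Rightarrow> (nat \<Rightarrow> nat set) \<Rightarrow> (nat \<Rightarrow> nat \<Rightarrow> nat set) \<Rightarrow> nat \<Rightarrow> (nat \<times> nat) set" where
  "D_set n A A2 i = {(k, l). k \<in> {1..n} \<and> l \<in> A k \<and> i \<in> A2 k l}"

text \<open>The second supremum ranges over the empty set if all \<open>A i\<close> are empty; its value is then 0,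
  the convention for suprema in \<^typ>\<open>nat\<close>.\<close>

definition kappa :: "nat \<Rightarrow> (nat \<Rightarrow> nat set) \<Rightarrow> (nat \<Rightarrow> nat \<Rightarrow> nat set) \<Rightarrow> nat" where
  "kappa n A A2 = max (SUP i\<in>{1..n}. card (N_set n A i))
                      (SUP (i, j)\<in>(SIGMA i:{1..n}. A i). card (A2 i j))"

definition tau :: "nat \<Rightarrow> (nat \<Rightarrow> nat set) \<Rightarrow> (nat \<Rightarrow> nat \<Rightarrow> nat set) \<Rightarrow> nat" where
  "tau n A A2 = (SUP i\<in>{1..n}. card (D_set n A A2 i))"

text \<open>Moments may be infinite, so norms and the bound take values in \<^typ>\<open>ennreal\<close>.  The extended
  power is meant for positive exponents \<open>a\<close>.\<close>

definition ennreal_powr :: "ennreal \<Rightarrow> real \<Rightarrow> ennreal" where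
  "ennreal_powr x a = (if x = \<infinity> then \<infinity> else ennreal (enn2real x powr a))"

definition Lp_norm :: "'a measure \<Rightarrow> real \<Rightarrow> ('a \<Rightarrow> real) \<Rightarrow> ennreal" where
  "Lp_norm M p f = ennreal_powr (\<integral>\<^sup>+\<omega>. ennreal (\<bar>f \<omega>\<bar> powr p) \<partial>M) (1 / p)"

definition lambda_ratio ::
    "'a measure \<Rightarrow> nat \<Rightarrow> (nat \<Rightarrow> 'a \<Rightarrow> real) \<Rightarrow> (nat \<Rightarrow> nat set) \<Rightarrow> (nat \<Rightarrow> nat \<Rightarrow> nat set) \<Rightarrow> ennreal"
  where
  "lambda_ratio M n X A A2 =
     ennreal (real (kappa n A A2) / (sd_S M n X)\<^sup>2) * (\<Sum>i\<in>{1..n}. (Lp_norm M 2 (X i))\<^sup>2)"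

definition moment_bound ::
    "'a measure \<Rightarrow> nat \<Rightarrow> (nat \<Rightarrow> 'a \<Rightarrow> real) \<Rightarrow> (nat \<Rightarrow> nat set) \<Rightarrow> (nat \<Rightarrow> nat \<Rightarrow> nat set) \<Rightarrow> ennreal"
  where
  "moment_bound M n X A A2 =
     ennreal ((real (kappa n A A2))\<^sup>2 / (sd_S M n X) ^ 3) * (\<Sum>i\<in>{1..n}. (Lp_norm M 4 (X i)) ^ 3)
   + ennreal (sqrt (real (kappa n A A2)) * (real (kappa n A A2) + sqrt (real (tau n A A2)))
                / (sd_S M n X)\<^sup>2)
     * ennreal_powr (\<Sum>i\<in>{1..n}. (Lp_norm M 4 (X i)) ^ 4) (1 / 2)"

text \<open>\<open>C\<close> is an admissible constant for all probability spaces on the type \<open>'a\<close>.  The type argument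
  makes it possible to express that a constant does not depend on the type of the sample space:
  this cannot be said by a quantifier, since HOL has no quantification over types.  The statement
  depends only on the joint law of $(W, X_1, \dots, X_n)$, so sample spaces on
  \<^typ>\<open>nat \<Rightarrow> real\<close> already realise every case up to equality in law.\<close>

definition berry_esseen_constant :: "'a itself \<Rightarrow> real \<Rightarrow> bool" where
  "berry_esseen_constant (_ :: 'a itself) C \<longleftrightarrow>
     (\<forall>(M :: 'a measure) n X A A2 W.
        local_dependence M n X A A2 \<longrightarrow>
        is_self_normalized_sum M n X A W \<longrightarrow>
        (SUP z. ennreal \<bar>measure M {\<omega> \<in> space M. W \<omega> \<le> z} - cdf std_normal_distribution z\<bar>)
          \<le> ennreal C * lambda_ratio M n X A A2 * moment_bound M n X A A2)"

end

theory Submission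
  imports Defs
begin

text \<open>The proof is by Stein's method, applied directly to the self-normalised sum. After division by
  the standard deviation assume \<open>Var S = 1\<close>, and let \<open>b\<close> be the moment bound; one may assume that it is
  small. Write \<open>Q\<close> for the sum of the \<open>X i * Y i\<close> and \<open>T\<close> for the square of the normaliser, which is \<open>Q\<close> minus the
  product of means. Sums of functions of neighbouring pairs have small variance, since a pair
  \<open>(X i, X l)\<close> is independent of all pairs outside \<open>A2 i l\<close> (\<open>pair_sum_family_variance\<close>). Therefore \<open>E \<bar>Q - 1\<bar>\<close>
  is \<open>O(b)\<close>, the means are negligible (\<open>lam_cube_le\<close>), and \<open>T\<close> may be clamped to the interval from \<open>1 / 4\<close> to \<open>4\<close>.
  The ratio \<open>U\<close> of \<open>S\<close> and the root of the clamped \<open>T\<close> satisfies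
  \<open>E (U * F U) = E (F' U) + O(b) + remainder\<close> for all test functions (\<open>stein_identity\<close>): leaving out the
  neighbourhood \<open>A i\<close> in \<open>S\<close> and in \<open>T\<close> makes \<open>X i\<close> independent of the rest, the change of \<open>T\<close> costs third moments, and
  \<open>Q / T\<close> is nearly \<open>1\<close>.

  The difficulty is the remainder for test functions whose derivative has a steep flank of width \<open>al\<close> at a
  point \<open>e\<close>. It is the expectation of a third-order sum on the event that \<open>U\<close> is within reach of \<open>e\<close>, and
  the hypotheses give no independence for triples of variables. The way out is \<open>kern_sum_expectation\<close>. If the
  sum \<open>Y i\<close> is large enough to reach \<open>e\<close>, then so is \<open>2 * k\<close> times one of its summands (\<open>kern_sum_le\<close>). Hence the
  remainder is dominated by sums over pairs, cut into dyadic shells according to the size of one variable, times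
  indicators of \<open>\<bar>U - e\<bar> \<le> 8 * 2 ^ m * al\<close>. The pair sums are close to their means, whatever their relation to \<open>U\<close>, so
  the remainder is at most \<open>O(b / al) * q + O(b)\<close>, where \<open>q\<close> bounds the probability that \<open>U\<close> lies in an interval
  of radius \<open>al\<close>.

  With a tent as derivative this gives \<open>q \<le> O(al + b) + O(b / al) * q\<close>, hence \<open>q = O(b)\<close> for \<open>al\<close> a large multiple of \<open>b\<close>
  (\<open>concentration\<close>). With the solution of the Stein equation for a smoothed indicator it gives the Kolmogorov
  distance \<open>O(b)\<close> (\<open>kolmogorov_ratio\<close>). Finally \<open>1 \<le> lam\<close>, because the variance is a sum of covariances of neighbours
  (\<open>lam_ge_1\<close>), and the constant passes between sample spaces through the joint law (\<open>berry_esseen_from_encode\<close>).\<close>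

section \<open>Elementary inequalities\<close>

lemma cube_sum_le:
  fixes a :: "'b \<Rightarrow> real"
  assumes "finite S" "\<And>l. l \<in> S \<Longrightarrow> 0 \<le> a l" "real (card S) \<le> k"
  shows "(\<Sum>l\<in>S. a l) ^ 3 \<le> k ^ 2 * (\<Sum>l\<in>S. a l ^ 3)"
proof (cases "S = {}")
  case False
  define c where "c = real (card S)"
  define m where "m = (\<Sum>l\<in>S. a l) / c"
  have c: "c > 0" using False assms(1) by (simp add: c_def card_gt_0_iff)
  have m0: "m \<ge> 0" using assms(2) c by (simp add: m_def sum_nonneg)
  have s: "(\<Sum>l\<in>S. a l) = c * m" using c by (simp add: m_def)
  \<comment> \<open>Jensen's inequality, by summing the tangent line of the cube at the mean \<open>m\<close>\<close>
  have "3 * m\<^sup>2 * a l - 2 * m ^ 3 \<le> a l ^ 3" if "l \<in> S" for l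
  proof -
    have "0 \<le> (a l - m)\<^sup>2 * (a l + 2 * m)" using assms(2)[OF that] m0 by simp
    then show ?thesis by (simp add: power2_eq_square power3_eq_cube algebra_simps)
  qed
  then have "(\<Sum>l\<in>S. 3 * m\<^sup>2 * a l - 2 * m ^ 3) \<le> (\<Sum>l\<in>S. a l ^ 3)" by (intro sum_mono)
  also have "(\<Sum>l\<in>S. 3 * m\<^sup>2 * a l - 2 * m ^ 3) = 3 * m\<^sup>2 * (c * m) - c * (2 * m ^ 3)"
    by (simp add: sum_subtractf sum_distrib_left[symmetric] s c_def)
  also have "\<dots> = c * m ^ 3" by (simp add: power2_eq_square power3_eq_cube)
  finally have *: "c * m ^ 3 \<le> (\<Sum>l\<in>S. a l ^ 3)" .
  have "(\<Sum>l\<in>S. a l) ^ 3 = c ^ 2 * (c * m ^ 3)" by (simp add: s power_mult_distrib power2_eq_square power3_eq_cube)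
  also have "\<dots> \<le> c ^ 2 * (\<Sum>l\<in>S. a l ^ 3)" using * by (intro mult_left_mono) auto
  also have "\<dots> \<le> k ^ 2 * (\<Sum>l\<in>S. a l ^ 3)"
    using assms c by (intro mult_right_mono power_mono sum_nonneg) (auto simp: c_def)
  finally show ?thesis .
qed simp

lemma square_sum_le:
  fixes a :: "'b \<Rightarrow> real"
  assumes "finite S" "real (card S) \<le> k"
  shows "(\<Sum>l\<in>S. a l) ^ 2 \<le> k * (\<Sum>l\<in>S. a l ^ 2)"
proof -
  have "(\<Sum>l\<in>S. a l) ^ 2 \<le> (\<Sum>l\<in>S. a l ^ 2) * card S"
    using sum_squared_le_sum_of_squares by blast
  also have "\<dots> \<le> (\<Sum>l\<in>S. a l ^ 2) * k" using assms by (intro mult_left_mono sum_nonneg) auto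
  finally show ?thesis by (simp add: mult.commute)
qed

lemma fourth_sum_le:
  fixes a :: "'b \<Rightarrow> real"
  assumes "finite S" "real (card S) \<le> k"
  shows "(\<Sum>l\<in>S. a l) ^ 4 \<le> k ^ 3 * (\<Sum>l\<in>S. a l ^ 4)"
proof -
  have k: "0 \<le> k" using assms(2) by linarith
  have "(\<Sum>l\<in>S. a l) ^ 4 = ((\<Sum>l\<in>S. a l)\<^sup>2)\<^sup>2" by simp
  also have "\<dots> \<le> (k * (\<Sum>l\<in>S. a l ^ 2))\<^sup>2"
    using square_sum_le[OF assms, of a] by (intro power_mono) auto
  also have "\<dots> = k\<^sup>2 * (\<Sum>l\<in>S. a l ^ 2)\<^sup>2" by (simp add: power_mult_distrib)
  also have "\<dots> \<le> k\<^sup>2 * (k * (\<Sum>l\<in>S. (a l ^ 2) ^ 2))"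
    by (intro mult_left_mono square_sum_le assms) auto
  finally show ?thesis by (simp add: power2_eq_square power3_eq_cube power4_eq_xxxx mult.assoc)
qed

lemma young_three:
  fixes a b c :: real
  assumes "0 \<le> a" "0 \<le> b" "0 \<le> c"
  shows "3 * (a * b * c) \<le> a ^ 3 + b ^ 3 + c ^ 3"
proof -
  have "a ^ 3 + b ^ 3 + c ^ 3 - 3 * (a * b * c) = (a + b + c) * ((a - b)\<^sup>2 + (b - c)\<^sup>2 + (c - a)\<^sup>2) / 2"
    by (simp add: power2_eq_square power3_eq_cube algebra_simps)
  also have "\<dots> \<ge> 0" using assms by simp
  finally show ?thesis by simp
qed

lemma young_31:
  fixes a b :: real
  assumes "0 \<le> a" "0 \<le> b"
  shows "4 * (a ^ 3 * b) \<le> 3 * a ^ 4 + b ^ 4"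
proof -
  have "3 * a ^ 4 + b ^ 4 - 4 * (a ^ 3 * b) = (a - b)\<^sup>2 * (2 * a\<^sup>2 + (a + b)\<^sup>2)"
    by (simp add: power2_eq_square power3_eq_cube power4_eq_xxxx algebra_simps)
  also have "\<dots> \<ge> 0" by simp
  finally show ?thesis by simp
qed

lemma weighted_square: 
  fixes a b :: real
  assumes "0 < k"
  shows "2 * (a * b) \<le> k * a\<^sup>2 + b\<^sup>2 / k"
proof -
  have "0 \<le> (k * a - b)\<^sup>2 / k" using assms by simp
  also have "\<dots> = k * a\<^sup>2 + b\<^sup>2 / k - 2 * (a * b)" using assms by (simp add: power2_eq_square field_simps)
  finally show ?thesis by simp
qed

section \<open>Sums over dependency neighbourhoods\<close>

definition zero_on :: "nat set \<Rightarrow> (nat \<Rightarrow> real) \<Rightarrow> nat \<Rightarrow> real" where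
  "zero_on B v = (\<lambda>j. if j \<in> B then 0 else v j)"

text \<open>The combinatorial part of the hypotheses, for fixed real values \<open>v i\<close> in place of the
  random variables. Every sum below is estimated by splitting a product of three or four values by
  the arithmetic-geometric mean inequality into pure powers \<open>\<bar>v i\<bar> ^ 3\<close> or \<open>v i ^ 4\<close>, and by counting how
  often an index \<open>i\<close> occurs. An index occurs at most \<open>k\<close> times as a centre, at most \<open>k\<close> times as a
  member of some \<open>A j\<close>, and at most \<open>t\<close> times as a member of some \<open>A2 j l\<close>. This is why \<open>k\<close> and \<open>t\<close>
  enter the final bound only as \<open>k\<^sup>2\<close> with third moments and as \<open>k * (k\<^sup>2 + t)\<close> with fourth moments.\<close>

locale dependency_neighbourhoods =
  fixes n :: nat and A :: "nat \<Rightarrow> nat set" and A2 :: "nat \<Rightarrow> nat \<Rightarrow> nat set" and k t :: real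
  assumes A_sub: "\<And>i. i \<in> {1..n} \<Longrightarrow> A i \<subseteq> {1..n}"
    and A2_sub: "\<And>i j. i \<in> {1..n} \<Longrightarrow> j \<in> A i \<Longrightarrow> A2 i j \<subseteq> {1..n}"
    and card_A: "\<And>i. i \<in> {1..n} \<Longrightarrow> real (card (A i)) \<le> k"
    and card_N: "\<And>i. i \<in> {1..n} \<Longrightarrow> real (card (N_set n A i)) \<le> k"
    and card_A2: "\<And>i j. i \<in> {1..n} \<Longrightarrow> j \<in> A i \<Longrightarrow> real (card (A2 i j)) \<le> k"
    and card_D: "\<And>i. i \<in> {1..n} \<Longrightarrow> real (card (D_set n A A2 i)) \<le> t"
    and k_ge_1: "1 \<le> k" and t_nonneg: "0 \<le> t"
begin

definition out_abs :: "(nat \<Rightarrow> real) \<Rightarrow> nat \<Rightarrow> real" where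
  "out_abs v i = (\<Sum>l\<in>A i. \<bar>v l\<bar>)"
definition in_abs :: "(nat \<Rightarrow> real) \<Rightarrow> nat \<Rightarrow> real" where
  "in_abs v l = (\<Sum>i\<in>N_set n A l. \<bar>v i\<bar>)"
definition pair_abs :: "(nat \<Rightarrow> real) \<Rightarrow> nat \<Rightarrow> nat \<Rightarrow> real" where
  "pair_abs v i l = (\<Sum>m\<in>A2 i l. \<bar>v m\<bar>)"
definition cube_sum :: "(nat \<Rightarrow> real) \<Rightarrow> real" where
  "cube_sum v = (\<Sum>i\<in>{1..n}. \<bar>v i\<bar> ^ 3)"
definition fourth_sum :: "(nat \<Rightarrow> real) \<Rightarrow> real" where
  "fourth_sum v = (\<Sum>i\<in>{1..n}. v i ^ 4)"

lemma finite_A [simp]: "i \<in> {1..n} \<Longrightarrow> finite (A i)"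
  using A_sub finite_subset by blast
lemma finite_A2 [simp]: "i \<in> {1..n} \<Longrightarrow> j \<in> A i \<Longrightarrow> finite (A2 i j)"
  using A2_sub finite_subset by blast
lemma finite_N [simp]: "finite (N_set n A l)" by (simp add: N_set_def)
lemma k_pos [simp]: "0 < k" and k_nonneg [simp]: "0 \<le> k" and k_neq_0 [simp]: "k \<noteq> 0"
  using k_ge_1 by auto
lemma in_A: "i \<in> {1..n} \<Longrightarrow> l \<in> A i \<Longrightarrow> l \<in> {1..n}" using A_sub by blast
lemma in_N: "i \<in> N_set n A l \<Longrightarrow> i \<in> {1..n}" by (simp add: N_set_def)
lemma out_abs_nonneg [simp]: "0 \<le> out_abs v i" by (simp add: out_abs_def sum_nonneg)
lemma in_abs_nonneg [simp]: "0 \<le> in_abs v i" by (simp add: in_abs_def sum_nonneg)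
lemma pair_abs_nonneg [simp]: "0 \<le> pair_abs v i l" by (simp add: pair_abs_def sum_nonneg)
lemma cube_sum_nonneg [simp]: "0 \<le> cube_sum v" by (simp add: cube_sum_def sum_nonneg)
lemma fourth_sum_nonneg [simp]: "0 \<le> fourth_sum v" by (simp add: fourth_sum_def sum_nonneg)

lemma sum_nbhd_swap:
  fixes f :: "nat \<Rightarrow> nat \<Rightarrow> real"
  shows "(\<Sum>i\<in>{1..n}. \<Sum>l\<in>A i. f i l) = (\<Sum>l\<in>{1..n}. \<Sum>i\<in>N_set n A l. f i l)"
proof -
  have "(\<Sum>i\<in>{1..n}. \<Sum>l\<in>A i. f i l) = (\<Sum>i\<in>{1..n}. \<Sum>l\<in>{l. l \<in> {1..n} \<and> l \<in> A i}. f i l)"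
    using A_sub by (intro sum.cong refl) blast
  also have "\<dots> = (\<Sum>l\<in>{1..n}. \<Sum>i\<in>{i. i \<in> {1..n} \<and> l \<in> A i}. f i l)"
    by (rule sum.swap_restrict) auto
  finally show ?thesis by (simp add: N_set_def)
qed

lemma sum_nbhd_centre_le:
  assumes "\<And>i. i \<in> {1..n} \<Longrightarrow> 0 \<le> g i"
  shows "(\<Sum>i\<in>{1..n}. \<Sum>l\<in>A i. g i) \<le> k * (\<Sum>i\<in>{1..n}. g i)"
proof -
  have "(\<Sum>i\<in>{1..n}. \<Sum>l\<in>A i. g i) \<le> (\<Sum>i\<in>{1..n}. k * g i)"
    using assms by (intro sum_mono) (simp add: card_A mult_right_mono)
  then show ?thesis by (simp add: sum_distrib_left)
qed

lemma sum_nbhd_member_le: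
  assumes "\<And>i. i \<in> {1..n} \<Longrightarrow> 0 \<le> g i"
  shows "(\<Sum>i\<in>{1..n}. \<Sum>l\<in>A i. g l) \<le> k * (\<Sum>i\<in>{1..n}. g i)"
proof -
  have "(\<Sum>i\<in>{1..n}. \<Sum>l\<in>A i. g l) \<le> (\<Sum>i\<in>{1..n}. k * g i)"
    unfolding sum_nbhd_swap using assms by (intro sum_mono) (simp add: card_N mult_right_mono)
  then show ?thesis by (simp add: sum_distrib_left)
qed

lemma sum_pair_member_le:
  assumes "\<And>i. i \<in> {1..n} \<Longrightarrow> 0 \<le> g i"
  shows "(\<Sum>i\<in>{1..n}. \<Sum>l\<in>A i. \<Sum>m\<in>A2 i l. g m) \<le> t * (\<Sum>m\<in>{1..n}. g m)"
proof -
  have "(\<Sum>i\<in>{1..n}. \<Sum>l\<in>A i. \<Sum>m\<in>A2 i l. g m) = (\<Sum>a\<in>(SIGMA i:{1..n}. A i). \<Sum>m\<in>A2 (fst a) (snd a). g m)"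
    by (subst sum.Sigma) (auto simp: case_prod_beta intro: finite_A)
  also have "\<dots> = (\<Sum>a\<in>(SIGMA i:{1..n}. A i). \<Sum>m\<in>{m. m \<in> {1..n} \<and> m \<in> A2 (fst a) (snd a)}. g m)"
    using A2_sub by (intro sum.cong refl) fastforce
  also have "\<dots> = (\<Sum>m\<in>{1..n}. \<Sum>a\<in>{a. a \<in> (SIGMA i:{1..n}. A i) \<and> m \<in> A2 (fst a) (snd a)}. g m)"
    by (rule sum.swap_restrict) (auto intro: finite_A)
  also have "\<dots> = (\<Sum>m\<in>{1..n}. real (card (D_set n A A2 m)) * g m)"
  proof (intro sum.cong refl)
    fix m
    have "{a. a \<in> (SIGMA i:{1..n}. A i) \<and> m \<in> A2 (fst a) (snd a)} = D_set n A A2 m"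
      by (auto simp: D_set_def)
    then show "(\<Sum>a\<in>{a. a \<in> (SIGMA i:{1..n}. A i) \<and> m \<in> A2 (fst a) (snd a)}. g m) = real (card (D_set n A A2 m)) * g m"
      by simp
  qed
  also have "\<dots> \<le> (\<Sum>m\<in>{1..n}. t * g m)" using assms by (intro sum_mono mult_right_mono card_D) auto
  finally show ?thesis by (simp add: sum_distrib_left)
qed

lemma sum_out_cube: "(\<Sum>i\<in>{1..n}. out_abs v i ^ 3) \<le> k ^ 3 * cube_sum v"
proof -
  have "(\<Sum>i\<in>{1..n}. out_abs v i ^ 3) \<le> (\<Sum>i\<in>{1..n}. k^2 * (\<Sum>l\<in>A i. \<bar>v l\<bar> ^ 3))"
    unfolding out_abs_def by (intro sum_mono cube_sum_le) (auto simp: card_A)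
  also have "\<dots> = k^2 * (\<Sum>i\<in>{1..n}. \<Sum>l\<in>A i. \<bar>v l\<bar> ^ 3)" by (simp add: sum_distrib_left)
  also have "\<dots> \<le> k^2 * (k * (\<Sum>i\<in>{1..n}. \<bar>v i\<bar> ^ 3))"
    by (intro mult_left_mono sum_nbhd_member_le) auto
  finally show ?thesis by (simp add: cube_sum_def power2_eq_square power3_eq_cube)
qed

lemma sum_in_cube: "(\<Sum>i\<in>{1..n}. in_abs v i ^ 3) \<le> k ^ 3 * cube_sum v"
proof -
  have "(\<Sum>i\<in>{1..n}. in_abs v i ^ 3) \<le> (\<Sum>i\<in>{1..n}. k^2 * (\<Sum>l\<in>N_set n A i. \<bar>v l\<bar> ^ 3))"
    unfolding in_abs_def by (intro sum_mono cube_sum_le) (auto simp: card_N)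
  also have "\<dots> = k^2 * (\<Sum>i\<in>{1..n}. \<Sum>l\<in>A i. \<bar>v i\<bar> ^ 3)"
    unfolding sum_nbhd_swap by (simp add: sum_distrib_left)
  also have "\<dots> \<le> k^2 * (k * (\<Sum>i\<in>{1..n}. \<bar>v i\<bar> ^ 3))"
    by (intro mult_left_mono sum_nbhd_centre_le) auto
  finally show ?thesis by (simp add: cube_sum_def power2_eq_square power3_eq_cube)
qed

lemma sum_out_fourth: "(\<Sum>i\<in>{1..n}. out_abs v i ^ 4) \<le> k ^ 4 * fourth_sum v"
proof -
  have "(\<Sum>i\<in>{1..n}. out_abs v i ^ 4) \<le> (\<Sum>i\<in>{1..n}. k^3 * (\<Sum>l\<in>A i. \<bar>v l\<bar> ^ 4))"
    unfolding out_abs_def by (intro sum_mono fourth_sum_le) (auto simp: card_A)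
  also have "\<dots> = k^3 * (\<Sum>i\<in>{1..n}. \<Sum>l\<in>A i. v l ^ 4)" by (simp add: sum_distrib_left)
  also have "\<dots> \<le> k^3 * (k * (\<Sum>i\<in>{1..n}. v i ^ 4))"
    by (intro mult_left_mono sum_nbhd_member_le) auto
  finally show ?thesis by (simp add: fourth_sum_def power4_eq_xxxx power3_eq_cube)
qed

lemma sum_in_fourth: "(\<Sum>i\<in>{1..n}. in_abs v i ^ 4) \<le> k ^ 4 * fourth_sum v"
proof -
  have "(\<Sum>i\<in>{1..n}. in_abs v i ^ 4) \<le> (\<Sum>i\<in>{1..n}. k^3 * (\<Sum>l\<in>N_set n A i. \<bar>v l\<bar> ^ 4))"
    unfolding in_abs_def by (intro sum_mono fourth_sum_le) (auto simp: card_N)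
  also have "\<dots> = k^3 * (\<Sum>i\<in>{1..n}. \<Sum>l\<in>A i. v i ^ 4)"
    unfolding sum_nbhd_swap by (simp add: sum_distrib_left)
  also have "\<dots> \<le> k^3 * (k * (\<Sum>i\<in>{1..n}. v i ^ 4))"
    by (intro mult_left_mono sum_nbhd_centre_le) auto
  finally show ?thesis by (simp add: fourth_sum_def power4_eq_xxxx power3_eq_cube)
qed

text \<open>Both \<open>out_abs\<close> and \<open>in_abs\<close> behave like \<open>k\<close> times a single value, in the sense of their third
  powers; dividing by \<open>k\<close> before applying \<open>a b c \<le> (a\<^sup>3 + b\<^sup>3 + c\<^sup>3) / 3\<close> gives the factor \<open>k\<^sup>2\<close>.\<close>

lemma triple_sum_le:
  assumes "(\<Sum>i\<in>{1..n}. b i ^ 3) \<le> k ^ 3 * cube_sum v" "(\<Sum>i\<in>{1..n}. c i ^ 3) \<le> k ^ 3 * cube_sum v"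
    "\<And>i. 0 \<le> b i" "\<And>i. 0 \<le> c i"
  shows "(\<Sum>i\<in>{1..n}. \<bar>v i\<bar> * b i * c i) \<le> k\<^sup>2 * cube_sum v"
proof -
  have "3 * (\<bar>v i\<bar> * b i * c i) \<le> k^2 * \<bar>v i\<bar> ^ 3 + b i ^ 3 / k + c i ^ 3 / k" for i
  proof -
    have "3 * (\<bar>v i\<bar> * (b i / k) * (c i / k)) \<le> \<bar>v i\<bar> ^ 3 + (b i / k) ^ 3 + (c i / k) ^ 3"
      using assms(3,4) by (intro young_three) auto
    then have "k^2 * (3 * (\<bar>v i\<bar> * (b i / k) * (c i / k))) \<le> k^2 * (\<bar>v i\<bar> ^ 3 + (b i / k) ^ 3 + (c i / k) ^ 3)"
      by (intro mult_left_mono) auto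
    moreover have "k^2 * (3 * (\<bar>v i\<bar> * (b i / k) * (c i / k))) = 3 * (\<bar>v i\<bar> * b i * c i)"
      by (simp add: power2_eq_square)
    moreover have "k^2 * (\<bar>v i\<bar> ^ 3 + (b i / k) ^ 3 + (c i / k) ^ 3) = k^2 * \<bar>v i\<bar> ^ 3 + b i ^ 3 / k + c i ^ 3 / k"
      by (simp add: power_divide power2_eq_square power3_eq_cube field_simps)
    ultimately show ?thesis by simp
  qed
  then have "(\<Sum>i\<in>{1..n}. 3 * (\<bar>v i\<bar> * b i * c i)) \<le> (\<Sum>i\<in>{1..n}. k^2 * \<bar>v i\<bar> ^ 3 + b i ^ 3 / k + c i ^ 3 / k)"
    by (intro sum_mono)
  also have "\<dots> = k^2 * cube_sum v + (\<Sum>i\<in>{1..n}. b i ^ 3) / k + (\<Sum>i\<in>{1..n}. c i ^ 3) / k"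
    by (simp add: cube_sum_def sum.distrib sum_distrib_left sum_divide_distrib)
  also have "\<dots> \<le> k^2 * cube_sum v + k ^ 3 * cube_sum v / k + k ^ 3 * cube_sum v / k"
    using assms(1,2) by (intro add_mono divide_right_mono) auto
  also have "\<dots> = 3 * (k^2 * cube_sum v)" by (simp add: power2_eq_square power3_eq_cube)
  finally show ?thesis by (simp add: sum_distrib_left[symmetric])
qed

lemma sum_abs_out_square: "(\<Sum>i\<in>{1..n}. \<bar>v i\<bar> * (out_abs v i)\<^sup>2) \<le> k\<^sup>2 * cube_sum v"
  using triple_sum_le[OF sum_out_cube sum_out_cube, of v] by (simp add: power2_eq_square mult.assoc)

lemma sum_abs_in_mult: "(\<Sum>i\<in>{1..n}. \<bar>v i\<bar> * in_abs v i * (out_abs v i + in_abs v i)) \<le> 2 * k\<^sup>2 * cube_sum v"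
  using triple_sum_le[OF sum_in_cube sum_out_cube, of v] triple_sum_le[OF sum_in_cube sum_in_cube, of v]
  by (simp add: distrib_left sum.distrib)

lemma sum_abs_out_in: "(\<Sum>i\<in>{1..n}. \<Sum>l\<in>A i. \<bar>v i\<bar> * \<bar>v l\<bar> * c l) = (\<Sum>l\<in>{1..n}. \<bar>v l\<bar> * in_abs v l * c l)"
  unfolding sum_nbhd_swap in_abs_def
  by (intro sum.cong refl) (simp add: sum_distrib_left sum_distrib_right mult_ac)

lemma sum_square_fourth_le:
  assumes "(\<Sum>i\<in>{1..n}. b i ^ 4) \<le> k ^ 4 * fourth_sum v"
  shows "(\<Sum>i\<in>{1..n}. (v i)\<^sup>2 * (b i)\<^sup>2) \<le> k\<^sup>2 * fourth_sum v"
proof -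
  have "2 * ((v i)\<^sup>2 * (b i)\<^sup>2) \<le> k^2 * v i ^ 4 + b i ^ 4 / k^2" for i
    using weighted_square[of "k^2" "(v i)\<^sup>2" "(b i)\<^sup>2"] by simp
  then have "(\<Sum>i\<in>{1..n}. 2 * ((v i)\<^sup>2 * (b i)\<^sup>2)) \<le> (\<Sum>i\<in>{1..n}. k^2 * v i ^ 4 + b i ^ 4 / k^2)"
    by (intro sum_mono)
  also have "\<dots> = k^2 * fourth_sum v + (\<Sum>i\<in>{1..n}. b i ^ 4) / k^2"
    by (simp add: fourth_sum_def sum.distrib sum_distrib_left sum_divide_distrib)
  also have "\<dots> \<le> k^2 * fourth_sum v + k ^ 4 * fourth_sum v / k^2"
    using assms by (intro add_mono divide_right_mono) auto
  also have "\<dots> = 2 * (k^2 * fourth_sum v)" by (simp add: power2_eq_square power4_eq_xxxx)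
  finally show ?thesis by (simp add: sum_distrib_left[symmetric])
qed

lemma sum_square_out_in: "(\<Sum>i\<in>{1..n}. (v i)\<^sup>2 * (out_abs v i + in_abs v i)\<^sup>2) \<le> 4 * k\<^sup>2 * fourth_sum v"
proof -
  have "(out_abs v i + in_abs v i)\<^sup>2 \<le> 2 * (out_abs v i)\<^sup>2 + 2 * (in_abs v i)\<^sup>2" for i
    using sum_squares_bound[of "out_abs v i" "in_abs v i"] by (simp add: power2_sum)
  then have "(\<Sum>i\<in>{1..n}. (v i)\<^sup>2 * (out_abs v i + in_abs v i)\<^sup>2) \<le>
      (\<Sum>i\<in>{1..n}. (v i)\<^sup>2 * (2 * (out_abs v i)\<^sup>2 + 2 * (in_abs v i)\<^sup>2))"
    by (intro sum_mono mult_left_mono) auto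
  also have "\<dots> = 2 * (\<Sum>i\<in>{1..n}. (v i)\<^sup>2 * (out_abs v i)\<^sup>2) + 2 * (\<Sum>i\<in>{1..n}. (v i)\<^sup>2 * (in_abs v i)\<^sup>2)"
    by (simp add: distrib_left sum.distrib sum_distrib_left mult_ac)
  also have "\<dots> \<le> 2 * (k\<^sup>2 * fourth_sum v) + 2 * (k\<^sup>2 * fourth_sum v)"
    by (intro add_mono mult_left_mono sum_square_fourth_le sum_out_fourth sum_in_fourth) auto
  finally show ?thesis by (simp add: mult_ac)
qed

lemma sum_cube_out: "(\<Sum>i\<in>{1..n}. \<bar>v i\<bar> ^ 3 * out_abs v i) \<le> k * fourth_sum v"
proof -
  have "4 * (\<bar>v i\<bar> ^ 3 * out_abs v i) \<le> 3 * k * v i ^ 4 + out_abs v i ^ 4 / k ^ 3" for i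
  proof -
    have "4 * (\<bar>v i\<bar> ^ 3 * (out_abs v i / k)) \<le> 3 * \<bar>v i\<bar> ^ 4 + (out_abs v i / k) ^ 4"
      by (intro young_31) auto
    then have "k * (4 * (\<bar>v i\<bar> ^ 3 * (out_abs v i / k))) \<le> k * (3 * \<bar>v i\<bar> ^ 4 + (out_abs v i / k) ^ 4)"
      by (intro mult_left_mono) auto
    moreover have "k * (4 * (\<bar>v i\<bar> ^ 3 * (out_abs v i / k))) = 4 * (\<bar>v i\<bar> ^ 3 * out_abs v i)" by simp
    moreover have "k * (3 * \<bar>v i\<bar> ^ 4 + (out_abs v i / k) ^ 4) = 3 * k * v i ^ 4 + out_abs v i ^ 4 / k ^ 3"
      by (simp add: power_divide power4_eq_xxxx power3_eq_cube field_simps)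
    ultimately show ?thesis by simp
  qed
  then have "(\<Sum>i\<in>{1..n}. 4 * (\<bar>v i\<bar> ^ 3 * out_abs v i)) \<le> (\<Sum>i\<in>{1..n}. 3 * k * v i ^ 4 + out_abs v i ^ 4 / k ^ 3)"
    by (intro sum_mono)
  also have "\<dots> = 3 * k * fourth_sum v + (\<Sum>i\<in>{1..n}. out_abs v i ^ 4) / k ^ 3"
    by (simp add: fourth_sum_def sum.distrib sum_distrib_left sum_divide_distrib)
  also have "\<dots> \<le> 3 * k * fourth_sum v + k ^ 4 * fourth_sum v / k ^ 3"
    by (intro add_mono divide_right_mono sum_out_fourth) auto
  also have "\<dots> = 4 * (k * fourth_sum v)" by (simp add: power4_eq_xxxx power3_eq_cube)
  finally show ?thesis by (simp add: sum_distrib_left[symmetric])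
qed

lemma sum_abs_out_cube: "(\<Sum>i\<in>{1..n}. \<bar>v i\<bar> * out_abs v i ^ 3) \<le> k ^ 3 * fourth_sum v"
proof -
  have "4 * (\<bar>v i\<bar> * out_abs v i ^ 3) \<le> k ^ 3 * v i ^ 4 + 3 * out_abs v i ^ 4 / k" for i
  proof -
    have "4 * ((out_abs v i / k) ^ 3 * \<bar>v i\<bar>) \<le> 3 * (out_abs v i / k) ^ 4 + \<bar>v i\<bar> ^ 4"
      by (intro young_31) auto
    then have "k ^ 3 * (4 * ((out_abs v i / k) ^ 3 * \<bar>v i\<bar>)) \<le> k ^ 3 * (3 * (out_abs v i / k) ^ 4 + \<bar>v i\<bar> ^ 4)"
      by (intro mult_left_mono) auto
    moreover have "k ^ 3 * (4 * ((out_abs v i / k) ^ 3 * \<bar>v i\<bar>)) = 4 * (\<bar>v i\<bar> * out_abs v i ^ 3)"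
      by (simp add: power_divide)
    moreover have "k ^ 3 * (3 * (out_abs v i / k) ^ 4 + \<bar>v i\<bar> ^ 4) = k ^ 3 * v i ^ 4 + 3 * out_abs v i ^ 4 / k"
      by (simp add: power_divide power4_eq_xxxx power3_eq_cube field_simps)
    ultimately show ?thesis by simp
  qed
  then have "(\<Sum>i\<in>{1..n}. 4 * (\<bar>v i\<bar> * out_abs v i ^ 3)) \<le> (\<Sum>i\<in>{1..n}. k ^ 3 * v i ^ 4 + 3 * out_abs v i ^ 4 / k)"
    by (intro sum_mono)
  also have "\<dots> = k ^ 3 * fourth_sum v + 3 * (\<Sum>i\<in>{1..n}. out_abs v i ^ 4) / k"
    by (simp add: fourth_sum_def sum.distrib sum_distrib_left sum_divide_distrib)
  also have "\<dots> \<le> k ^ 3 * fourth_sum v + 3 * (k ^ 4 * fourth_sum v) / k"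
    by (intro add_mono divide_right_mono mult_left_mono sum_out_fourth) auto
  also have "\<dots> = 4 * (k ^ 3 * fourth_sum v)" by (simp add: power4_eq_xxxx power3_eq_cube)
  finally show ?thesis by (simp add: sum_distrib_left[symmetric])
qed

text \<open>The weight \<open>k\<^sup>2\<close> in the mean inequality balances the two kinds of indices: the pair \<open>(i, l)\<close>
  costs \<open>k\<^sup>3\<close>, and the members of \<open>A2 i l\<close> cost \<open>k * t\<close>.\<close>

lemma sum_pair_abs_square:
  "(\<Sum>i\<in>{1..n}. \<Sum>l\<in>A i. \<bar>v i\<bar> * \<bar>v l\<bar> * (pair_abs v i l)\<^sup>2) \<le> k * (k\<^sup>2 + t) * fourth_sum v"
proof -
  have *: "4 * (\<bar>v i\<bar> * \<bar>v l\<bar> * (pair_abs v i l)\<^sup>2) \<le> k^2 * v i ^ 4 + k^2 * v l ^ 4 + 2 * k * (\<Sum>m\<in>A2 i l. v m ^ 4)"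
    if il: "i \<in> {1..n}" "l \<in> A i" for i l
  proof -
    have p4: "pair_abs v i l ^ 4 \<le> k ^ 3 * (\<Sum>m\<in>A2 i l. v m ^ 4)"
      using fourth_sum_le[of "A2 i l" k "\<lambda>m. \<bar>v m\<bar>"] il by (simp add: pair_abs_def card_A2)
    have s: "2 * (\<bar>v i\<bar> * \<bar>v l\<bar>) \<le> (v i)\<^sup>2 + (v l)\<^sup>2" using sum_squares_bound[of "\<bar>v i\<bar>" "\<bar>v l\<bar>"] by simp
    have "2 * (((v i)\<^sup>2 + (v l)\<^sup>2) * (pair_abs v i l)\<^sup>2) \<le>
      (k\<^sup>2 * v i ^ 4 + pair_abs v i l ^ 4 / k^2) + (k\<^sup>2 * v l ^ 4 + pair_abs v i l ^ 4 / k^2)"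
      using weighted_square[of "k^2" "(v i)\<^sup>2" "(pair_abs v i l)\<^sup>2"]
        weighted_square[of "k^2" "(v l)\<^sup>2" "(pair_abs v i l)\<^sup>2"] by (simp add: distrib_right)
    moreover have "pair_abs v i l ^ 4 / k^2 \<le> k * (\<Sum>m\<in>A2 i l. v m ^ 4)"
      using p4 by (simp add: divide_le_eq power2_eq_square power3_eq_cube mult_ac)
    moreover have "4 * (\<bar>v i\<bar> * \<bar>v l\<bar> * (pair_abs v i l)\<^sup>2) \<le> 2 * (((v i)\<^sup>2 + (v l)\<^sup>2) * (pair_abs v i l)\<^sup>2)"
      using mult_right_mono[OF s, of "2 * (pair_abs v i l)\<^sup>2"] by (simp add: mult_ac)
    ultimately show ?thesis by linarith
  qed
  have "4 * (\<Sum>i\<in>{1..n}. \<Sum>l\<in>A i. \<bar>v i\<bar> * \<bar>v l\<bar> * (pair_abs v i l)\<^sup>2) =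
     (\<Sum>i\<in>{1..n}. \<Sum>l\<in>A i. 4 * (\<bar>v i\<bar> * \<bar>v l\<bar> * (pair_abs v i l)\<^sup>2))"
    by (simp only: sum_distrib_left)
  also have "\<dots> \<le>
     (\<Sum>i\<in>{1..n}. \<Sum>l\<in>A i. k^2 * v i ^ 4 + k^2 * v l ^ 4 + 2 * k * (\<Sum>m\<in>A2 i l. v m ^ 4))"
    by (intro sum_mono *)
  also have "\<dots> = k^2 * (\<Sum>i\<in>{1..n}. \<Sum>l\<in>A i. v i ^ 4) + k^2 * (\<Sum>i\<in>{1..n}. \<Sum>l\<in>A i. v l ^ 4)
     + 2 * k * (\<Sum>i\<in>{1..n}. \<Sum>l\<in>A i. \<Sum>m\<in>A2 i l. v m ^ 4)"
    by (simp add: sum.distrib sum_distrib_left mult_ac)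
  also have "\<dots> \<le> k^2 * (k * fourth_sum v) + k^2 * (k * fourth_sum v) + 2 * k * (t * fourth_sum v)"
    unfolding fourth_sum_def
    by (intro add_mono mult_left_mono sum_nbhd_centre_le sum_nbhd_member_le sum_pair_member_le) auto
  also have "\<dots> \<le> 4 * (k * (k\<^sup>2 + t) * fourth_sum v)"
    using t_nonneg by (simp add: algebra_simps power2_eq_square)
  finally show ?thesis by simp
qed

text \<open>The quadruples \<open>(i, l, m, p)\<close> collected here, with \<open>m\<close> in \<open>A2 i l\<close> and with \<open>p\<close> a neighbour of
  \<open>m\<close> on either side, are those for which the products \<open>X i * X l\<close> and \<open>X m * X p\<close> may be
  correlated. The sum bounds the variance of every sum over neighbouring pairs.\<close>

lemma sum_dependent_quadruples:
  "(\<Sum>i\<in>{1..n}. \<Sum>l\<in>A i. \<Sum>m\<in>A2 i l. \<bar>v i\<bar> * \<bar>v l\<bar> * (\<bar>v m\<bar> * (out_abs v m + in_abs v m)))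
     \<le> 2 * (k * (k\<^sup>2 + t) * fourth_sum v)"
proof -
  let ?c = "\<lambda>m. out_abs v m + in_abs v m"
  have *: "\<bar>v i\<bar> * \<bar>v l\<bar> * (\<bar>v m\<bar> * ?c m) \<le> k / 4 * (v i ^ 4 + v l ^ 4) + (v m)\<^sup>2 * (?c m)\<^sup>2 / (2 * k)" for i l m
  proof -
    have "2 * ((\<bar>v i\<bar> * \<bar>v l\<bar>) * (\<bar>v m\<bar> * ?c m)) \<le> k * (\<bar>v i\<bar> * \<bar>v l\<bar>)\<^sup>2 + (\<bar>v m\<bar> * ?c m)\<^sup>2 / k"
      by (rule weighted_square) simp
    moreover have "(\<bar>v i\<bar> * \<bar>v l\<bar>)\<^sup>2 \<le> (v i ^ 4 + v l ^ 4) / 2"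
      using sum_squares_bound[of "(v i)\<^sup>2" "(v l)\<^sup>2"] by (simp add: power_mult_distrib)
    then have "k * (\<bar>v i\<bar> * \<bar>v l\<bar>)\<^sup>2 \<le> k * ((v i ^ 4 + v l ^ 4) / 2)" by (intro mult_left_mono) auto
    moreover have "(\<bar>v m\<bar> * ?c m)\<^sup>2 / k = 2 * ((v m)\<^sup>2 * (?c m)\<^sup>2 / (2 * k))" by (simp add: power_mult_distrib)
    moreover have "k * ((v i ^ 4 + v l ^ 4) / 2) = 2 * (k / 4 * (v i ^ 4 + v l ^ 4))" by simp
    ultimately show ?thesis by linarith
  qed
  have "(\<Sum>i\<in>{1..n}. \<Sum>l\<in>A i. \<Sum>m\<in>A2 i l. \<bar>v i\<bar> * \<bar>v l\<bar> * (\<bar>v m\<bar> * ?c m)) \<le>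
    (\<Sum>i\<in>{1..n}. \<Sum>l\<in>A i. \<Sum>m\<in>A2 i l. k / 4 * (v i ^ 4 + v l ^ 4) + (v m)\<^sup>2 * (?c m)\<^sup>2 / (2 * k))"
    by (intro sum_mono *)
  also have "\<dots> = (\<Sum>i\<in>{1..n}. \<Sum>l\<in>A i. real (card (A2 i l)) * (k / 4 * (v i ^ 4 + v l ^ 4)))
      + (\<Sum>i\<in>{1..n}. \<Sum>l\<in>A i. \<Sum>m\<in>A2 i l. (v m)\<^sup>2 * (?c m)\<^sup>2) / (2 * k)"
    by (simp add: sum.distrib sum_divide_distrib)
  also have "\<dots> \<le> (\<Sum>i\<in>{1..n}. \<Sum>l\<in>A i. k * (k / 4 * (v i ^ 4 + v l ^ 4)))
      + (t * (\<Sum>m\<in>{1..n}. (v m)\<^sup>2 * (?c m)\<^sup>2)) / (2 * k)"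
    by (intro add_mono sum_mono mult_right_mono card_A2 divide_right_mono sum_pair_member_le) auto
  also have "\<dots> \<le> (k * (k / 4)) * (k * fourth_sum v + k * fourth_sum v) + (t * (4 * k\<^sup>2 * fourth_sum v)) / (2 * k)"
  proof (intro add_mono divide_right_mono mult_left_mono sum_square_out_in)
    have "(\<Sum>i\<in>{1..n}. \<Sum>l\<in>A i. k * (k / 4 * (v i ^ 4 + v l ^ 4))) =
        (k * (k / 4)) * ((\<Sum>i\<in>{1..n}. \<Sum>l\<in>A i. v i ^ 4) + (\<Sum>i\<in>{1..n}. \<Sum>l\<in>A i. v l ^ 4))"
      by (simp add: sum.distrib sum_distrib_left distrib_left mult_ac)
    also have "\<dots> \<le> (k * (k / 4)) * (k * fourth_sum v + k * fourth_sum v)"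
      unfolding fourth_sum_def
      by (intro add_mono mult_left_mono sum_nbhd_centre_le sum_nbhd_member_le) auto
    finally show "(\<Sum>i\<in>{1..n}. \<Sum>l\<in>A i. k * (k / 4 * (v i ^ 4 + v l ^ 4))) \<le> (k * (k / 4)) * (k * fourth_sum v + k * fourth_sum v)" .
  qed (auto simp: t_nonneg)
  also have "\<dots> = k ^ 3 / 2 * fourth_sum v + 2 * k * t * fourth_sum v"
    by (simp add: field_simps power2_eq_square power3_eq_cube)
  also have "\<dots> \<le> 2 * (k * (k\<^sup>2 + t) * fourth_sum v)"
    by (simp add: algebra_simps power2_eq_square power3_eq_cube)
  finally show ?thesis .
qed

end

section \<open>The Stein equation for the normal law\<close>

lemma std_normal_density_deriv:
  "(std_normal_density has_real_derivative (- w * std_normal_density w)) (at w)"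
proof -
  define c where "c = 1 / sqrt (2 * pi)"
  have eq: "std_normal_density = (\<lambda>x. c * exp (- x\<^sup>2 / 2))"
    by (simp add: fun_eq_iff std_normal_density_def c_def)
  show ?thesis unfolding eq by (auto intro!: derivative_eq_intros)
qed

text \<open>Mills' ratio: replace \<open>w\<close> by the larger integration variable \<open>x\<close>; then the integrand \<open>x * std_normal_density x\<close>
  has the primitive \<open>- std_normal_density x\<close>.\<close>

lemma normal_tail_mills:
  assumes "0 < w"
  shows "w * (\<integral>x. indicator {w..} x * std_normal_density x \<partial>lborel) \<le> std_normal_density w"
proof -
  have d: "DERIV (\<lambda>x. - std_normal_density x) x :> x * std_normal_density x" for x
    using DERIV_minus[OF std_normal_density_deriv[of x]] by simp
  have lim: "((\<lambda>x. - std_normal_density x) \<longlongrightarrow> 0) at_top"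
    unfolding std_normal_density_def by real_asymp
  have i: "integrable lborel (\<lambda>x. indicator {w..} x * (w * std_normal_density x))"
    using integrable_real_mult_indicator[of "{w..}" lborel "\<lambda>x. w * std_normal_density x"] by (simp add: mult.commute)
  have "ennreal (\<integral>x. indicator {w..} x * (w * std_normal_density x) \<partial>lborel)
      = (\<integral>\<^sup>+x. ennreal (indicator {w..} x * (w * std_normal_density x)) \<partial>lborel)"
    using assms by (intro nn_integral_eq_integral[symmetric] i) auto
  also have "\<dots> \<le> (\<integral>\<^sup>+x. ennreal (x * std_normal_density x) * indicator {w..} x \<partial>lborel)"
    using assms by (intro nn_integral_mono) (auto simp: indicator_def intro!: ennreal_leI mult_right_mono)
  also have "\<dots> = 0 - (- std_normal_density w)"
    using assms d lim by (intro nn_integral_FTC_atLeast) (auto intro: mult_nonneg_nonneg)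
  finally have "(\<integral>x. indicator {w..} x * (w * std_normal_density x) \<partial>lborel) \<le> std_normal_density w"
    by simp
  then show ?thesis by (simp add: mult.left_commute)
qed

lemma normal_density_ge: "\<bar>w\<bar> \<le> 1 \<Longrightarrow> 1 \<le> 6 * std_normal_density w"
proof -
  assume w: "\<bar>w\<bar> \<le> 1"
  have "w\<^sup>2 \<le> 1" using w by (simp add: abs_square_le_1)
  then have 1: "exp (- w\<^sup>2 / 2) \<ge> exp (- (1/2))" by simp
  have "exp (1/2) \<le> (2::real)"
  proof (rule power2_le_imp_le)
    have "exp (1/2::real) ^ 2 = exp 1" by (simp add: power2_eq_square exp_add[symmetric])
    then show "exp (1/2::real) ^ 2 \<le> 2 ^ 2" using exp_le by simp
  qed simp
  then have 2: "exp (- (1/2)) \<ge> (1/2::real)" by (simp add: exp_minus field_simps)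
  have 3: "sqrt (2 * pi) \<le> 3" using pi_less_4 by (intro real_le_lsqrt) auto
  have "1 \<le> 6 * (1 / 3) * (1 / 2 :: real)" by simp
  also have "\<dots> \<le> 6 * (1 / sqrt (2 * pi)) * exp (- w\<^sup>2 / 2)"
    using order_trans[OF 2 1] 3 by (intro mult_mono) (auto simp: field_simps)
  finally show ?thesis by (simp add: std_normal_density_def)
qed

lemma integrable_normal_mult:
  assumes "g \<in> borel_measurable borel" "\<And>x. \<bar>g x\<bar> \<le> c"
  shows "integrable lborel (\<lambda>x. g x * std_normal_density x)"
proof (rule Bochner_Integration.integrable_bound)
  show "integrable lborel (\<lambda>x. c * std_normal_density x)" by simp
  show "(\<lambda>x. g x * std_normal_density x) \<in> borel_measurable lborel" using assms(1) by simp
  show "AE x in lborel. norm (g x * std_normal_density x) \<le> norm (c * std_normal_density x)"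
    using assms(2) by (auto simp: abs_mult intro!: mult_right_mono order_trans[OF assms(2)])
qed

lemma normal_upper_tail_le:
  assumes "g \<in> borel_measurable borel" "\<And>x. \<bar>g x\<bar> \<le> 1" "0 < w"
  shows "\<bar>w * (\<integral>x. indicator {w..} x * (g x * std_normal_density x) \<partial>lborel)\<bar> \<le> std_normal_density w"
proof -
  have i: "integrable lborel (\<lambda>x. indicator {w..} x * (g x * std_normal_density x))"
    using integrable_real_mult_indicator[OF _ integrable_normal_mult[OF assms(1,2)], of "{w..}"]
    by (simp add: mult.commute)
  have i2: "integrable lborel (\<lambda>x. indicator {w..} x * std_normal_density x)"
    using integrable_real_mult_indicator[of "{w..}" lborel std_normal_density] by (simp add: mult.commute)
  have "\<bar>\<integral>x. indicator {w..} x * (g x * std_normal_density x) \<partial>lborel\<bar>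
     \<le> (\<integral>x. \<bar>indicator {w..} x * (g x * std_normal_density x)\<bar> \<partial>lborel)"
    by (rule integral_abs_bound)
  also have "\<dots> \<le> (\<integral>x. indicator {w..} x * std_normal_density x \<partial>lborel)"
    using assms(2) by (intro integral_mono integrable_abs i i2)
      (auto simp: indicator_def abs_mult intro!: mult_left_le_one_le)
  finally have "w * \<bar>\<integral>x. indicator {w..} x * (g x * std_normal_density x) \<partial>lborel\<bar>
     \<le> w * (\<integral>x. indicator {w..} x * std_normal_density x \<partial>lborel)"
    using assms(3) by (intro mult_left_mono) auto
  also have "\<dots> \<le> std_normal_density w" using normal_tail_mills[OF assms(3)] .
  finally show ?thesis using assms(3) by (simp add: abs_mult)
qed

lemma normal_lower_tail_le:
  assumes "g \<in> borel_measurable borel" "\<And>x. \<bar>g x\<bar> \<le> 1" "w < 0"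
  shows "\<bar>w * (\<integral>x. indicator {..w} x * (g x * std_normal_density x) \<partial>lborel)\<bar> \<le> std_normal_density w"
proof -
  have "(\<integral>x. indicator {..w} x * (g x * std_normal_density x) \<partial>lborel)
     = (\<integral>x. indicator {..w} (0 + (-1) * x) * (g (0 + (-1) * x) * std_normal_density (0 + (-1) * x)) \<partial>lborel)"
    by (subst lborel_integral_real_affine[where c="-1" and t=0]) auto
  also have "\<dots> = (\<integral>x. indicator {-w..} x * (g (- x) * std_normal_density x) \<partial>lborel)"
    by (intro Bochner_Integration.integral_cong) (auto simp: indicator_def std_normal_density_def)
  finally have eq: "(\<integral>x. indicator {..w} x * (g x * std_normal_density x) \<partial>lborel)
     = (\<integral>x. indicator {-w..} x * (g (- x) * std_normal_density x) \<partial>lborel)" .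
  have "\<bar>(- w) * (\<integral>x. indicator {-w..} x * (g (- x) * std_normal_density x) \<partial>lborel)\<bar> \<le> std_normal_density (- w)"
    using assms by (intro normal_upper_tail_le) auto
  then show ?thesis unfolding eq by (simp add: std_normal_density_def)
qed

text \<open>The solution is the integral of \<open>(h x - E h) * std_normal_density x\<close> up to \<open>w\<close>, divided by the density at
  \<open>w\<close>. Since the integrand has total integral \<open>0\<close>, the numerator is also a tail integral on either side, and Mills'
  ratio bounds it for large \<open>\<bar>w\<bar>\<close>; for \<open>\<bar>w\<bar> \<le> 1\<close> the density is at least \<open>1 / 6\<close>.\<close>

theorem stein_solution:
  fixes h :: "real \<Rightarrow> real"
  assumes cont: "continuous_on UNIV h" and h01: "\<And>x. 0 \<le> h x" "\<And>x. h x \<le> 1"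
  obtains f where "\<And>w. (f has_real_derivative (w * f w + h w - (\<integral>x. h x * std_normal_density x \<partial>lborel))) (at w)"
    "\<And>w. \<bar>f w\<bar> \<le> 6" "\<And>w. \<bar>w * f w\<bar> \<le> 6"
    "0 \<le> (\<integral>x. h x * std_normal_density x \<partial>lborel)" "(\<integral>x. h x * std_normal_density x \<partial>lborel) \<le> 1"
proof -
  define c where "c = (\<integral>x. h x * std_normal_density x \<partial>lborel)"
  have hm [measurable]: "h \<in> borel_measurable borel" using cont by (rule borel_measurable_continuous_onI)
  have ih: "integrable lborel (\<lambda>x. h x * std_normal_density x)"
    using h01 by (intro integrable_normal_mult[of _ 1]) (auto simp: abs_le_iff intro: order_trans[of _ 0])
  have c0: "0 \<le> c" unfolding c_def using h01 by (intro integral_nonneg_AE) auto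
  have "c \<le> (\<integral>x. std_normal_density x \<partial>lborel)" unfolding c_def
    using h01 by (intro integral_mono[OF ih]) (auto intro: mult_left_le_one_le)
  then have c1: "c \<le> 1" by simp
  define g where "g x = h x - c" for x
  have gm [measurable]: "g \<in> borel_measurable borel" unfolding g_def by measurable
  have g1: "\<bar>g x\<bar> \<le> 1" for x using h01[of x] c0 c1 by (simp add: g_def abs_le_iff)
  have ig: "integrable lborel (\<lambda>x. g x * std_normal_density x)"
    by (rule integrable_normal_mult[OF gm g1])
  have ii: "integrable lborel (\<lambda>x. indicator S x * (g x * std_normal_density x))" if "S \<in> sets borel" for S
    using integrable_real_mult_indicator[OF _ ig, of S] that by (simp add: mult.commute)
  have total: "(\<integral>x. g x * std_normal_density x \<partial>lborel) = 0"
    unfolding g_def left_diff_distrib by (subst Bochner_Integration.integral_diff[OF ih]) (auto simp: c_def)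
  define G where "G w = (\<integral>x. indicator {..w} x * (g x * std_normal_density x) \<partial>lborel)" for w
  have G_upper: "G w = - (\<integral>x. indicator {w..} x * (g x * std_normal_density x) \<partial>lborel)" for w
  proof -
    have "G w + (\<integral>x. indicator {w..} x * (g x * std_normal_density x) \<partial>lborel) =
      (\<integral>x. indicator {..w} x * (g x * std_normal_density x) + indicator {w..} x * (g x * std_normal_density x) \<partial>lborel)"
      unfolding G_def by (subst Bochner_Integration.integral_add) (auto intro: ii)
    also have "\<dots> = (\<integral>x. g x * std_normal_density x \<partial>lborel)"
    proof (rule integral_cong_AE)
      show "AE x in lborel. indicator {..w} x * (g x * std_normal_density x) + indicator {w..} x * (g x * std_normal_density x)
         = g x * std_normal_density x"
        using AE_lborel_singleton[of w] by eventually_elim (auto simp: indicator_def)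
    qed auto
    finally show ?thesis using total by simp
  qed
  have G_interval: "G b - G a = integral {a..b} (\<lambda>x. g x * std_normal_density x)" if "a \<le> b" for a b
  proof -
    have "G b = (\<integral>x. indicator {..a} x * (g x * std_normal_density x) + indicator {a..b} x * (g x * std_normal_density x) \<partial>lborel)"
      unfolding G_def
    proof (rule integral_cong_AE)
      show "AE x in lborel. indicator {..b} x * (g x * std_normal_density x) =
         indicator {..a} x * (g x * std_normal_density x) + indicator {a..b} x * (g x * std_normal_density x)"
        using AE_lborel_singleton[of a] by eventually_elim (use that in \<open>auto simp: indicator_def\<close>)
    qed auto
    also have "\<dots> = G a + (\<integral>x. indicator {a..b} x * (g x * std_normal_density x) \<partial>lborel)"
      unfolding G_def by (subst Bochner_Integration.integral_add) (auto intro: ii)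
    also have "(\<integral>x. indicator {a..b} x * (g x * std_normal_density x) \<partial>lborel) = integral {a..b} (\<lambda>x. g x * std_normal_density x)"
      using set_borel_integral_eq_integral(2)[of "{a..b}" "\<lambda>x. g x * std_normal_density x"] ii[of "{a..b}"]
      by (simp add: set_integrable_def set_lebesgue_integral_def)
    finally show ?thesis by simp
  qed
  have cg: "continuous_on S (\<lambda>x. g x * std_normal_density x)" for S
    unfolding g_def std_normal_density_def
    by (intro continuous_intros continuous_on_subset[OF cont]) auto
  have G_deriv: "(G has_real_derivative (g w * std_normal_density w)) (at w)" for w
  proof -
    have "((\<lambda>u. integral {w-1..u} (\<lambda>x. g x * std_normal_density x)) has_vector_derivative (g w * std_normal_density w))
       (at w within {w-1..w+1})"
      by (rule integral_has_vector_derivative[OF cg]) auto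
    then have "((\<lambda>u. G (w-1) + integral {w-1..u} (\<lambda>x. g x * std_normal_density x)) has_vector_derivative (g w * std_normal_density w))
       (at w within {w-1..w+1})"
      by (auto intro!: derivative_eq_intros)
    then have "(G has_vector_derivative (g w * std_normal_density w)) (at w within {w-1..w+1})"
    proof (rule has_vector_derivative_transform[rotated 2])
      show "w \<in> {w-1..w+1}" by simp
      fix u assume "u \<in> {w-1..w+1}"
      then show "G u = G (w-1) + integral {w-1..u} (\<lambda>x. g x * std_normal_density x)"
        using G_interval[of "w-1" u] by simp
    qed
    then show ?thesis
      by (simp add: has_real_derivative_iff_has_vector_derivative at_within_Icc_at)
  qed
  define f where "f w = G w / std_normal_density w" for w
  have pos: "0 < std_normal_density w" for w by (simp add: std_normal_density_def)
  have deriv: "(f has_real_derivative (w * f w + h w - c)) (at w)" for w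
  proof -
    have "(f has_real_derivative ((g w * std_normal_density w) * std_normal_density w - G w * (- w * std_normal_density w)) /
        (std_normal_density w * std_normal_density w)) (at w)"
      unfolding f_def using pos[of w] by (intro DERIV_divide G_deriv std_normal_density_deriv) auto
    also have "((g w * std_normal_density w) * std_normal_density w - G w * (- w * std_normal_density w)) /
        (std_normal_density w * std_normal_density w) = w * f w + h w - c"
      using pos[of w] by (simp add: f_def g_def field_simps)
    finally show ?thesis .
  qed
  have wf: "\<bar>w * G w\<bar> \<le> std_normal_density w" if "w \<noteq> 0" for w
  proof (cases "w > 0")
    case True
    then show ?thesis using normal_upper_tail_le[OF gm g1 True] by (simp add: G_upper)
  next
    case False
    then have "w < 0" using that by simp
    then show ?thesis using normal_lower_tail_le[OF gm g1] by (simp add: G_def)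
  qed
  have G1: "\<bar>G w\<bar> \<le> 1" for w
  proof -
    have "\<bar>G w\<bar> \<le> (\<integral>x. \<bar>indicator {..w} x * (g x * std_normal_density x)\<bar> \<partial>lborel)"
      unfolding G_def by (rule integral_abs_bound)
    also have "\<dots> \<le> (\<integral>x. std_normal_density x \<partial>lborel)"
      using g1 ii[of "{..w}"] by (intro integral_mono integrable_abs) (auto simp: indicator_def abs_mult intro: mult_left_le_one_le)
    finally show ?thesis by simp
  qed
  have small: "\<bar>f w\<bar> \<le> 6" if "\<bar>w\<bar> \<le> 1" for w
    using G1[of w] normal_density_ge[OF that] pos[of w] by (simp add: f_def divide_le_eq)
  have wf1: "\<bar>w * f w\<bar> \<le> 1" if "w \<noteq> 0" for w
    using wf[OF that] pos[of w] by (simp add: f_def abs_mult field_simps)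
  have large: "\<bar>f w\<bar> \<le> 6" if "\<not> \<bar>w\<bar> \<le> 1" for w
  proof -
    have "\<bar>f w\<bar> \<le> \<bar>w\<bar> * \<bar>f w\<bar>" using mult_right_mono[of 1 "\<bar>w\<bar>" "\<bar>f w\<bar>"] that by simp
    then show ?thesis using wf1[of w] that by (cases "w = 0") (auto simp: abs_mult)
  qed
  show ?thesis
  proof (rule that[of f, folded c_def])
    show "\<bar>w * f w\<bar> \<le> 6" for w using wf1[of w] by (cases "w = 0") auto
    show "\<bar>f w\<bar> \<le> 6" for w using small large by blast
  qed (use deriv c0 c1 in auto)
qed

section \<open>The truncated inverse root\<close>

text \<open>The statistic divides by the root of a random variable that is close to \<open>1\<close> with high
  probability. Clamping it to the interval from \<open>1 / 4\<close> to \<open>4\<close> makes the division Lipschitz, and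
  the interval is chosen so that its roots are rational.\<close>

definition quarter_clamp :: "real \<Rightarrow> real" where "quarter_clamp t = max (1 / 4) (min 4 t)"
definition inv_root :: "real \<Rightarrow> real" where "inv_root t = 1 / sqrt (quarter_clamp t)"

lemma quarter_clamp_bounds: "1 / 4 \<le> quarter_clamp t" "quarter_clamp t \<le> 4" by (auto simp: quarter_clamp_def)

lemma sqrt_clamp_bounds: "1 / 2 \<le> sqrt (quarter_clamp t)" "sqrt (quarter_clamp t) \<le> 2"
proof -
  show "1 / 2 \<le> sqrt (quarter_clamp t)" using quarter_clamp_bounds(1)[of t] by (intro real_le_rsqrt) (simp add: power2_eq_square)
  show "sqrt (quarter_clamp t) \<le> 2" using quarter_clamp_bounds[of t] by (intro real_le_lsqrt) auto
qed

lemma inv_root_bounds: "0 < inv_root t" "inv_root t \<le> 2"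
proof -
  have "0 < sqrt (quarter_clamp t)" using sqrt_clamp_bounds(1)[of t] by linarith
  then show "0 < inv_root t" "inv_root t \<le> 2"
    using sqrt_clamp_bounds(1)[of t] by (auto simp: inv_root_def divide_le_eq)
qed

lemma inv_root_lipschitz: "\<bar>inv_root s - inv_root t\<bar> \<le> 4 * \<bar>s - t\<bar>"
proof -
  define a b where "a = sqrt (quarter_clamp s)" and "b = sqrt (quarter_clamp t)"
  have ab: "1 / 2 \<le> a" "1 / 2 \<le> b" using sqrt_clamp_bounds by (auto simp: a_def b_def)
  have sq: "a * a = quarter_clamp s" "b * b = quarter_clamp t" using quarter_clamp_bounds(1)[of s] quarter_clamp_bounds(1)[of t] by (auto simp: a_def b_def)
  have "1 / 4 \<le> a * b" using mult_mono[OF ab] ab by simp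
  have "inv_root s - inv_root t = (b - a) / (a * b)"
    using ab by (simp add: inv_root_def a_def[symmetric] b_def[symmetric] field_simps)
  then have "\<bar>inv_root s - inv_root t\<bar> = \<bar>b - a\<bar> / (a * b)" using ab by (simp add: abs_mult)
  also have "\<dots> \<le> \<bar>b - a\<bar> / (1 / 4)" using \<open>1 / 4 \<le> a * b\<close> by (intro divide_left_mono) auto
  also have "\<dots> \<le> 4 * (\<bar>b - a\<bar> * (b + a))" using ab mult_left_mono[of 1 "b + a" "\<bar>b - a\<bar>"] by (simp add: mult.commute)
  also have "\<bar>b - a\<bar> * (b + a) = \<bar>(b - a) * (b + a)\<bar>" using ab by (simp add: abs_mult)
  also have "(b - a) * (b + a) = quarter_clamp t - quarter_clamp s" using sq by (simp add: algebra_simps)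
  also have "\<bar>quarter_clamp t - quarter_clamp s\<bar> \<le> \<bar>s - t\<bar>" unfolding quarter_clamp_def by linarith
  finally show ?thesis by simp
qed

lemma inv_root_square: "(inv_root t)\<^sup>2 = 1 / quarter_clamp t"
  using quarter_clamp_bounds(1)[of t] by (simp add: inv_root_def power_divide)

lemma inv_root_square_le: "(inv_root t)\<^sup>2 \<le> 4"
  using inv_root_bounds[of t] power_mono[of "inv_root t" 2 2] by simp

text \<open>Inside the interval the left-hand side vanishes. This exact cancellation is what
  self-normalisation gains in Stein's identity.\<close>

lemma inv_root_normalises: "\<bar>t * (inv_root t)\<^sup>2 - 1\<bar> \<le> 4 * \<bar>t - 1\<bar>"
proof -
  have "t * (inv_root t)\<^sup>2 - 1 = (t - quarter_clamp t) / quarter_clamp t"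
    using quarter_clamp_bounds(1)[of t] by (simp add: inv_root_square field_simps)
  then have "\<bar>t * (inv_root t)\<^sup>2 - 1\<bar> = \<bar>t - quarter_clamp t\<bar> / quarter_clamp t"
    using quarter_clamp_bounds(1)[of t] by simp
  also have "\<dots> \<le> \<bar>t - quarter_clamp t\<bar> / (1 / 4)" using quarter_clamp_bounds(1)[of t] by (intro divide_left_mono) auto
  also have "\<dots> \<le> 4 * \<bar>t - 1\<bar>" unfolding quarter_clamp_def by (simp add: max_def min_def)
  finally show ?thesis .
qed

lemma inv_root_measurable [measurable]: "inv_root \<in> borel_measurable borel"
  unfolding inv_root_def quarter_clamp_def by measurable

section \<open>A kernel for Taylor remainders\<close>

text \<open>Let \<open>g\<close> be a function with values between \<open>0\<close> and \<open>1\<close> that varies only near a point \<open>e\<close> and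
  on the scale \<open>al\<close>. Then \<open>kern al \<bar>v\<bar> \<bar>u - e\<bar>\<close> bounds the Taylor remainder of a primitive of \<open>g\<close> for a step
  from \<open>u\<close> to \<open>u + v\<close>: an increment of \<open>g\<close> of size at most \<open>min 1 (\<bar>v\<bar> / al)\<close>, which is present only if the
  step can reach the critical zone.\<close>

definition kern :: "real \<Rightarrow> real \<Rightarrow> real \<Rightarrow> real" where
  "kern al y d = (if d \<le> 4 * max al y then y * min 1 (y / al) else 0)"

lemma kern_nonneg: "0 < al \<Longrightarrow> 0 \<le> y \<Longrightarrow> 0 \<le> kern al y d"
  by (simp add: kern_def)

lemma kern_le: "0 < al \<Longrightarrow> 0 \<le> y \<Longrightarrow> kern al y d \<le> y"
  by (simp add: kern_def mult_left_le)

lemma kern_mono: "0 < al \<Longrightarrow> 0 \<le> y \<Longrightarrow> y \<le> y' \<Longrightarrow> kern al y d \<le> kern al y' d"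
  by (auto simp: kern_def intro!: mult_mono min.mono divide_right_mono)

text \<open>This is the step that makes pairwise independence suffice. If the sum of the \<open>a l\<close> is large enough to
  reach the critical zone, then the terms with \<open>k * a l\<close> at least half of the sum carry half of it, and
  each of these can reach the zone on its own after multiplication by \<open>2 * k\<close>. So the indicator, which
  depended on the whole sum over a neighbourhood, now depends on a single summand.\<close>

lemma kern_sum_le:
  fixes a :: "'b \<Rightarrow> real"
  assumes S: "finite S" "real (card S) \<le> k" and a: "\<And>l. l \<in> S \<Longrightarrow> 0 \<le> a l" and al: "0 < al" and k: "1 \<le> k"
  shows "kern al (\<Sum>l\<in>S. a l) d
    \<le> 4 * (\<Sum>l\<in>S. if d \<le> 8 * max al (k * a l) then a l * min 1 (k * a l / al) else 0)"
proof (cases "d \<le> 4 * max al (\<Sum>l\<in>S. a l)")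
  case True
  define s where "s = (\<Sum>l\<in>S. a l)"
  define L where "L = {l\<in>S. s / 2 \<le> k * a l}"
  have s0: "0 \<le> s" unfolding s_def using a by (simp add: sum_nonneg)
  have "(\<Sum>l\<in>S - L. a l) \<le> (\<Sum>l\<in>S - L. s / (2 * k))"
  proof (rule sum_mono)
    fix l assume "l \<in> S - L"
    then have "k * a l \<le> s / 2" by (auto simp: L_def)
    then show "a l \<le> s / (2 * k)" using k by (simp add: pos_le_divide_eq mult_ac)
  qed
  also have "\<dots> = real (card (S - L)) * (s / (2 * k))" by simp
  also have "\<dots> \<le> k * (s / (2 * k))"
    using S s0 k card_mono[of S "S - L"] by (intro mult_right_mono) auto
  also have "\<dots> = s / 2" using k by simp
  finally have "(\<Sum>l\<in>S - L. a l) \<le> s / 2" .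
  then have half: "s / 2 \<le> (\<Sum>l\<in>L. a l)"
  proof -
    have "L \<subseteq> S" by (auto simp: L_def)
    then have "s = (\<Sum>l\<in>S - L. a l) + (\<Sum>l\<in>L. a l)" unfolding s_def using S(1) by (rule sum.subset_diff)
    with \<open>(\<Sum>l\<in>S - L. a l) \<le> s / 2\<close> show ?thesis by linarith
  qed
  have "kern al s d = s * min 1 (s / al)" using True by (simp add: kern_def s_def)
  also have "\<dots> \<le> (2 * (\<Sum>l\<in>L. a l)) * min 1 (s / al)" using half s0 al by (intro mult_right_mono) auto
  also have "\<dots> = (\<Sum>l\<in>L. 2 * (a l * min 1 (s / al)))" by (simp add: sum_distrib_left sum_distrib_right mult_ac)
  also have "\<dots> \<le> (\<Sum>l\<in>L. 4 * (if d \<le> 8 * max al (k * a l) then a l * min 1 (k * a l / al) else 0))"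
  proof (rule sum_mono)
    fix l assume l: "l \<in> L"
    then have l0: "0 \<le> a l" "s \<le> 2 * (k * a l)" using a by (auto simp: L_def)
    have "s \<le> 2 * max al (k * a l)" "al \<le> 2 * max al (k * a l)" using l0(2) al by linarith+
    then have "max al s \<le> 2 * max al (k * a l)" by simp
    then have d: "d \<le> 8 * max al (k * a l)" using True unfolding s_def[symmetric] by linarith
    have "s / al \<le> 2 * (k * a l) / al" using l0 al by (intro divide_right_mono) auto
    then have "s / al \<le> 2 * (k * a l / al)" by simp
    then have "min 1 (s / al) \<le> 2 * min 1 (k * a l / al)" by linarith
    then have "a l * min 1 (s / al) \<le> a l * (2 * min 1 (k * a l / al))" using l0 by (intro mult_left_mono)
    then show "2 * (a l * min 1 (s / al)) \<le> 4 * (if d \<le> 8 * max al (k * a l) then a l * min 1 (k * a l / al) else 0)"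
      using d by simp
  qed
  also have "\<dots> \<le> (\<Sum>l\<in>S. 4 * (if d \<le> 8 * max al (k * a l) then a l * min 1 (k * a l / al) else 0))"
  proof (rule sum_mono2[OF S(1)])
    show "0 \<le> 4 * (if d \<le> 8 * max al (k * a l) then a l * min 1 (k * a l / al) else 0)" if "l \<in> S - L" for l
    proof -
      have "0 \<le> a l" using a that by simp
      moreover from this have "0 \<le> k * a l / al" using k al by simp
      ultimately show ?thesis by simp
    qed
  qed (simp add: L_def)
  finally show ?thesis by (simp add: sum_distrib_left s_def)
next
  case False
  then have "kern al (\<Sum>l\<in>S. a l) d = 0" by (simp add: kern_def)
  also have "0 \<le> 4 * (\<Sum>l\<in>S. if d \<le> 8 * max al (k * a l) then a l * min 1 (k * a l / al) else 0)"
  proof (intro mult_nonneg_nonneg sum_nonneg)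
    show "0 \<le> (if d \<le> 8 * max al (k * a l) then a l * min 1 (k * a l / al) else 0)" if "l \<in> S" for l
    proof -
      have "0 \<le> a l" using a that by simp
      moreover from this have "0 \<le> k * a l / al" using k al by simp
      ultimately show ?thesis by simp
    qed
  qed simp
  finally show ?thesis .
qed

section \<open>Test functions\<close>

lemma taylor_remainder:
  fixes F g :: "real \<Rightarrow> real"
  assumes d: "\<And>x. (F has_real_derivative g x) (at x)"
    and B: "\<And>t. \<bar>t\<bar> \<le> \<bar>v\<bar> \<Longrightarrow> \<bar>g (u + t) - g u\<bar> \<le> B"
  shows "\<bar>F (u + v) - F u - v * g u\<bar> \<le> \<bar>v\<bar> * B"
proof -
  have "norm ((\<lambda>t. F (u + t) - t * g u) v - (\<lambda>t. F (u + t) - t * g u) 0) \<le> B * norm (v - 0)"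
  proof (rule field_differentiable_bound[where S="{-\<bar>v\<bar>..\<bar>v\<bar>}" and f'="\<lambda>t. g (u + t) - g u"])
    fix t assume t: "t \<in> {-\<bar>v\<bar>..\<bar>v\<bar>}"
    have "((\<lambda>t. F (u + t)) has_real_derivative g (u + t) * 1) (at t)"
      by (rule DERIV_chain2[OF d]) (auto intro!: derivative_eq_intros)
    then have "((\<lambda>t. F (u + t) - t * g u) has_real_derivative g (u + t) - g u) (at t)"
      by (auto intro!: derivative_eq_intros)
    then show "((\<lambda>t. F (u + t) - t * g u) has_real_derivative g (u + t) - g u) (at t within {-\<bar>v\<bar>..\<bar>v\<bar>})"
      by (rule has_field_derivative_at_within)
    show "norm (g (u + t) - g u) \<le> B" using B[of t] t by (auto simp: abs_le_iff)
  qed auto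
  then show ?thesis by (simp add: algebra_simps)
qed

lemma DERIV_from_quadratic_bound:
  fixes f :: "real \<Rightarrow> real"
  assumes "\<And>h. \<bar>f (x + h) - f x - h * D\<bar> \<le> h\<^sup>2"
  shows "(f has_real_derivative D) (at x)"
  unfolding DERIV_def
proof (subst Lim_null, rule tendsto_0_le[where K=1])
  show "((\<lambda>h. h) \<longlongrightarrow> 0) (at (0::real))" by (rule tendsto_ident_at)
  show "\<forall>\<^sub>F h in at 0. norm ((f (x + h) - f x) / h - D) \<le> norm h * 1"
    unfolding eventually_at_filter
  proof (intro always_eventually allI impI)
    fix h :: real assume h: "h \<noteq> 0"
    have "(f (x + h) - f x) / h - D = (f (x + h) - f x - h * D) / h" using h by (simp add: field_simps)
    then have "norm ((f (x + h) - f x) / h - D) = \<bar>f (x + h) - f x - h * D\<bar> / \<bar>h\<bar>" by simp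
    also have "\<dots> \<le> h\<^sup>2 / \<bar>h\<bar>" by (intro divide_right_mono assms) auto
    also have "\<dots> = norm h * 1" using h by (simp add: power2_eq_square abs_if)
    finally show "norm ((f (x + h) - f x) / h - D) \<le> norm h * 1" .
  qed
qed

lemma DERIV_pos_part_square: "((\<lambda>x. (max 0 x)\<^sup>2) has_real_derivative 2 * max 0 x) (at (x::real))"
proof (rule DERIV_from_quadratic_bound)
  fix h :: real
  consider "0 \<le> x" "0 \<le> x + h" | "0 \<le> x" "x + h < 0" | "x < 0" "0 \<le> x + h" | "x < 0" "x + h < 0" by linarith
  then show "\<bar>(max 0 (x + h))\<^sup>2 - (max 0 x)\<^sup>2 - h * (2 * max 0 x)\<bar> \<le> h\<^sup>2"
  proof cases
    case 1
    then show ?thesis by (simp add: power2_eq_square algebra_simps)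
  next
    case 2
    have "0 \<le> (x + h)\<^sup>2" by simp
    moreover have "x * h \<le> x * (- x)" using 2 by (intro mult_left_mono) auto
    moreover have "0 \<le> x * x" "0 \<le> h * h" by auto
    ultimately have "x * x + 2 * (x * h) \<le> h * h" "- (x * x) - 2 * (x * h) \<le> h * h"
      by (auto simp only: power2_eq_square ring_distribs mult.commute[of h x])
    then show ?thesis using 2 by (simp add: max_def power2_eq_square algebra_simps abs_le_iff)
  next
    case 3
    have "(x + h)\<^sup>2 \<le> h\<^sup>2" using 3 by (intro power_mono) auto
    then show ?thesis using 3 by simp
  next
    case 4
    then show ?thesis by simp
  qed
qed

lemma max_zero_lipschitz: "\<bar>max 0 a - max 0 b\<bar> \<le> \<bar>a - b\<bar>" for a b :: real
  by (simp add: max_def abs_if)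
lemma min_one_lipschitz: "\<bar>min 1 a - min 1 b\<bar> \<le> \<bar>a - b\<bar>" for a b :: real
  by (simp add: min_def abs_if)

text \<open>The tent is the test derivative for concentration: it dominates half of the indicator of the interval of
  radius \<open>al\<close> around \<open>e\<close>. Its primitive is a second difference of the squared positive part.\<close>

definition tent :: "real \<Rightarrow> real \<Rightarrow> real \<Rightarrow> real" where
  "tent al e u = max 0 (1 - \<bar>u - e\<bar> / (2 * al))"
definition tent_int :: "real \<Rightarrow> real \<Rightarrow> real \<Rightarrow> real" where
  "tent_int al e u = ((max 0 (u - e + 2 * al))\<^sup>2 - 2 * (max 0 (u - e))\<^sup>2 + (max 0 (u - e - 2 * al))\<^sup>2) / (4 * al)"

lemma tent_int_deriv:
  assumes "0 < al" shows "(tent_int al e has_real_derivative tent al e u) (at u)"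
proof -
  have sh: "((\<lambda>u. (max 0 (u + c))\<^sup>2) has_real_derivative 2 * max 0 (u + c)) (at u)" for c :: real
  proof -
    have "((\<lambda>u. u + c) has_real_derivative 1) (at u)" by (auto intro!: derivative_eq_intros)
    from DERIV_chain2[where f="\<lambda>x. (max 0 x)\<^sup>2" and g="\<lambda>u. u + c", OF DERIV_pos_part_square this]
    show ?thesis by simp
  qed
  have eq: "tent_int al e = (\<lambda>u. ((max 0 (u + (2 * al - e)))\<^sup>2 - 2 * (max 0 (u + (- e)))\<^sup>2 + (max 0 (u + (- e - 2 * al)))\<^sup>2) / (4 * al))"
    by (simp add: tent_int_def fun_eq_iff algebra_simps)
  have "((\<lambda>u. ((max 0 (u + (2 * al - e)))\<^sup>2 - 2 * (max 0 (u + (- e)))\<^sup>2 + (max 0 (u + (- e - 2 * al)))\<^sup>2) / (4 * al))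
     has_real_derivative (2 * max 0 (u + (2 * al - e)) - 2 * (2 * max 0 (u + (- e))) + 2 * max 0 (u + (- e - 2 * al))) / (4 * al)) (at u)"
    by (intro DERIV_cdivide DERIV_add DERIV_diff DERIV_cmult sh)
  also have "(2 * max 0 (u + (2 * al - e)) - 2 * (2 * max 0 (u + (- e))) + 2 * max 0 (u + (- e - 2 * al))) / (4 * al) = tent al e u"
  proof -
    define s where "s = u - e"
    consider "s \<le> - 2 * al" | "- 2 * al \<le> s" "s \<le> 0" | "0 \<le> s" "s \<le> 2 * al" | "2 * al \<le> s" by linarith
    then show ?thesis
    proof cases
      case 1
      then have "max 0 (u + (2 * al - e)) = 0" "max 0 (u + (- e)) = 0" "max 0 (u + (- e - 2 * al)) = 0" "tent al e u = 0"
        using assms by (auto simp: s_def tent_def field_simps)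
      then show ?thesis by simp
    next
      case 2
      then have "max 0 (u + (2 * al - e)) = s + 2 * al" "max 0 (u + (- e)) = 0" "max 0 (u + (- e - 2 * al)) = 0"
          "tent al e u = 1 + s / (2 * al)"
        using assms by (auto simp: s_def tent_def field_simps)
      then show ?thesis using assms by (simp add: field_simps)
    next
      case 3
      then have "max 0 (u + (2 * al - e)) = s + 2 * al" "max 0 (u + (- e)) = s" "max 0 (u + (- e - 2 * al)) = 0"
          "tent al e u = 1 - s / (2 * al)"
        using assms by (auto simp: s_def tent_def field_simps)
      then show ?thesis using assms by (simp add: field_simps)
    next
      case 4
      then have "max 0 (u + (2 * al - e)) = s + 2 * al" "max 0 (u + (- e)) = s" "max 0 (u + (- e - 2 * al)) = s - 2 * al"
          "tent al e u = 0"
        using assms by (auto simp: s_def tent_def field_simps)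
      then show ?thesis using assms by simp
    qed
  qed
  finally show ?thesis unfolding eq .
qed

lemma tent_int_bounds: 
  assumes "0 < al" shows "0 \<le> tent_int al e u" "tent_int al e u \<le> 2 * al"
proof -
  define s where "s = u - e"
  have *: "tent_int al e u = ((max 0 (s + 2 * al))\<^sup>2 - 2 * (max 0 s)\<^sup>2 + (max 0 (s - 2 * al))\<^sup>2) / (4 * al)"
    by (simp add: tent_int_def s_def)
  have "0 \<le> (max 0 (s + 2 * al))\<^sup>2 - 2 * (max 0 s)\<^sup>2 + (max 0 (s - 2 * al))\<^sup>2 \<and>
     (max 0 (s + 2 * al))\<^sup>2 - 2 * (max 0 s)\<^sup>2 + (max 0 (s - 2 * al))\<^sup>2 \<le> 8 * al\<^sup>2"
  proof -
    consider "s \<le> - 2 * al" | "- 2 * al \<le> s" "s \<le> 0" | "0 \<le> s" "s \<le> 2 * al" | "2 * al \<le> s" by linarith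
    then show ?thesis
    proof cases
      case 1
      then have "max 0 (s + 2 * al) = 0" "max 0 s = 0" "max 0 (s - 2 * al) = 0" using assms by auto
      then show ?thesis by simp
    next
      case 2
      have "(s + 2 * al)\<^sup>2 \<le> (2 * al)\<^sup>2" using 2 by (intro power_mono) auto
      then have "(s + 2 * al)\<^sup>2 \<le> 8 * al\<^sup>2"
        by (simp add: power_mult_distrib) (use zero_le_power2[of al] in linarith)
      moreover have "max 0 (s + 2 * al) = s + 2 * al" "max 0 s = 0" "max 0 (s - 2 * al) = 0" using 2 assms by auto
      ultimately show ?thesis by simp
    next
      case 3
      have "0 \<le> s * (2 * al - s)" "0 \<le> (s - 2 * al)\<^sup>2" "0 \<le> al * s" "0 \<le> al * al"
        using 3 assms by auto
      then have "2 * s\<^sup>2 \<le> (s + 2 * al)\<^sup>2" "(s + 2 * al)\<^sup>2 - 2 * s\<^sup>2 \<le> 8 * al\<^sup>2"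
        unfolding power2_eq_square ring_distribs mult.commute[of s al] by linarith+
      moreover have "max 0 (s + 2 * al) = s + 2 * al" "max 0 s = s" "max 0 (s - 2 * al) = 0" using 3 assms by auto
      ultimately show ?thesis by simp
    next
      case 4 then show ?thesis using assms by (simp add: max_def power2_eq_square algebra_simps)
    qed
  qed
  then show "0 \<le> tent_int al e u" "tent_int al e u \<le> 2 * al"
    using assms unfolding * by (auto simp: divide_le_eq power2_eq_square)
qed

lemma tent_bounds: 
  assumes "0 < al"
  shows "0 \<le> tent al e u" "tent al e u \<le> 1" "\<bar>u - e\<bar> \<le> al \<Longrightarrow> 1 / 2 \<le> tent al e u"
proof -
  have "0 \<le> \<bar>u - e\<bar> / (2 * al)" using assms by simp
  then show "0 \<le> tent al e u" "tent al e u \<le> 1" unfolding tent_def by auto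
  assume "\<bar>u - e\<bar> \<le> al"
  then have "\<bar>u - e\<bar> / (2 * al) \<le> al / (2 * al)" using assms by (intro divide_right_mono) auto
  then have "\<bar>u - e\<bar> / (2 * al) \<le> 1 / 2" using assms by simp
  then show "1 / 2 \<le> tent al e u" unfolding tent_def by linarith
qed

lemma tent_remainder:
  assumes al: "0 < al"
  shows "\<bar>tent_int al e (u + v) - tent_int al e u - v * tent al e u\<bar> \<le> kern al \<bar>v\<bar> \<bar>u - e\<bar>"
proof -
  have 1: "\<bar>tent al e (u + t) - tent al e u\<bar> \<le> \<bar>t\<bar> / al" for t
  proof -
    have "\<bar>tent al e (u + t) - tent al e u\<bar> \<le> \<bar>\<bar>u + t - e\<bar> / (2 * al) - \<bar>u - e\<bar> / (2 * al)\<bar>"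
      using max_zero_lipschitz[of "1 - \<bar>u + t - e\<bar> / (2 * al)" "1 - \<bar>u - e\<bar> / (2 * al)"]
      unfolding tent_def by (simp add: abs_minus_commute)
    also have "\<dots> = \<bar>\<bar>u + t - e\<bar> - \<bar>u - e\<bar>\<bar> / (2 * al)"
      using al by (simp add: diff_divide_distrib[symmetric])
    also have "\<dots> \<le> \<bar>t\<bar> / (2 * al)" using al by (intro divide_right_mono) auto
    also have "\<dots> \<le> \<bar>t\<bar> / al" using al by (intro divide_left_mono) auto
    finally show ?thesis .
  qed
  have 2: "\<bar>tent al e (u + t) - tent al e u\<bar> \<le> 1" for t
    using tent_bounds[OF al, of e u] tent_bounds[OF al, of e "u + t"] by linarith
  have 3: "tent al e x = 0" if "2 * al \<le> \<bar>x - e\<bar>" for x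
    using that al by (simp add: tent_def field_simps max_def)
  show ?thesis
  proof (cases "\<bar>u - e\<bar> \<le> 4 * max al \<bar>v\<bar>")
    case True
    have "\<bar>tent_int al e (u + v) - tent_int al e u - v * tent al e u\<bar> \<le> \<bar>v\<bar> * min 1 (\<bar>v\<bar> / al)"
      using 1 2 al by (intro taylor_remainder tent_int_deriv)
        (auto intro!: min.boundedI order_trans[OF 1] divide_right_mono)
    then show ?thesis using True by (simp add: kern_def)
  next
    case False
    then have "\<bar>u - e\<bar> > 2 * al + \<bar>v\<bar>" by (auto simp: max_def split: if_splits)
    then have "tent al e (u + t) - tent al e u = 0" if "\<bar>t\<bar> \<le> \<bar>v\<bar>" for t
      using that 3[of "u + t"] 3[of u] by simp
    then have "\<bar>tent_int al e (u + v) - tent_int al e u - v * tent al e u\<bar> \<le> \<bar>v\<bar> * 0"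
      by (intro taylor_remainder tent_int_deriv al) simp
    moreover have "kern al \<bar>v\<bar> \<bar>u - e\<bar> = 0" unfolding kern_def using False by (rule if_not_P)
    ultimately show ?thesis by simp
  qed
qed


definition ramp :: "real \<Rightarrow> real \<Rightarrow> real \<Rightarrow> real" where
  "ramp al z u = max 0 (min 1 (1 - (u - z) / al))"

lemma ramp_bounds: "0 \<le> ramp al z u" "ramp al z u \<le> 1"
  by (auto simp: ramp_def)

lemma ramp_eq_1: "0 < al \<Longrightarrow> u \<le> z \<Longrightarrow> ramp al z u = 1"
  by (simp add: ramp_def field_simps min_def max_def)
lemma ramp_eq_0: "0 < al \<Longrightarrow> z + al \<le> u \<Longrightarrow> ramp al z u = 0"
  by (simp add: ramp_def field_simps min_def max_def)

lemma ramp_continuous: "0 < al \<Longrightarrow> continuous_on UNIV (ramp al z)"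
  unfolding ramp_def by (intro continuous_intros) auto

text \<open>The derivative \<open>f' w = w * f w + ramp al z w - c\<close> has a Lipschitz part with constant of order
  \<open>1 + \<bar>w\<bar>\<close>, which gives the quadratic remainder, and the ramp, which gives the kernel.\<close>

lemma stein_ramp:
  assumes al: "0 < al"
  obtains f f' c where "\<And>w. (f has_real_derivative f' w) (at w)"
    "\<And>w. f' w = w * f w + ramp al z w - c"
    "\<And>w. \<bar>f w\<bar> \<le> 7" "\<And>w. \<bar>f' w\<bar> \<le> 7" "c = (\<integral>x. ramp al z x * std_normal_density x \<partial>lborel)"
    "\<And>u v. \<bar>f (u + v) - f u - v * f' u\<bar> \<le> kern al \<bar>v\<bar> \<bar>u - z\<bar> + 7 * (v\<^sup>2 * (1 + \<bar>u\<bar>))"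
proof -
  define c where "c = (\<integral>x. ramp al z x * std_normal_density x \<partial>lborel)"
  obtain f where f: "\<And>w. (f has_real_derivative (w * f w + ramp al z w - c)) (at w)"
    "\<And>w. \<bar>f w\<bar> \<le> 6" "\<And>w. \<bar>w * f w\<bar> \<le> 6" and c: "0 \<le> c" "c \<le> 1"
    using stein_solution[OF ramp_continuous[OF al, of z] ramp_bounds] unfolding c_def by metis
  define f' where "f' w = w * f w + ramp al z w - c" for w
  have df: "(f has_real_derivative f' w) (at w)" for w using f(1) by (simp add: f'_def)
  have f'7: "\<bar>f' w\<bar> \<le> 7" for w
    using f(3)[of w] ramp_bounds[of al z w] c unfolding f'_def by linarith
  have lip: "\<bar>f (u + t) - f u\<bar> \<le> 7 * \<bar>t\<bar>" for u t
  proof -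
    have "norm (f (u + t) - f u) \<le> 7 * norm (u + t - u)"
      using f'7 by (intro field_differentiable_bound[where S=UNIV and f'=f']) (auto intro: df)
    then show ?thesis by simp
  qed
  have smooth: "\<bar>(u + t) * f (u + t) - u * f u\<bar> \<le> 7 * (\<bar>t\<bar> * (1 + \<bar>u\<bar>))" for u t
  proof -
    have "(u + t) * f (u + t) - u * f u = t * f (u + t) + u * (f (u + t) - f u)" by (simp add: algebra_simps)
    also have "\<bar>\<dots>\<bar> \<le> \<bar>t\<bar> * \<bar>f (u + t)\<bar> + \<bar>u\<bar> * \<bar>f (u + t) - f u\<bar>"
      by (metis abs_mult abs_triangle_ineq)
    also have "\<dots> \<le> \<bar>t\<bar> * 7 + \<bar>u\<bar> * (7 * \<bar>t\<bar>)"
      using f(2)[of "u + t"] by (intro add_mono mult_left_mono lip) auto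
    finally show ?thesis by (simp add: algebra_simps)
  qed
  have r1: "\<bar>ramp al z (u + t) - ramp al z u\<bar> \<le> \<bar>t\<bar> / al" for u t
  proof -
    have "\<bar>ramp al z (u + t) - ramp al z u\<bar> \<le> \<bar>(u - z) / al - (u + t - z) / al\<bar>"
      using max_zero_lipschitz[of "min 1 (1 - (u + t - z) / al)" "min 1 (1 - (u - z) / al)"]
        min_one_lipschitz[of "1 - (u + t - z) / al" "1 - (u - z) / al"]
      unfolding ramp_def by (simp add: abs_minus_commute)
    also have "\<dots> = \<bar>t\<bar> / al" using al by (simp add: diff_divide_distrib[symmetric])
    finally show ?thesis .
  qed
  have r2: "\<bar>ramp al z (u + t) - ramp al z u\<bar> \<le> 1" for u t
    using ramp_bounds[of al z u] ramp_bounds[of al z "u + t"] by linarith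
  have r3: "ramp al z (u + t) = ramp al z u" if "al + \<bar>t\<bar> < \<bar>u - z\<bar>" for u t
  proof (cases "u < z")
    case True
    then show ?thesis using that al by (simp add: ramp_eq_1)
  next
    case False
    then show ?thesis using that al by (simp add: ramp_eq_0)
  qed
  have rem: "\<bar>f (u + v) - f u - v * f' u\<bar> \<le> kern al \<bar>v\<bar> \<bar>u - z\<bar> + 7 * (v\<^sup>2 * (1 + \<bar>u\<bar>))" for u v
  proof -
    define b where "b = (if \<bar>u - z\<bar> \<le> 4 * max al \<bar>v\<bar> then min 1 (\<bar>v\<bar> / al) else 0)"
    have "\<bar>f' (u + t) - f' u\<bar> \<le> b + 7 * (\<bar>v\<bar> * (1 + \<bar>u\<bar>))" if t: "\<bar>t\<bar> \<le> \<bar>v\<bar>" for t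
    proof -
      have "\<bar>ramp al z (u + t) - ramp al z u\<bar> \<le> b"
      proof (cases "\<bar>u - z\<bar> \<le> 4 * max al \<bar>v\<bar>")
        case True
        have "\<bar>t\<bar> / al \<le> \<bar>v\<bar> / al" using t al by (intro divide_right_mono) auto
        then show ?thesis using r1[of u t] r2[of u t] True by (simp add: b_def)
      next
        case False
        then have "al + \<bar>t\<bar> < \<bar>u - z\<bar>" using t al by (auto simp: max_def split: if_splits)
        then show ?thesis using False by (simp add: b_def r3)
      qed
      moreover have "\<bar>t\<bar> * (1 + \<bar>u\<bar>) \<le> \<bar>v\<bar> * (1 + \<bar>u\<bar>)" using t by (intro mult_right_mono) auto
      ultimately show ?thesis using smooth[of u t] unfolding f'_def by linarith
    qed
    then have "\<bar>f (u + v) - f u - v * f' u\<bar> \<le> \<bar>v\<bar> * (b + 7 * (\<bar>v\<bar> * (1 + \<bar>u\<bar>)))"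
      by (intro taylor_remainder df)
    also have "\<dots> = kern al \<bar>v\<bar> \<bar>u - z\<bar> + 7 * (v\<^sup>2 * (1 + \<bar>u\<bar>))"
    proof -
      have vv: "\<bar>v\<bar> * \<bar>v\<bar> = v\<^sup>2" by (simp add: power2_eq_square)
      have "p * (q + 7 * (p * r)) = p * q + 7 * ((p * p) * r)" for p q r :: real
        by (simp add: algebra_simps)
      from this[of "\<bar>v\<bar>" b "1 + \<bar>u\<bar>"] show ?thesis unfolding vv by (simp add: b_def kern_def)
    qed
    finally show ?thesis .
  qed
  show ?thesis
    by (rule that[OF df _ _ f'7 _ rem, of c]) (use f(2) in \<open>auto simp: f'_def c_def intro: order_trans[OF f(2)]\<close>)
qed

section \<open>Dyadic shells\<close>

definition shell :: "real \<Rightarrow> nat" where "shell w = (LEAST m. w \<le> 2 ^ m)"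

lemma shell_le: "w \<le> 2 ^ shell w"
proof -
  obtain m :: nat where "w < 2 ^ m" using real_arch_pow[of 2 w] by auto
  then show ?thesis unfolding shell_def by (intro LeastI[of "\<lambda>m. w \<le> 2 ^ m" m]) simp
qed

lemma shell_le_iff: "shell w \<le> M \<longleftrightarrow> w \<le> 2 ^ M"
proof
  assume "shell w \<le> M"
  then have "(2::real) ^ shell w \<le> 2 ^ M" by (intro power_increasing) auto
  then show "w \<le> 2 ^ M" using shell_le[of w] by linarith
next
  assume "w \<le> 2 ^ M" then show "shell w \<le> M" unfolding shell_def by (rule Least_le)
qed

lemma shell_scale: 
  assumes "0 \<le> w" shows "min 1 w * 2 ^ shell w \<le> 2 * w"
proof (cases "shell w")
  case 0
  then show ?thesis using assms by simp
next
  case (Suc m)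
  then have "\<not> w \<le> 2 ^ m" using shell_le_iff[of w m] by simp
  then have "2 ^ shell w \<le> 2 * w" using Suc by simp
  moreover have "min 1 w * 2 ^ shell w \<le> 1 * 2 ^ shell w" using assms by (intro mult_right_mono) auto
  ultimately show ?thesis by linarith
qed

lemma shell_measurable [measurable]: "shell \<in> measurable borel (count_space UNIV)"
  unfolding shell_def by measurable

section \<open>Leaving out a neighbourhood\<close>

text \<open>For a configuration \<open>v\<close> of values of the random variables, \<open>total\<close> is the sum \<open>S\<close>, \<open>quad\<close> is the
  sum of the products \<open>X i * Y i\<close>, and \<open>norm_sq\<close> is the square of the self-normaliser. The product of the
  two means is \<open>mean_term\<close>: each \<open>X p\<close> occurs in the sum of all \<open>Y i\<close> once for every \<open>i\<close> with \<open>p\<close> in \<open>A i\<close>,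
  so that sum is \<open>k * in_weighted v\<close> with weights between \<open>0\<close> and \<open>1\<close>. Setting the values in
  \<open>A i\<close> to \<open>0\<close> makes every functional independent of \<open>X i\<close>; the lemmas of this section bound the change.\<close>

context dependency_neighbourhoods
begin

definition lin :: "(nat \<Rightarrow> real) \<Rightarrow> (nat \<Rightarrow> real) \<Rightarrow> real" where
  "lin c v = (\<Sum>i\<in>{1..n}. c i * v i)"
definition total :: "(nat \<Rightarrow> real) \<Rightarrow> real" where
  "total v = lin (\<lambda>_. 1) v"
definition in_weighted :: "(nat \<Rightarrow> real) \<Rightarrow> real" where
  "in_weighted v = lin (\<lambda>i. real (card (N_set n A i)) / k) v"
definition quad :: "(nat \<Rightarrow> real) \<Rightarrow> real" where
  "quad v = (\<Sum>i\<in>{1..n}. \<Sum>l\<in>A i. v i * v l)"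
definition mean_term :: "(nat \<Rightarrow> real) \<Rightarrow> real" where
  "mean_term v = k / real n * (total v * in_weighted v)"
definition norm_sq :: "(nat \<Rightarrow> real) \<Rightarrow> real" where
  "norm_sq v = quad v - mean_term v"

lemma lin_local: "(\<And>i. i \<in> {1..n} \<Longrightarrow> v i = w i) \<Longrightarrow> lin c v = lin c w"
  unfolding lin_def by (intro sum.cong) auto
lemma quad_local:
  assumes "\<And>i. i \<in> {1..n} \<Longrightarrow> v i = w i" shows "quad v = quad w"
  unfolding quad_def
proof (intro sum.cong refl)
  fix i l assume "i \<in> {1..n}" "l \<in> A i"
  then show "v i * v l = w i * w l" using assms[of i] assms[OF in_A[of i l]] by simp
qed
lemma norm_sq_local:
  assumes "\<And>i. i \<in> {1..n} \<Longrightarrow> v i = w i" shows "norm_sq v = norm_sq w"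
proof -
  have "lin c v = lin c w" for c by (rule lin_local) (rule assms)
  moreover have "quad v = quad w" by (rule quad_local) (rule assms)
  ultimately show ?thesis by (simp only: norm_sq_def mean_term_def total_def in_weighted_def)
qed

lemma in_weight_bounds: "i \<in> {1..n} \<Longrightarrow> 0 \<le> real (card (N_set n A i)) / k"
  "i \<in> {1..n} \<Longrightarrow> real (card (N_set n A i)) / k \<le> 1"
  using card_N[of i] by simp_all

lemma lin_minus_zero_on:
  assumes "B \<subseteq> {1..n}"
  shows "lin c v - lin c (zero_on B v) = (\<Sum>i\<in>B. c i * v i)"
proof -
  have "lin c v - lin c (zero_on B v) = (\<Sum>i\<in>{1..n}. if i \<in> B then c i * v i else 0)"
    unfolding lin_def sum_subtractf[symmetric] zero_on_def by (intro sum.cong) auto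
  also have "\<dots> = (\<Sum>i\<in>{1..n} \<inter> B. c i * v i)" by (subst sum.inter_restrict) auto
  also have "{1..n} \<inter> B = B" using assms by auto
  finally show ?thesis .
qed

lemma lin_zero_on_diff_le:
  assumes "B \<subseteq> {1..n}" "\<And>i. i \<in> {1..n} \<Longrightarrow> 0 \<le> c i" "\<And>i. i \<in> {1..n} \<Longrightarrow> c i \<le> 1"
  shows "\<bar>lin c v - lin c (zero_on B v)\<bar> \<le> (\<Sum>i\<in>B. \<bar>v i\<bar>)"
proof -
  have "\<bar>lin c v - lin c (zero_on B v)\<bar> \<le> (\<Sum>i\<in>B. \<bar>c i * v i\<bar>)"
    unfolding lin_minus_zero_on[OF assms(1)] by (rule sum_abs)
  also have "\<dots> \<le> (\<Sum>i\<in>B. \<bar>v i\<bar>)"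
    using assms by (intro sum_mono) (auto simp: abs_mult intro!: mult_left_le_one_le)
  finally show ?thesis .
qed

lemma total_minus_zero_on: "B \<subseteq> {1..n} \<Longrightarrow> total v - total (zero_on B v) = (\<Sum>i\<in>B. v i)"
  unfolding total_def using lin_minus_zero_on by simp

lemma total_zero_on_le: "i \<in> {1..n} \<Longrightarrow> \<bar>total (zero_on (A i) v)\<bar> \<le> \<bar>total v\<bar> + out_abs v i"
  using lin_zero_on_diff_le[OF A_sub, of i "\<lambda>_. 1" v] unfolding total_def out_abs_def by linarith

lemma sum_touching:
  assumes B: "B \<subseteq> {1..n}"
  shows "(\<Sum>j\<in>{1..n}. \<Sum>l\<in>A j. (if j \<in> B then \<bar>v j\<bar> * \<bar>v l\<bar> else 0) + (if l \<in> B then \<bar>v j\<bar> * \<bar>v l\<bar> else 0))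
    = (\<Sum>l\<in>B. \<bar>v l\<bar> * (out_abs v l + in_abs v l))"
proof -
  have "(\<Sum>j\<in>{1..n}. \<Sum>l\<in>A j. (if j \<in> B then \<bar>v j\<bar> * \<bar>v l\<bar> else 0) + (if l \<in> B then \<bar>v j\<bar> * \<bar>v l\<bar> else 0))
    = (\<Sum>j\<in>{1..n}. \<Sum>l\<in>A j. if j \<in> B then \<bar>v j\<bar> * \<bar>v l\<bar> else 0)
      + (\<Sum>l\<in>{1..n}. \<Sum>j\<in>N_set n A l. if l \<in> B then \<bar>v j\<bar> * \<bar>v l\<bar> else 0)"
    unfolding sum.distrib sum_nbhd_swap[of "\<lambda>j l. if l \<in> B then \<bar>v j\<bar> * \<bar>v l\<bar> else 0"] ..
  also have "\<dots> = (\<Sum>j\<in>{1..n}. if j \<in> B then \<bar>v j\<bar> * out_abs v j else 0)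
      + (\<Sum>l\<in>{1..n}. if l \<in> B then \<bar>v l\<bar> * in_abs v l else 0)"
    by (intro arg_cong2[where f="(+)"] sum.cong refl)
      (simp_all add: out_abs_def in_abs_def sum_distrib_left mult.commute)
  also have "\<dots> = (\<Sum>j\<in>{1..n} \<inter> B. \<bar>v j\<bar> * out_abs v j) + (\<Sum>l\<in>{1..n} \<inter> B. \<bar>v l\<bar> * in_abs v l)"
    by (simp add: sum.inter_restrict)
  also have "{1..n} \<inter> B = B" using B by auto
  finally show ?thesis by (simp add: sum.distrib distrib_left)
qed

lemma quad_zero_on_diff_le:
  assumes i: "i \<in> {1..n}"
  shows "\<bar>quad v - quad (zero_on (A i) v)\<bar> \<le> (\<Sum>l\<in>A i. \<bar>v l\<bar> * (out_abs v l + in_abs v l))"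
proof -
  have "quad v - quad (zero_on (A i) v) = (\<Sum>j\<in>{1..n}. \<Sum>l\<in>A j. v j * v l - zero_on (A i) v j * zero_on (A i) v l)"
    unfolding quad_def by (simp add: sum_subtractf)
  also have "\<bar>\<dots>\<bar> \<le> (\<Sum>j\<in>{1..n}. \<bar>\<Sum>l\<in>A j. v j * v l - zero_on (A i) v j * zero_on (A i) v l\<bar>)"
    by (rule sum_abs)
  also have "\<dots> \<le> (\<Sum>j\<in>{1..n}. \<Sum>l\<in>A j. \<bar>v j * v l - zero_on (A i) v j * zero_on (A i) v l\<bar>)"
    by (intro sum_mono sum_abs)
  also have "\<dots> \<le> (\<Sum>j\<in>{1..n}. \<Sum>l\<in>A j. (if j \<in> A i then \<bar>v j\<bar> * \<bar>v l\<bar> else 0) + (if l \<in> A i then \<bar>v j\<bar> * \<bar>v l\<bar> else 0))"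
    by (intro sum_mono) (auto simp: zero_on_def abs_mult)
  also have "\<dots> = (\<Sum>l\<in>A i. \<bar>v l\<bar> * (out_abs v l + in_abs v l))"
    by (rule sum_touching[OF A_sub[OF i]])
  finally show ?thesis .
qed

lemma mean_term_zero_on_diff_le:
  assumes i: "i \<in> {1..n}"
  shows "\<bar>mean_term v - mean_term (zero_on (A i) v)\<bar>
    \<le> k / real n * (out_abs v i * (\<bar>in_weighted v\<bar> + \<bar>total (zero_on (A i) v)\<bar>))"
proof -
  let ?w = "zero_on (A i) v"
  have ring: "p * q - r * s = (p - r) * q + r * (q - s)" for p q r s :: real by (simp add: algebra_simps)
  have c0: "0 \<le> k / real n" by simp
  have eq: "mean_term v - mean_term ?w =
     k / real n * ((total v - total ?w) * in_weighted v + total ?w * (in_weighted v - in_weighted ?w))"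
    unfolding mean_term_def right_diff_distrib[symmetric] ring[of "total v"] ..
  have "\<bar>mean_term v - mean_term ?w\<bar> = k / real n * \<bar>(total v - total ?w) * in_weighted v + total ?w * (in_weighted v - in_weighted ?w)\<bar>"
    by (simp only: eq abs_mult[of "k / real n"] abs_of_nonneg[OF c0])
  also have "\<dots> \<le> k / real n * (out_abs v i * (\<bar>in_weighted v\<bar> + \<bar>total ?w\<bar>))"
  proof (rule mult_left_mono)
    have t: "\<bar>total v - total ?w\<bar> \<le> out_abs v i"
      unfolding out_abs_def total_def by (rule lin_zero_on_diff_le[OF A_sub[OF i]]) auto
    have w: "\<bar>in_weighted v - in_weighted ?w\<bar> \<le> out_abs v i"
      unfolding out_abs_def in_weighted_def
      by (rule lin_zero_on_diff_le[OF A_sub[OF i] in_weight_bounds])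
    have "\<bar>(total v - total ?w) * in_weighted v + total ?w * (in_weighted v - in_weighted ?w)\<bar>
       \<le> \<bar>total v - total ?w\<bar> * \<bar>in_weighted v\<bar> + \<bar>total ?w\<bar> * \<bar>in_weighted v - in_weighted ?w\<bar>"
      unfolding abs_mult[symmetric] by (rule abs_triangle_ineq)
    also have "\<dots> \<le> out_abs v i * \<bar>in_weighted v\<bar> + \<bar>total ?w\<bar> * out_abs v i"
      by (rule add_mono[OF mult_right_mono[OF t] mult_left_mono[OF w]]) auto
    also have "\<dots> = out_abs v i * (\<bar>in_weighted v\<bar> + \<bar>total ?w\<bar>)" by (simp add: distrib_left)
    finally show "\<bar>(total v - total ?w) * in_weighted v + total ?w * (in_weighted v - in_weighted ?w)\<bar>
       \<le> out_abs v i * (\<bar>in_weighted v\<bar> + \<bar>total ?w\<bar>)" .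
  qed (rule c0)
  finally show ?thesis .
qed

lemma sum_leave_out_quad:
  "(\<Sum>i\<in>{1..n}. \<bar>v i\<bar> * \<bar>quad v - quad (zero_on (A i) v)\<bar> * (1 + \<bar>total (zero_on (A i) v)\<bar>))
    \<le> 2 * k\<^sup>2 * cube_sum v * (1 + \<bar>total v\<bar>) + 3 * (k ^ 3 * fourth_sum v)"
proof -
  let ?c = "\<lambda>l. out_abs v l + in_abs v l"
  have "(\<Sum>i\<in>{1..n}. \<bar>v i\<bar> * \<bar>quad v - quad (zero_on (A i) v)\<bar> * (1 + \<bar>total (zero_on (A i) v)\<bar>))
    \<le> (\<Sum>i\<in>{1..n}. \<bar>v i\<bar> * (\<Sum>l\<in>A i. \<bar>v l\<bar> * ?c l) * ((1 + \<bar>total v\<bar>) + out_abs v i))"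
    by (intro sum_mono mult_mono mult_left_mono quad_zero_on_diff_le) 
      (auto simp: add.assoc intro!: total_zero_on_le sum_nonneg mult_nonneg_nonneg)
  also have "\<dots> = (\<Sum>i\<in>{1..n}. \<Sum>l\<in>A i. \<bar>v i\<bar> * \<bar>v l\<bar> * ?c l) * (1 + \<bar>total v\<bar>)
     + (\<Sum>i\<in>{1..n}. \<Sum>l\<in>A i. (\<bar>v i\<bar> * out_abs v i) * (\<bar>v l\<bar> * ?c l))"
    unfolding sum_distrib_right sum.distrib[symmetric]
  proof (rule sum.cong[OF refl])
    fix i
    have split: "\<bar>v i\<bar> * s * (p + out_abs v i) = \<bar>v i\<bar> * s * p + \<bar>v i\<bar> * out_abs v i * s" for s p
      by (simp add: algebra_simps)
    show "\<bar>v i\<bar> * (\<Sum>l\<in>A i. \<bar>v l\<bar> * ?c l) * ((1 + \<bar>total v\<bar>) + out_abs v i) =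
       (\<Sum>l\<in>A i. \<bar>v i\<bar> * \<bar>v l\<bar> * ?c l * (1 + \<bar>total v\<bar>) + (\<bar>v i\<bar> * out_abs v i) * (\<bar>v l\<bar> * ?c l))"
      unfolding split sum.distrib by (simp only: sum_distrib_left sum_distrib_right mult.assoc)
  qed
  also have "\<dots> \<le> (2 * k\<^sup>2 * cube_sum v) * (1 + \<bar>total v\<bar>) + 3 * (k ^ 3 * fourth_sum v)"
  proof (intro add_mono mult_right_mono)
    show "(\<Sum>i\<in>{1..n}. \<Sum>l\<in>A i. \<bar>v i\<bar> * \<bar>v l\<bar> * ?c l) \<le> 2 * k\<^sup>2 * cube_sum v"
      unfolding sum_abs_out_in by (rule sum_abs_in_mult)
    have "(\<bar>v i\<bar> * out_abs v i) * (\<bar>v l\<bar> * ?c l) \<le> ((v i)\<^sup>2 * (out_abs v i)\<^sup>2 + (v l)\<^sup>2 * (?c l)\<^sup>2) / 2" for i l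
      using sum_squares_bound[of "\<bar>v i\<bar> * out_abs v i" "\<bar>v l\<bar> * ?c l"] by (simp add: power_mult_distrib)
    then have "(\<Sum>i\<in>{1..n}. \<Sum>l\<in>A i. (\<bar>v i\<bar> * out_abs v i) * (\<bar>v l\<bar> * ?c l))
       \<le> (\<Sum>i\<in>{1..n}. \<Sum>l\<in>A i. ((v i)\<^sup>2 * (out_abs v i)\<^sup>2 + (v l)\<^sup>2 * (?c l)\<^sup>2) / 2)"
      by (intro sum_mono)
    also have "\<dots> = ((\<Sum>i\<in>{1..n}. \<Sum>l\<in>A i. (v i)\<^sup>2 * (out_abs v i)\<^sup>2) + (\<Sum>i\<in>{1..n}. \<Sum>l\<in>A i. (v l)\<^sup>2 * (?c l)\<^sup>2)) / 2"
      by (simp only: sum.distrib sum_divide_distrib add_divide_distrib)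
    also have "\<dots> \<le> (k * (\<Sum>i\<in>{1..n}. (v i)\<^sup>2 * (out_abs v i)\<^sup>2) + k * (\<Sum>l\<in>{1..n}. (v l)\<^sup>2 * (?c l)\<^sup>2)) / 2"
      by (intro divide_right_mono add_mono sum_nbhd_centre_le sum_nbhd_member_le) auto
    also have "\<dots> \<le> (k * (k\<^sup>2 * fourth_sum v) + k * (4 * k\<^sup>2 * fourth_sum v)) / 2"
      by (intro divide_right_mono add_mono mult_left_mono sum_square_fourth_le sum_out_fourth sum_square_out_in) auto
    also have "\<dots> \<le> 3 * (k ^ 3 * fourth_sum v)"
      by (simp add: power2_eq_square power3_eq_cube)
    finally show "(\<Sum>i\<in>{1..n}. \<Sum>l\<in>A i. (\<bar>v i\<bar> * out_abs v i) * (\<bar>v l\<bar> * ?c l)) \<le> 3 * (k ^ 3 * fourth_sum v)" .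
  qed auto
  finally show ?thesis .
qed

lemma sum_leave_out_mean_term:
  "(\<Sum>i\<in>{1..n}. \<bar>v i\<bar> * \<bar>mean_term v - mean_term (zero_on (A i) v)\<bar> * (1 + \<bar>total (zero_on (A i) v)\<bar>))
    \<le> k / real n * ((\<Sum>i\<in>{1..n}. \<bar>v i\<bar> * out_abs v i) * (1 + (in_weighted v)\<^sup>2 + 4 * (total v)\<^sup>2) + 4 * (k ^ 3 * fourth_sum v))"
proof -
  have "\<bar>v i\<bar> * \<bar>mean_term v - mean_term (zero_on (A i) v)\<bar> * (1 + \<bar>total (zero_on (A i) v)\<bar>)
     \<le> k / real n * (\<bar>v i\<bar> * out_abs v i * (1 + (in_weighted v)\<^sup>2 + 4 * (total v)\<^sup>2) + 4 * (\<bar>v i\<bar> * out_abs v i ^ 3))"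
    if i: "i \<in> {1..n}" for i
  proof -
    define a b y where "a = \<bar>total (zero_on (A i) v)\<bar>" and "b = \<bar>in_weighted v\<bar>" and "y = out_abs v i"
    have y0: "0 \<le> y" "0 \<le> a" "0 \<le> b" by (auto simp: y_def a_def b_def)
    have "a \<le> \<bar>total v\<bar> + y" using total_zero_on_le[OF i] by (simp add: a_def y_def)
    then have "a\<^sup>2 \<le> (\<bar>total v\<bar> + y)\<^sup>2" using y0 by (intro power_mono) auto
    also have "\<dots> \<le> 2 * (total v)\<^sup>2 + 2 * y\<^sup>2"
      using sum_squares_bound[of "\<bar>total v\<bar>" y] by (simp add: power2_sum)
    finally have a2: "a\<^sup>2 \<le> 2 * (total v)\<^sup>2 + 2 * y\<^sup>2" .
    have "(b + a) * (1 + a) \<le> 1 + b\<^sup>2 + 2 * a\<^sup>2"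
      using sum_squares_bound[of 1 b] sum_squares_bound[of 1 a] sum_squares_bound[of a b]
      by (simp add: power2_eq_square algebra_simps)
    also have "\<dots> \<le> (1 + (in_weighted v)\<^sup>2 + 4 * (total v)\<^sup>2) + 4 * y\<^sup>2" using a2 by (simp add: b_def)
    finally have ab: "(b + a) * (1 + a) \<le> (1 + (in_weighted v)\<^sup>2 + 4 * (total v)\<^sup>2) + 4 * y\<^sup>2" .
    have "\<bar>v i\<bar> * \<bar>mean_term v - mean_term (zero_on (A i) v)\<bar> * (1 + a)
       \<le> \<bar>v i\<bar> * (k / real n * (y * (b + a))) * (1 + a)"
      unfolding a_def b_def y_def
      by (intro mult_right_mono mult_left_mono mean_term_zero_on_diff_le i) auto
    also have "\<dots> = k / real n * (\<bar>v i\<bar> * y * ((b + a) * (1 + a)))" by simp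
    also have "\<dots> \<le> k / real n * (\<bar>v i\<bar> * y * ((1 + (in_weighted v)\<^sup>2 + 4 * (total v)\<^sup>2) + 4 * y\<^sup>2))"
      using y0 by (intro mult_left_mono ab) auto
    also have "\<dots> = k / real n * (\<bar>v i\<bar> * y * (1 + (in_weighted v)\<^sup>2 + 4 * (total v)\<^sup>2) + 4 * (\<bar>v i\<bar> * y ^ 3))"
      by (simp add: distrib_left power2_eq_square power3_eq_cube mult_ac)
    finally show ?thesis by (simp add: a_def y_def)
  qed
  then have "(\<Sum>i\<in>{1..n}. \<bar>v i\<bar> * \<bar>mean_term v - mean_term (zero_on (A i) v)\<bar> * (1 + \<bar>total (zero_on (A i) v)\<bar>))
    \<le> (\<Sum>i\<in>{1..n}. k / real n * (\<bar>v i\<bar> * out_abs v i * (1 + (in_weighted v)\<^sup>2 + 4 * (total v)\<^sup>2) + 4 * (\<bar>v i\<bar> * out_abs v i ^ 3)))"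
    by (intro sum_mono)
  also have "\<dots> = k / real n * ((\<Sum>i\<in>{1..n}. \<bar>v i\<bar> * out_abs v i) * (1 + (in_weighted v)\<^sup>2 + 4 * (total v)\<^sup>2)
       + 4 * (\<Sum>i\<in>{1..n}. \<bar>v i\<bar> * out_abs v i ^ 3))"
    by (simp only: sum_distrib_left[symmetric] sum.distrib sum_distrib_right[symmetric])
  also have "\<dots> \<le> k / real n * ((\<Sum>i\<in>{1..n}. \<bar>v i\<bar> * out_abs v i) * (1 + (in_weighted v)\<^sup>2 + 4 * (total v)\<^sup>2)
       + 4 * (k ^ 3 * fourth_sum v))"
    by (intro mult_left_mono add_left_mono sum_abs_out_cube) auto
  finally show ?thesis .
qed

text \<open>The total cost of making the normaliser independent of \<open>X i\<close>. The factor \<open>1 + \<bar>total\<bar>\<close> appears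
  because the derivative of \<open>r * F (w * r)\<close> in \<open>r\<close> grows linearly in \<open>w\<close>.\<close>

lemma sum_leave_out_norm_sq:
  "(\<Sum>i\<in>{1..n}. \<bar>v i\<bar> * \<bar>norm_sq v - norm_sq (zero_on (A i) v)\<bar> * (1 + \<bar>total (zero_on (A i) v)\<bar>))
    \<le> 2 * k\<^sup>2 * cube_sum v * (1 + \<bar>total v\<bar>) + 3 * (k ^ 3 * fourth_sum v)
      + k / real n * ((\<Sum>i\<in>{1..n}. \<bar>v i\<bar> * out_abs v i) * (1 + (in_weighted v)\<^sup>2 + 4 * (total v)\<^sup>2) + 4 * (k ^ 3 * fourth_sum v))"
proof -
  have "(\<Sum>i\<in>{1..n}. \<bar>v i\<bar> * \<bar>norm_sq v - norm_sq (zero_on (A i) v)\<bar> * (1 + \<bar>total (zero_on (A i) v)\<bar>))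
    \<le> (\<Sum>i\<in>{1..n}. \<bar>v i\<bar> * \<bar>quad v - quad (zero_on (A i) v)\<bar> * (1 + \<bar>total (zero_on (A i) v)\<bar>) + 
        \<bar>v i\<bar> * \<bar>mean_term v - mean_term (zero_on (A i) v)\<bar> * (1 + \<bar>total (zero_on (A i) v)\<bar>))"
  proof (rule sum_mono)
    fix i
    let ?w = "zero_on (A i) v"
    have tri: "\<bar>norm_sq v - norm_sq ?w\<bar> \<le> \<bar>quad v - quad ?w\<bar> + \<bar>mean_term v - mean_term ?w\<bar>"
      unfolding norm_sq_def by linarith
    have "\<bar>v i\<bar> * \<bar>norm_sq v - norm_sq ?w\<bar> * (1 + \<bar>total ?w\<bar>)
      \<le> \<bar>v i\<bar> * (\<bar>quad v - quad ?w\<bar> + \<bar>mean_term v - mean_term ?w\<bar>) * (1 + \<bar>total ?w\<bar>)"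
      by (intro mult_right_mono mult_left_mono tri) auto
    then show "\<bar>v i\<bar> * \<bar>norm_sq v - norm_sq ?w\<bar> * (1 + \<bar>total ?w\<bar>)
      \<le> \<bar>v i\<bar> * \<bar>quad v - quad ?w\<bar> * (1 + \<bar>total ?w\<bar>)
        + \<bar>v i\<bar> * \<bar>mean_term v - mean_term ?w\<bar> * (1 + \<bar>total ?w\<bar>)"
      unfolding distrib_left[of "\<bar>v i\<bar>"] distrib_right[of _ _ "1 + \<bar>total ?w\<bar>"] .
  qed
  also have "\<dots> \<le> (2 * k\<^sup>2 * cube_sum v * (1 + \<bar>total v\<bar>) + 3 * (k ^ 3 * fourth_sum v))
      + k / real n * ((\<Sum>i\<in>{1..n}. \<bar>v i\<bar> * out_abs v i) * (1 + (in_weighted v)\<^sup>2 + 4 * (total v)\<^sup>2) + 4 * (k ^ 3 * fourth_sum v))"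
    unfolding sum.distrib by (intro add_mono sum_leave_out_quad sum_leave_out_mean_term)
  finally show ?thesis .
qed

lemma sum_abs_out_le: "(\<Sum>i\<in>{1..n}. \<bar>v i\<bar> * out_abs v i) \<le> k * (\<Sum>i\<in>{1..n}. (v i)\<^sup>2)"
proof -
  have "(\<Sum>i\<in>{1..n}. \<bar>v i\<bar> * out_abs v i) = (\<Sum>i\<in>{1..n}. \<Sum>l\<in>A i. \<bar>v i\<bar> * \<bar>v l\<bar>)"
    by (simp add: out_abs_def sum_distrib_left)
  also have "\<dots> \<le> (\<Sum>i\<in>{1..n}. \<Sum>l\<in>A i. ((v i)\<^sup>2 + (v l)\<^sup>2) / 2)"
  proof (intro sum_mono)
    fix i l show "\<bar>v i\<bar> * \<bar>v l\<bar> \<le> ((v i)\<^sup>2 + (v l)\<^sup>2) / 2"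
      using sum_squares_bound[of "\<bar>v i\<bar>" "\<bar>v l\<bar>"] by simp
  qed
  also have "\<dots> = ((\<Sum>i\<in>{1..n}. \<Sum>l\<in>A i. (v i)\<^sup>2) + (\<Sum>i\<in>{1..n}. \<Sum>l\<in>A i. (v l)\<^sup>2)) / 2"
    by (simp only: sum.distrib sum_divide_distrib add_divide_distrib)
  also have "\<dots> \<le> (k * (\<Sum>i\<in>{1..n}. (v i)\<^sup>2) + k * (\<Sum>i\<in>{1..n}. (v i)\<^sup>2)) / 2"
    by (intro divide_right_mono add_mono sum_nbhd_centre_le sum_nbhd_member_le) auto
  finally show ?thesis by simp
qed

lemma sum_abs_member_square:
  "k * (\<Sum>i\<in>{1..n}. \<Sum>l\<in>A i. \<bar>v i\<bar> * (v l)\<^sup>2) \<le> k\<^sup>2 * cube_sum v"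
proof -
  have "\<bar>v i\<bar> * (v l)\<^sup>2 \<le> \<bar>v i\<bar> ^ 3 / 3 + 2 * \<bar>v l\<bar> ^ 3 / 3" for i l
    using young_three[of "\<bar>v i\<bar>" "\<bar>v l\<bar>" "\<bar>v l\<bar>"] by (simp add: power2_eq_square mult.assoc)
  then have "(\<Sum>i\<in>{1..n}. \<Sum>l\<in>A i. \<bar>v i\<bar> * (v l)\<^sup>2) \<le> (\<Sum>i\<in>{1..n}. \<Sum>l\<in>A i. \<bar>v i\<bar> ^ 3 / 3 + 2 * \<bar>v l\<bar> ^ 3 / 3)"
    by (intro sum_mono)
  also have "\<dots> = (\<Sum>i\<in>{1..n}. \<Sum>l\<in>A i. \<bar>v i\<bar> ^ 3) / 3 + 2 * (\<Sum>i\<in>{1..n}. \<Sum>l\<in>A i. \<bar>v l\<bar> ^ 3) / 3"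
    by (simp only: sum.distrib sum_divide_distrib sum_distrib_left)
  also have "\<dots> \<le> (k * cube_sum v) / 3 + 2 * (k * cube_sum v) / 3"
    unfolding cube_sum_def
    by (intro add_mono divide_right_mono mult_left_mono sum_nbhd_centre_le sum_nbhd_member_le) auto
  finally have "(\<Sum>i\<in>{1..n}. \<Sum>l\<in>A i. \<bar>v i\<bar> * (v l)\<^sup>2) \<le> k * cube_sum v" by simp
  then have "k * (\<Sum>i\<in>{1..n}. \<Sum>l\<in>A i. \<bar>v i\<bar> * (v l)\<^sup>2) \<le> k * (k * cube_sum v)" by (intro mult_left_mono) auto
  then show ?thesis by (simp add: power2_eq_square mult.assoc)
qed

end

section \<open>Random fields with unit variance\<close>

locale unit_variance_field =
  local_dependence M n X A A2 + dependency_neighbourhoods n A A2 k t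
  for M :: "'a measure" and n X A A2 k t +
  assumes second_moment: "expectation (\<lambda>\<omega>. (sum_X n X \<omega>)\<^sup>2) = 1"
    and fourth_integrable: "\<And>i. i \<in> {1..n} \<Longrightarrow> integrable M (\<lambda>\<omega>. X i \<omega> ^ 4)"
begin

abbreviation cfg :: "'a \<Rightarrow> nat \<Rightarrow> real" where "cfg \<omega> \<equiv> (\<lambda>i. X i \<omega>)"

lemma X_measurable [measurable]: "i \<in> {1..n} \<Longrightarrow> X i \<in> borel_measurable M"
  using X_random_variable by simp

text \<open>A bookkeeping device for integrability. All quantities below are dominated by a power of \<open>mass\<close>, and
  the fourth power of \<open>mass\<close> is integrable. So \<open>deg p f\<close> with \<open>p \<le> 4\<close> makes \<open>f\<close> integrable, and degrees add up under
  products.\<close>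

definition mass :: "'a \<Rightarrow> real" where "mass \<omega> = 1 + (\<Sum>i\<in>{1..n}. \<bar>X i \<omega>\<bar>)"

definition deg :: "nat \<Rightarrow> ('a \<Rightarrow> real) \<Rightarrow> bool" where
  "deg p f \<longleftrightarrow> f \<in> borel_measurable M \<and> (\<exists>c\<ge>0. \<forall>\<omega>. \<bar>f \<omega>\<bar> \<le> c * mass \<omega> ^ p)"

lemma mass_ge_1: "1 \<le> mass \<omega>" by (simp add: mass_def sum_nonneg)

lemma mass_nonneg [simp]: "0 \<le> mass \<omega>" using mass_ge_1[of \<omega>] by linarith

lemma mass_fourth_integrable: "integrable M (\<lambda>\<omega>. mass \<omega> ^ 4)"
proof (rule Bochner_Integration.integrable_bound)
  show "integrable M (\<lambda>\<omega>. (real n + 1) ^ 3 * (1 + (\<Sum>i\<in>{1..n}. X i \<omega> ^ 4)))"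
    by (intro integrable_mult_right Bochner_Integration.integrable_add integrable_const
        Bochner_Integration.integrable_sum fourth_integrable)
  show "(\<lambda>\<omega>. mass \<omega> ^ 4) \<in> borel_measurable M" unfolding mass_def by measurable
  show "AE \<omega> in M. norm (mass \<omega> ^ 4) \<le> norm ((real n + 1) ^ 3 * (1 + (\<Sum>i\<in>{1..n}. X i \<omega> ^ 4)))"
  proof (rule AE_I2)
    fix \<omega>
    let ?a = "\<lambda>i. if i = 0 then 1 else \<bar>X i \<omega>\<bar>"
    have e: "{0..n} = insert 0 {1..n}" by auto
    have "(\<Sum>i\<in>{0..n}. ?a i) ^ 4 \<le> (real n + 1) ^ 3 * (\<Sum>i\<in>{0..n}. ?a i ^ 4)"
      by (rule fourth_sum_le) auto
    moreover have "(\<Sum>i\<in>{0..n}. ?a i) = mass \<omega>" unfolding e mass_def by (subst sum.insert) auto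
    moreover have "(\<Sum>i\<in>{0..n}. ?a i ^ 4) = 1 + (\<Sum>i\<in>{1..n}. X i \<omega> ^ 4)" unfolding e by (subst sum.insert) auto
    moreover have "0 \<le> (\<Sum>i\<in>{1..n}. X i \<omega> ^ 4)" by (intro sum_nonneg) auto
    ultimately show "norm (mass \<omega> ^ 4) \<le> norm ((real n + 1) ^ 3 * (1 + (\<Sum>i\<in>{1..n}. X i \<omega> ^ 4)))"
      by (simp add: abs_mult)
  qed
qed

lemma deg_mono: assumes "deg p f" "p \<le> q" shows "deg q f"
proof -
  obtain c where c: "0 \<le> c" "\<And>\<omega>. \<bar>f \<omega>\<bar> \<le> c * mass \<omega> ^ p" and m: "f \<in> borel_measurable M"
    using assms(1) by (auto simp: deg_def)
  have "\<bar>f \<omega>\<bar> \<le> c * mass \<omega> ^ q" for \<omega>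
    using c(2)[of \<omega>] mult_left_mono[OF power_increasing[OF assms(2) mass_ge_1] c(1), of \<omega>] by linarith
  then show ?thesis using c(1) m by (auto simp: deg_def)
qed

lemma deg_integrable: assumes "deg p f" "p \<le> 4" shows "integrable M f"
proof -
  obtain c where c: "0 \<le> c" "\<And>\<omega>. \<bar>f \<omega>\<bar> \<le> c * mass \<omega> ^ 4" and m: "f \<in> borel_measurable M"
    using deg_mono[OF assms] by (auto simp: deg_def)
  show ?thesis
    by (rule Bochner_Integration.integrable_bound[OF integrable_mult_right[OF mass_fourth_integrable, of c] m])
      (use c in \<open>auto simp: abs_mult intro: order_trans\<close>)
qed

lemma deg_measurable: "deg p f \<Longrightarrow> f \<in> borel_measurable M" by (simp add: deg_def)

lemma deg_bounded: "f \<in> borel_measurable M \<Longrightarrow> (\<And>\<omega>. \<bar>f \<omega>\<bar> \<le> c) \<Longrightarrow> deg 0 f"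
  unfolding deg_def by (auto intro!: exI[of _ "max 0 c"] simp: le_max_iff_disj)

lemma deg_const: "deg 0 (\<lambda>_. c)" by (rule deg_bounded[of _ "\<bar>c\<bar>"]) auto

lemma deg_X: assumes "i \<in> {1..n}" shows "deg 1 (X i)"
proof -
  have "\<bar>X i \<omega>\<bar> \<le> mass \<omega>" for \<omega>
    using member_le_sum[of i "{1..n}" "\<lambda>i. \<bar>X i \<omega>\<bar>"] assms by (simp add: mass_def)
  then show ?thesis using assms unfolding deg_def by (auto intro!: exI[of _ 1])
qed

lemma deg_mult: assumes "deg p f" "deg q g" shows "deg (p + q) (\<lambda>\<omega>. f \<omega> * g \<omega>)"
proof -
  obtain c d where c: "0 \<le> c" "\<And>\<omega>. \<bar>f \<omega>\<bar> \<le> c * mass \<omega> ^ p" and d: "0 \<le> d" "\<And>\<omega>. \<bar>g \<omega>\<bar> \<le> d * mass \<omega> ^ q"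
    and [measurable]: "f \<in> borel_measurable M" "g \<in> borel_measurable M"
    using assms by (auto simp: deg_def)
  have "\<bar>f \<omega> * g \<omega>\<bar> \<le> (c * d) * mass \<omega> ^ (p + q)" for \<omega>
  proof -
    have "\<bar>f \<omega> * g \<omega>\<bar> \<le> (c * mass \<omega> ^ p) * (d * mass \<omega> ^ q)"
      unfolding abs_mult using c d by (intro mult_mono) auto
    then show ?thesis by (simp add: power_add mult_ac)
  qed
  then show ?thesis using c(1) d(1) unfolding deg_def by (auto intro!: exI[of _ "c * d"])
qed

lemma deg_add: assumes "deg p f" "deg q g" shows "deg (max p q) (\<lambda>\<omega>. f \<omega> + g \<omega>)"
proof -
  have "deg (max p q) f" "deg (max p q) g" using assms deg_mono by auto
  then obtain c d where c: "0 \<le> c" "\<And>\<omega>. \<bar>f \<omega>\<bar> \<le> c * mass \<omega> ^ max p q"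
    and d: "0 \<le> d" "\<And>\<omega>. \<bar>g \<omega>\<bar> \<le> d * mass \<omega> ^ max p q"
    and [measurable]: "f \<in> borel_measurable M" "g \<in> borel_measurable M"
    by (auto simp: deg_def)
  have "\<bar>f \<omega> + g \<omega>\<bar> \<le> (c + d) * mass \<omega> ^ max p q" for \<omega>
    using c(2)[of \<omega>] d(2)[of \<omega>] abs_triangle_ineq[of "f \<omega>" "g \<omega>"] unfolding distrib_right by linarith
  moreover have "(\<lambda>\<omega>. f \<omega> + g \<omega>) \<in> borel_measurable M" by measurable
  ultimately show ?thesis using c(1) d(1) unfolding deg_def by (intro conjI exI[of _ "c + d"]) auto
qed

lemma deg_cmult: "deg p f \<Longrightarrow> deg p (\<lambda>\<omega>. c * f \<omega>)" using deg_mult[OF deg_const] by simp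
lemma deg_minus: "deg p f \<Longrightarrow> deg p (\<lambda>\<omega>. - f \<omega>)" using deg_cmult[of p f "-1"] by simp
lemma deg_diff: "deg p f \<Longrightarrow> deg q g \<Longrightarrow> deg (max p q) (\<lambda>\<omega>. f \<omega> - g \<omega>)"
  using deg_add[OF _ deg_minus] by simp
lemma deg_divide: "deg p f \<Longrightarrow> deg p (\<lambda>\<omega>. f \<omega> / c)" using deg_cmult[of p f "1 / c"] by simp

lemma deg_abs: "deg p f \<Longrightarrow> deg p (\<lambda>\<omega>. \<bar>f \<omega>\<bar>)"
  unfolding deg_def by auto

lemma deg_power: "deg p f \<Longrightarrow> deg (q * p) (\<lambda>\<omega>. f \<omega> ^ q)"
proof (induction q)
  case 0 then show ?case using deg_const[of 1] by simp
next
  case (Suc q) then show ?case using deg_mult[of p f "q * p"] by simp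
qed

lemma deg_sum: "(\<And>s. s \<in> S \<Longrightarrow> deg p (f s)) \<Longrightarrow> deg p (\<lambda>\<omega>. \<Sum>s\<in>S. f s \<omega>)"
proof (induction S rule: infinite_finite_induct)
  case (insert s S)
  then show ?case using deg_add[of p "f s" p "\<lambda>\<omega>. \<Sum>s\<in>S. f s \<omega>"] by simp
qed (use deg_mono[OF deg_const] in auto)

lemma deg_if: 
  assumes "deg p f" "Measurable.pred M P" shows "deg p (\<lambda>\<omega>. if P \<omega> then f \<omega> else 0)"
proof -
  obtain c where c: "0 \<le> c" "\<And>\<omega>. \<bar>f \<omega>\<bar> \<le> c * mass \<omega> ^ p" and [measurable]: "f \<in> borel_measurable M"
    using assms by (auto simp: deg_def)
  note [measurable] = assms(2)
  have "(\<lambda>\<omega>. if P \<omega> then f \<omega> else 0) \<in> borel_measurable M" by measurable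
  then show ?thesis using c unfolding deg_def by (intro conjI exI[of _ c]) auto
qed

lemma deg_abs_X: "i \<in> {1..n} \<Longrightarrow> deg 1 (\<lambda>\<omega>. \<bar>X i \<omega>\<bar>)" by (intro deg_abs deg_X)

lemma deg_out: "i \<in> {1..n} \<Longrightarrow> deg 1 (\<lambda>\<omega>. out_abs (cfg \<omega>) i)"
  unfolding out_abs_def by (intro deg_sum deg_abs_X) (rule in_A)
lemma deg_in: "i \<in> {1..n} \<Longrightarrow> deg 1 (\<lambda>\<omega>. in_abs (cfg \<omega>) i)"
  unfolding in_abs_def by (intro deg_sum deg_abs_X) (rule in_N)
lemma deg_pair_abs: "i \<in> {1..n} \<Longrightarrow> l \<in> A i \<Longrightarrow> deg 1 (\<lambda>\<omega>. pair_abs (cfg \<omega>) i l)"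
  unfolding pair_abs_def using A2_sub by (intro deg_sum deg_abs_X) blast
lemma deg_zero_on: "i \<in> {1..n} \<Longrightarrow> deg 1 (\<lambda>\<omega>. zero_on B (cfg \<omega>) i)"
  using deg_X[of i] deg_mono[OF deg_const[of 0], of 1] by (cases "i \<in> B") (auto simp: zero_on_def)
lemma deg_lin0: "deg 1 (\<lambda>\<omega>. lin c (zero_on B (cfg \<omega>)))"
  unfolding lin_def by (intro deg_sum deg_cmult deg_zero_on)
lemma deg_quad0: "deg 2 (\<lambda>\<omega>. quad (zero_on B (cfg \<omega>)))"
  unfolding quad_def
proof (intro deg_sum)
  fix i l assume "i \<in> {1..n}" "l \<in> A i"
  then show "deg 2 (\<lambda>\<omega>. zero_on B (cfg \<omega>) i * zero_on B (cfg \<omega>) l)"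
    using deg_mult[OF deg_zero_on deg_zero_on[OF in_A]] by (simp only: one_add_one)
qed
lemma zero_on_empty: "zero_on {} v = v" by (simp add: zero_on_def)
lemma deg_lin: "deg 1 (\<lambda>\<omega>. lin c (cfg \<omega>))" using deg_lin0[of c "{}"] by (simp add: zero_on_empty)
lemma deg_total0: "deg 1 (\<lambda>\<omega>. total (zero_on B (cfg \<omega>)))" unfolding total_def by (rule deg_lin0)
lemma deg_total: "deg 1 (\<lambda>\<omega>. total (cfg \<omega>))" unfolding total_def by (rule deg_lin)
lemma deg_quad: "deg 2 (\<lambda>\<omega>. quad (cfg \<omega>))" using deg_quad0[of "{}"] by (simp add: zero_on_empty)
lemma deg_in_weighted0: "deg 1 (\<lambda>\<omega>. in_weighted (zero_on B (cfg \<omega>)))" unfolding in_weighted_def by (rule deg_lin0)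
lemma deg_in_weighted: "deg 1 (\<lambda>\<omega>. in_weighted (cfg \<omega>))" unfolding in_weighted_def by (rule deg_lin)
lemma deg_mean_term0: "deg 2 (\<lambda>\<omega>. mean_term (zero_on B (cfg \<omega>)))" unfolding mean_term_def
  using deg_cmult[OF deg_mult[OF deg_total0 deg_in_weighted0]] by (simp only: one_add_one)
lemma deg_norm_sq0: "deg 2 (\<lambda>\<omega>. norm_sq (zero_on B (cfg \<omega>)))" unfolding norm_sq_def
  using deg_diff[OF deg_quad0 deg_mean_term0] by simp
lemma deg_mean_term: "deg 2 (\<lambda>\<omega>. mean_term (cfg \<omega>))" using deg_mean_term0[of "{}"] by (simp add: zero_on_empty)
lemma deg_norm_sq: "deg 2 (\<lambda>\<omega>. norm_sq (cfg \<omega>))" using deg_norm_sq0[of "{}"] by (simp add: zero_on_empty)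
lemma deg_cube: "deg 3 (\<lambda>\<omega>. cube_sum (cfg \<omega>))" unfolding cube_sum_def
  using deg_power[OF deg_abs_X, of _ 3] by (intro deg_sum) simp
lemma deg_fourth: "deg 4 (\<lambda>\<omega>. fourth_sum (cfg \<omega>))" unfolding fourth_sum_def
  using deg_power[OF deg_X, of _ 4] by (intro deg_sum) simp

lemmas deg_intros = deg_const deg_X deg_cmult deg_mult deg_add deg_diff deg_minus deg_divide deg_abs deg_power
  deg_sum deg_out deg_in deg_pair_abs deg_lin0 deg_lin deg_total0 deg_total deg_quad0 deg_quad deg_in_weighted0
  deg_in_weighted deg_mean_term0 deg_mean_term deg_norm_sq0 deg_norm_sq deg_cube deg_fourth

section \<open>Independence of leave-out functionals\<close>

text \<open>A functional is determined by the coordinates in \<open>{1..n}\<close>. The hypotheses speak of restricted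
  random vectors; a functional of the configuration in which \<open>B\<close> is set to \<open>0\<close> is a function of the restriction
  to \<open>{1..n} - B\<close>.\<close>

definition functional :: "((nat \<Rightarrow> real) \<Rightarrow> real) \<Rightarrow> bool" where
  "functional \<Phi> \<longleftrightarrow> \<Phi> \<in> borel_measurable (PiM {1..n} (\<lambda>_. borel)) \<and>
     (\<forall>v w. (\<forall>i\<in>{1..n}. v i = w i) \<longrightarrow> \<Phi> v = \<Phi> w)"

lemma functional_lin: "functional (lin c)"
  unfolding functional_def
proof (intro conjI allI impI)
  show "lin c \<in> borel_measurable (PiM {1..n} (\<lambda>_. borel))"
    unfolding lin_def by measurable
qed (auto intro: lin_local)

lemma functional_total: "functional total" 
  using functional_lin[of "\<lambda>_. 1"] unfolding functional_def total_def[abs_def] by simp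

lemma functional_norm_sq: "functional norm_sq"
  unfolding functional_def
proof (intro conjI allI impI)
  have [measurable]: "(\<lambda>v. v l) \<in> borel_measurable (PiM {1..n} (\<lambda>_. borel))" if "l \<in> {1..n}" for l
    using that by (rule measurable_component_singleton)
  have [measurable]: "lin c \<in> borel_measurable (PiM {1..n} (\<lambda>_. borel))" for c
    using functional_lin[of c] by (simp add: functional_def)
  have [measurable]: "quad \<in> borel_measurable (PiM {1..n} (\<lambda>_. borel))"
    unfolding quad_def
    by (intro borel_measurable_sum borel_measurable_times measurable_component_singleton) (assumption, rule in_A)
  show "norm_sq \<in> borel_measurable (PiM {1..n} (\<lambda>_. borel))"
    unfolding norm_sq_def mean_term_def total_def in_weighted_def by measurable
qed (auto intro: norm_sq_local)

lemma functional_comp: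
  assumes "functional \<Phi>" "functional \<Psi>" "(\<lambda>(s, t). f s t) \<in> borel_measurable (borel \<Otimes>\<^sub>M borel)"
  shows "functional (\<lambda>v. f (\<Phi> v) (\<Psi> v))"
  unfolding functional_def
proof (intro conjI allI impI)
  have [measurable]: "\<Phi> \<in> borel_measurable (PiM {1..n} (\<lambda>_. borel))" "\<Psi> \<in> borel_measurable (PiM {1..n} (\<lambda>_. borel))"
    using assms(1,2) by (auto simp: functional_def)
  note [measurable] = assms(3)
  have "(\<lambda>v. (\<lambda>(s, t). f s t) (\<Phi> v, \<Psi> v)) \<in> borel_measurable (PiM {1..n} (\<lambda>_. borel))"
    by measurable
  then show "(\<lambda>v. f (\<Phi> v) (\<Psi> v)) \<in> borel_measurable (PiM {1..n} (\<lambda>_. borel))" by simp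
next
  fix v w :: "nat \<Rightarrow> real" assume "\<forall>i\<in>{1..n}. v i = w i"
  then have "\<Phi> v = \<Phi> w" "\<Psi> v = \<Psi> w" using assms(1,2) unfolding functional_def by blast+
  then show "f (\<Phi> v) (\<Psi> v) = f (\<Phi> w) (\<Psi> w)" by simp
qed

lemma functional_comp1: "functional \<Phi> \<Longrightarrow> g \<in> borel_measurable borel \<Longrightarrow> functional (\<lambda>v. g (\<Phi> v))"
  by (rule functional_comp[where f="\<lambda>s t. g s" and \<Psi>=\<Phi>]) auto

lemma indep_zero_on:
  assumes ind: "indep_var (PiM J (\<lambda>_. borel)) (\<lambda>\<omega>. \<lambda>j\<in>J. X j \<omega>)
        (PiM ({1..n} - B) (\<lambda>_. borel)) (\<lambda>\<omega>. \<lambda>j\<in>{1..n} - B. X j \<omega>)"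
    and f: "f \<in> borel_measurable (PiM J (\<lambda>_. borel))" and \<Phi>: "functional \<Phi>"
  shows "indep_var borel (\<lambda>\<omega>. f (\<lambda>j\<in>J. X j \<omega>)) borel (\<lambda>\<omega>. \<Phi> (zero_on B (cfg \<omega>)))"
proof -
  define r :: "(nat \<Rightarrow> real) \<Rightarrow> nat \<Rightarrow> real" where "r v = (\<lambda>j\<in>{1..n}. if j \<in> B then 0 else v j)" for v
  have "r \<in> measurable (PiM ({1..n} - B) (\<lambda>_. borel)) (PiM {1..n} (\<lambda>_. borel))"
    unfolding r_def
  proof (rule measurable_restrict)
    fix j assume "j \<in> {1..n}"
    then show "(\<lambda>v. if j \<in> B then 0 else v j) \<in> measurable (PiM ({1..n} - B) (\<lambda>_. borel)) borel"
      by (cases "j \<in> B") (auto intro!: measurable_component_singleton)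
  qed
  then have "(\<lambda>v. \<Phi> (r v)) \<in> borel_measurable (PiM ({1..n} - B) (\<lambda>_. borel))"
    using \<Phi> unfolding functional_def by (auto intro: measurable_compose)
  from indep_var_compose[OF ind f this]
  have "indep_var borel (f \<circ> (\<lambda>\<omega>. \<lambda>j\<in>J. X j \<omega>)) borel ((\<lambda>v. \<Phi> (r v)) \<circ> (\<lambda>\<omega>. \<lambda>j\<in>{1..n} - B. X j \<omega>))" .
  moreover have "\<Phi> (r (\<lambda>j\<in>{1..n} - B. X j \<omega>)) = \<Phi> (zero_on B (cfg \<omega>))" for \<omega>
  proof -
    have "\<forall>i\<in>{1..n}. r (\<lambda>j\<in>{1..n} - B. X j \<omega>) i = zero_on B (cfg \<omega>) i" by (simp add: r_def zero_on_def)
    then show ?thesis using \<Phi> unfolding functional_def by blast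
  qed
  ultimately show ?thesis by (simp add: comp_def)
qed

lemma expectation_single:
  assumes i: "i \<in> {1..n}" and g: "g \<in> borel_measurable borel" and \<Phi>: "functional \<Phi>"
    and "integrable M (\<lambda>\<omega>. g (X i \<omega>))" "integrable M (\<lambda>\<omega>. \<Phi> (zero_on (A i) (cfg \<omega>)))"
  shows "expectation (\<lambda>\<omega>. g (X i \<omega>) * \<Phi> (zero_on (A i) (cfg \<omega>)))
    = expectation (\<lambda>\<omega>. g (X i \<omega>)) * expectation (\<lambda>\<omega>. \<Phi> (zero_on (A i) (cfg \<omega>)))"
proof -
  have "(\<lambda>v. g (v i)) \<in> borel_measurable (PiM {i} (\<lambda>_. borel))"
    using g by (intro measurable_compose[OF measurable_component_singleton]) auto
  from indep_zero_on[OF A_indep[OF i] this \<Phi>]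
  have "indep_var borel (\<lambda>\<omega>. g (X i \<omega>)) borel (\<lambda>\<omega>. \<Phi> (zero_on (A i) (cfg \<omega>)))" by simp
  then show ?thesis using assms(4,5) by (rule indep_var_lebesgue_integral)
qed

lemma expectation_pair:
  assumes i: "i \<in> {1..n}" "l \<in> A i" and g: "(\<lambda>(s, t). g s t) \<in> borel_measurable (borel \<Otimes>\<^sub>M borel)" and \<Phi>: "functional \<Phi>"
    and "integrable M (\<lambda>\<omega>. g (X i \<omega>) (X l \<omega>))" "integrable M (\<lambda>\<omega>. \<Phi> (zero_on (A2 i l) (cfg \<omega>)))"
  shows "expectation (\<lambda>\<omega>. g (X i \<omega>) (X l \<omega>) * \<Phi> (zero_on (A2 i l) (cfg \<omega>)))
    = expectation (\<lambda>\<omega>. g (X i \<omega>) (X l \<omega>)) * expectation (\<lambda>\<omega>. \<Phi> (zero_on (A2 i l) (cfg \<omega>)))"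
proof -
  have [measurable]: "(\<lambda>v. v j) \<in> borel_measurable (PiM {i, l} (\<lambda>_. borel))" if "j \<in> {i, l}" for j
    using that by (rule measurable_component_singleton)
  have "(\<lambda>v. (\<lambda>(s, t). g s t) (v i, v l)) \<in> borel_measurable (PiM {i, l} (\<lambda>_. borel))"
    using g by (rule measurable_compose[rotated]) measurable
  then have "(\<lambda>v. g (v i) (v l)) \<in> borel_measurable (PiM {i, l} (\<lambda>_. borel))" by simp
  from indep_zero_on[OF A2_indep[OF i] this \<Phi>]
  have "indep_var borel (\<lambda>\<omega>. g (X i \<omega>) (X l \<omega>)) borel (\<lambda>\<omega>. \<Phi> (zero_on (A2 i l) (cfg \<omega>)))" by simp
  then show ?thesis using assms(5,6) by (rule indep_var_lebesgue_integral)
qed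

end

section \<open>Moments of linear and cubic functionals\<close>

context unit_variance_field
begin

lemma expectation_centred:
  assumes i: "i \<in> {1..n}" and \<Phi>: "functional \<Phi>" "integrable M (\<lambda>\<omega>. \<Phi> (zero_on (A i) (cfg \<omega>)))"
  shows "expectation (\<lambda>\<omega>. X i \<omega> * \<Phi> (zero_on (A i) (cfg \<omega>))) = 0"
  using expectation_single[OF i _ \<Phi>(1) _ \<Phi>(2), of "\<lambda>x. x"] X_integrable[OF i] X_centered[OF i] by simp

definition lam :: real where "lam = k * (\<Sum>i\<in>{1..n}. expectation (\<lambda>\<omega>. (X i \<omega>)\<^sup>2))"

lemma expectation_sum_square: "expectation (\<lambda>\<omega>. k * (\<Sum>i\<in>{1..n}. (X i \<omega>)\<^sup>2)) = lam"
proof -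
  have "integrable M (\<lambda>\<omega>. (X i \<omega>)\<^sup>2)" if "i \<in> {1..n}" for i
    by (rule deg_integrable, (rule deg_intros that)+, simp)
  then show ?thesis unfolding lam_def by (simp add: Bochner_Integration.integral_sum)
qed

lemma expectation_abs_out_le: "expectation (\<lambda>\<omega>. \<Sum>i\<in>{1..n}. \<bar>X i \<omega>\<bar> * out_abs (cfg \<omega>) i) \<le> lam"
  unfolding expectation_sum_square[symmetric]
proof (rule integral_mono)
  show "integrable M (\<lambda>\<omega>. \<Sum>i\<in>{1..n}. \<bar>X i \<omega>\<bar> * out_abs (cfg \<omega>) i)"
    by (rule deg_integrable, (rule deg_intros | assumption)+, simp)
  show "integrable M (\<lambda>\<omega>. k * (\<Sum>i\<in>{1..n}. (X i \<omega>)\<^sup>2))"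
    by (rule deg_integrable, (rule deg_intros | assumption)+, simp)
qed (rule sum_abs_out_le)

text \<open>Every covariance of \<open>X i\<close> with a variable outside \<open>A i\<close> vanishes, so at most the products of neighbours
  contribute. For the weights \<open>1\<close> the left-hand side is the variance \<open>1\<close>, and therefore \<open>1 \<le> lam\<close>.\<close>

lemma expectation_lin_square:
  assumes c: "\<And>i. i \<in> {1..n} \<Longrightarrow> 0 \<le> c i" "\<And>i. i \<in> {1..n} \<Longrightarrow> c i \<le> 1"
  shows "expectation (\<lambda>\<omega>. (lin c (cfg \<omega>))\<^sup>2) \<le> lam"
proof -
  let ?d = "\<lambda>i \<omega>. lin c (cfg \<omega>) - lin c (zero_on (A i) (cfg \<omega>))"
  have i1: "integrable M (\<lambda>\<omega>. c i * X i \<omega> * ?d i \<omega>)" "integrable M (\<lambda>\<omega>. X i \<omega> * lin c (zero_on (A i) (cfg \<omega>)))"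
    if "i \<in> {1..n}" for i
    by (rule deg_integrable, (rule deg_intros that)+, simp)+
  have i0: "integrable M (\<lambda>\<omega>. \<Sum>i\<in>{1..n}. c i * X i \<omega> * ?d i \<omega>)"
    by (rule deg_integrable, (rule deg_intros | assumption)+, simp)
  have i3: "integrable M (\<lambda>\<omega>. \<Sum>i\<in>{1..n}. c i * (X i \<omega> * lin c (zero_on (A i) (cfg \<omega>))))"
    by (intro Bochner_Integration.integrable_sum integrable_mult_right i1(2))
  have il: "integrable M (\<lambda>\<omega>. lin c (zero_on B (cfg \<omega>)))" for B
    by (rule deg_integrable, rule deg_intros, simp)
  have "(lin c (cfg \<omega>))\<^sup>2 = (\<Sum>i\<in>{1..n}. c i * X i \<omega> * ?d i \<omega>) + (\<Sum>i\<in>{1..n}. c i * (X i \<omega> * lin c (zero_on (A i) (cfg \<omega>))))" for \<omega>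
  proof -
    have "(lin c (cfg \<omega>))\<^sup>2 = (\<Sum>i\<in>{1..n}. c i * X i \<omega> * lin c (cfg \<omega>))"
      by (simp add: power2_eq_square lin_def[of _ "cfg \<omega>"] sum_distrib_right)
    then show ?thesis by (simp add: sum.distrib[symmetric] algebra_simps)
  qed
  then have "expectation (\<lambda>\<omega>. (lin c (cfg \<omega>))\<^sup>2) = expectation (\<lambda>\<omega>. \<Sum>i\<in>{1..n}. c i * X i \<omega> * ?d i \<omega>)
     + expectation (\<lambda>\<omega>. \<Sum>i\<in>{1..n}. c i * (X i \<omega> * lin c (zero_on (A i) (cfg \<omega>))))"
    by (simp only: Bochner_Integration.integral_add[OF i0 i3])
  also have "expectation (\<lambda>\<omega>. \<Sum>i\<in>{1..n}. c i * (X i \<omega> * lin c (zero_on (A i) (cfg \<omega>))))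
     = (\<Sum>i\<in>{1..n}. c i * expectation (\<lambda>\<omega>. X i \<omega> * lin c (zero_on (A i) (cfg \<omega>))))"
    using i1(2) by (subst Bochner_Integration.integral_sum) auto
  also have "(\<Sum>i\<in>{1..n}. c i * expectation (\<lambda>\<omega>. X i \<omega> * lin c (zero_on (A i) (cfg \<omega>)))) = 0"
    using expectation_centred[OF _ functional_lin il] by (intro sum.neutral ballI) simp
  also have "expectation (\<lambda>\<omega>. \<Sum>i\<in>{1..n}. c i * X i \<omega> * ?d i \<omega>)
      \<le> expectation (\<lambda>\<omega>. \<Sum>i\<in>{1..n}. \<bar>X i \<omega>\<bar> * out_abs (cfg \<omega>) i)"
  proof (rule integral_mono[OF i0])
    show "integrable M (\<lambda>\<omega>. \<Sum>i\<in>{1..n}. \<bar>X i \<omega>\<bar> * out_abs (cfg \<omega>) i)"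
      by (rule deg_integrable, (rule deg_intros | assumption)+, simp)
    fix \<omega>
    show "(\<Sum>i\<in>{1..n}. c i * X i \<omega> * ?d i \<omega>) \<le> (\<Sum>i\<in>{1..n}. \<bar>X i \<omega>\<bar> * out_abs (cfg \<omega>) i)"
    proof (rule sum_mono)
      fix i assume i: "i \<in> {1..n}"
      have "c i * X i \<omega> * ?d i \<omega> \<le> \<bar>c i * X i \<omega>\<bar> * \<bar>?d i \<omega>\<bar>" by (metis abs_ge_self abs_mult)
      also have "\<dots> \<le> \<bar>X i \<omega>\<bar> * out_abs (cfg \<omega>) i"
        unfolding out_abs_def using c[OF i]
        by (intro mult_mono lin_zero_on_diff_le A_sub i c) (auto simp: abs_mult intro: mult_left_le_one_le)
      finally show "c i * X i \<omega> * ?d i \<omega> \<le> \<bar>X i \<omega>\<bar> * out_abs (cfg \<omega>) i" .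
    qed
  qed
  also have "\<dots> \<le> lam" by (rule expectation_abs_out_le)
  finally show ?thesis by simp
qed

lemma total_eq: "total (cfg \<omega>) = sum_X n X \<omega>" by (simp add: total_def lin_def sum_X_def)

lemma total_second_moment: "expectation (\<lambda>\<omega>. (total (cfg \<omega>))\<^sup>2) = 1"
  using second_moment by (simp add: total_eq)

lemma lam_ge_1: "1 \<le> lam"
  using expectation_lin_square[of "\<lambda>_. 1"] total_second_moment by (simp add: total_def)

text \<open>The total of all \<open>X i * Y i\<close> estimates the variance without bias, as \<open>X i\<close> is uncorrelated with \<open>S - Y i\<close>.\<close>

lemma quad_expectation: "expectation (\<lambda>\<omega>. quad (cfg \<omega>)) = 1"
proof -
  have i0: "integrable M (\<lambda>\<omega>. X i \<omega> * total (cfg \<omega>))" "integrable M (\<lambda>\<omega>. X i \<omega> * total (zero_on (A i) (cfg \<omega>)))"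
     if "i \<in> {1..n}" for i
    by (rule deg_integrable, (rule deg_intros that)+, simp)+
  have il: "integrable M (\<lambda>\<omega>. total (zero_on B (cfg \<omega>)))" for B
    by (rule deg_integrable, rule deg_intros, simp)
  have "quad (cfg \<omega>) = (\<Sum>i\<in>{1..n}. X i \<omega> * total (cfg \<omega>) - X i \<omega> * total (zero_on (A i) (cfg \<omega>)))" for \<omega>
    unfolding quad_def right_diff_distrib[symmetric]
    by (intro sum.cong refl) (simp only: total_minus_zero_on[OF A_sub] sum_distrib_left)
  then have "expectation (\<lambda>\<omega>. quad (cfg \<omega>)) = (\<Sum>i\<in>{1..n}. expectation (\<lambda>\<omega>. X i \<omega> * total (cfg \<omega>))
      - expectation (\<lambda>\<omega>. X i \<omega> * total (zero_on (A i) (cfg \<omega>))))"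
    using i0 by (simp add: Bochner_Integration.integral_sum Bochner_Integration.integral_diff)
  also have "\<dots> = (\<Sum>i\<in>{1..n}. expectation (\<lambda>\<omega>. X i \<omega> * total (cfg \<omega>)))"
    using expectation_centred[OF _ functional_total il] by (intro sum.cong) auto
  also have "\<dots> = expectation (\<lambda>\<omega>. (total (cfg \<omega>))\<^sup>2)"
    using i0 by (subst Bochner_Integration.integral_sum[symmetric])
      (auto simp: power2_eq_square total_def lin_def sum_distrib_right)
  finally show ?thesis using total_second_moment by simp
qed

end

text \<open>From here on \<open>b\<close> is a small number that dominates both moment quantities of the Berry-Esseen bound for the
  variables divided by the standard deviation. The restriction \<open>3072 * b \<le> 1\<close> costs nothing, because
  a larger \<open>b\<close> makes the bound trivial; \<open>3072 * b\<close> will be the width of the test functions.\<close>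

locale normalized_field = unit_variance_field M n X A A2 k t
  for M :: "'a measure" and n X A A2 k t +
  fixes b :: real
  assumes b_pos: "0 < b" and b_small: "3072 * b \<le> 1"
    and cube_le: "k\<^sup>2 * expectation (\<lambda>\<omega>. cube_sum (\<lambda>i. X i \<omega>)) \<le> b"
    and fourth_le: "k * (k\<^sup>2 + t) * expectation (\<lambda>\<omega>. fourth_sum (\<lambda>i. X i \<omega>)) \<le> b\<^sup>2"
begin

lemma k_cube_fourth: "k ^ 3 * expectation (\<lambda>\<omega>. fourth_sum (cfg \<omega>)) \<le> b\<^sup>2"
proof -
  have "k ^ 3 * expectation (\<lambda>\<omega>. fourth_sum (cfg \<omega>)) \<le> k * (k\<^sup>2 + t) * expectation (\<lambda>\<omega>. fourth_sum (cfg \<omega>))"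
    using t_nonneg by (intro mult_right_mono Bochner_Integration.integral_nonneg)
      (auto simp: power2_eq_square power3_eq_cube distrib_left)
  then show ?thesis using fourth_le by linarith
qed

lemma b_le_1: "b \<le> 1" "b\<^sup>2 \<le> b" "b\<^sup>2 \<le> 1"
  using b_pos b_small by (auto simp: power2_eq_square mult_le_one mult_left_le)

lemma small_fourth:
  assumes "B \<subseteq> {1..n}" "real (card B) \<le> k"
  shows "expectation (\<lambda>\<omega>. (\<Sum>l\<in>B. \<bar>X l \<omega>\<bar>) ^ 4) \<le> 1"
proof -
  have fin: "finite B" using assms(1) finite_subset by blast
  have "expectation (\<lambda>\<omega>. (\<Sum>l\<in>B. \<bar>X l \<omega>\<bar>) ^ 4) \<le> expectation (\<lambda>\<omega>. k ^ 3 * fourth_sum (cfg \<omega>))"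
  proof (rule integral_mono)
    have "B \<subseteq> {1..n}" by fact
    then show "integrable M (\<lambda>\<omega>. (\<Sum>l\<in>B. \<bar>X l \<omega>\<bar>) ^ 4)"
      by (intro deg_integrable[OF deg_power[OF deg_sum[OF deg_abs_X]]]) auto
    show "integrable M (\<lambda>\<omega>. k ^ 3 * fourth_sum (cfg \<omega>))"
      by (rule deg_integrable, (rule deg_intros)+, simp)
    fix \<omega>
    have "(\<Sum>l\<in>B. \<bar>X l \<omega>\<bar>) ^ 4 \<le> k ^ 3 * (\<Sum>l\<in>B. \<bar>X l \<omega>\<bar> ^ 4)"
      by (rule fourth_sum_le[OF fin assms(2)])
    also have "\<dots> \<le> k ^ 3 * fourth_sum (cfg \<omega>)"
      unfolding fourth_sum_def using assms(1) by (intro mult_left_mono) (auto intro!: sum_mono2)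
    finally show "(\<Sum>l\<in>B. \<bar>X l \<omega>\<bar>) ^ 4 \<le> k ^ 3 * fourth_sum (cfg \<omega>)" .
  qed
  also have "\<dots> \<le> 1" using k_cube_fourth b_le_1 by simp
  finally show ?thesis .
qed

text \<open>A sum over one neighbourhood is small in \<open>L\<^sup>4\<close>. Hence leaving out a neighbourhood changes first and second moments
  only by constants.\<close>

lemma small_second:
  assumes "B \<subseteq> {1..n}" "real (card B) \<le> k"
  shows "expectation (\<lambda>\<omega>. (\<Sum>l\<in>B. \<bar>X l \<omega>\<bar>)\<^sup>2) \<le> 1" "expectation (\<lambda>\<omega>. \<Sum>l\<in>B. \<bar>X l \<omega>\<bar>) \<le> 1"
proof -
  let ?y = "\<lambda>\<omega>. \<Sum>l\<in>B. \<bar>X l \<omega>\<bar>"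
  have sub: "B \<subseteq> {1..n}" by fact
  have d: "deg 1 ?y" using sub by (intro deg_sum deg_abs_X) auto
  have i1: "integrable M ?y" by (rule deg_integrable[OF d]) simp
  have i2: "integrable M (\<lambda>\<omega>. (?y \<omega>)\<^sup>2)" by (rule deg_integrable[OF deg_power[OF d]]) simp
  have i4: "integrable M (\<lambda>\<omega>. (?y \<omega>) ^ 4)" by (rule deg_integrable[OF deg_power[OF d]]) simp
  have "expectation (\<lambda>\<omega>. (?y \<omega>)\<^sup>2) \<le> expectation (\<lambda>\<omega>. (1 + ?y \<omega> ^ 4) / 2)"
  proof (rule integral_mono[OF i2])
    show "integrable M (\<lambda>\<omega>. (1 + ?y \<omega> ^ 4) / 2)" using i4 by simp
    fix \<omega> show "(?y \<omega>)\<^sup>2 \<le> (1 + ?y \<omega> ^ 4) / 2" using sum_squares_bound[of 1 "(?y \<omega>)\<^sup>2"] by simp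
  qed
  also have "\<dots> \<le> 1" using small_fourth[OF assms] i4 by (simp add: prob_space)
  finally show 2: "expectation (\<lambda>\<omega>. (?y \<omega>)\<^sup>2) \<le> 1" .
  have "expectation (\<lambda>\<omega>. ?y \<omega>) \<le> expectation (\<lambda>\<omega>. (1 + (?y \<omega>)\<^sup>2) / 2)"
  proof (rule integral_mono[OF i1])
    show "integrable M (\<lambda>\<omega>. (1 + (?y \<omega>)\<^sup>2) / 2)" using i2 by simp
    fix \<omega> show "?y \<omega> \<le> (1 + (?y \<omega>)\<^sup>2) / 2" using sum_squares_bound[of 1 "?y \<omega>"] by simp
  qed
  also have "\<dots> \<le> 1" using 2 i2 by (simp add: prob_space)
  finally show "expectation (\<lambda>\<omega>. ?y \<omega>) \<le> 1" .
qed

lemma expectation_abs_total: "expectation (\<lambda>\<omega>. \<bar>total (cfg \<omega>)\<bar>) \<le> 1"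
proof -
  have i2: "integrable M (\<lambda>\<omega>. (total (cfg \<omega>))\<^sup>2)"
    by (rule deg_integrable, (rule deg_intros)+, simp)
  have "expectation (\<lambda>\<omega>. \<bar>total (cfg \<omega>)\<bar>) \<le> expectation (\<lambda>\<omega>. (1 + (total (cfg \<omega>))\<^sup>2) / 2)"
  proof (rule integral_mono)
    show "integrable M (\<lambda>\<omega>. \<bar>total (cfg \<omega>)\<bar>)" by (rule deg_integrable, (rule deg_intros)+, simp)
    show "integrable M (\<lambda>\<omega>. (1 + (total (cfg \<omega>))\<^sup>2) / 2)" using i2 by simp
    fix \<omega> show "\<bar>total (cfg \<omega>)\<bar> \<le> (1 + (total (cfg \<omega>))\<^sup>2) / 2"
      using sum_squares_bound[of 1 "\<bar>total (cfg \<omega>)\<bar>"] by simp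
  qed
  also have "\<dots> = 1" using total_second_moment i2 by (simp add: prob_space)
  finally show ?thesis .
qed

text \<open>The pointwise bound of the previous sections contains only pure cubes \<open>\<bar>X i\<bar> ^ 3\<close>. Each of them is independent
  of the total without \<open>A i\<close>, and the difference of the totals has fourth order. So no moment beyond the fourth is
  involved.\<close>

lemma expectation_cube_total: "k\<^sup>2 * expectation (\<lambda>\<omega>. cube_sum (cfg \<omega>) * \<bar>total (cfg \<omega>)\<bar>) \<le> 3 * b"
proof -
  have i1: "integrable M (\<lambda>\<omega>. \<bar>X i \<omega>\<bar> ^ 3)" "integrable M (\<lambda>\<omega>. \<bar>X i \<omega>\<bar> ^ 3 * out_abs (cfg \<omega>) i)"
    "integrable M (\<lambda>\<omega>. \<bar>X i \<omega>\<bar> ^ 3 * \<bar>total (zero_on (A i) (cfg \<omega>))\<bar>)" if "i \<in> {1..n}" for i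
    by (rule deg_integrable, (rule deg_intros that)+, simp)+
  have it: "integrable M (\<lambda>\<omega>. \<bar>total (zero_on B (cfg \<omega>))\<bar>)" for B
    by (rule deg_integrable, (rule deg_intros)+, simp)
  have single: "expectation (\<lambda>\<omega>. \<bar>X i \<omega>\<bar> ^ 3 * \<bar>total (zero_on (A i) (cfg \<omega>))\<bar>) \<le> 2 * expectation (\<lambda>\<omega>. \<bar>X i \<omega>\<bar> ^ 3)"
    if i: "i \<in> {1..n}" for i
  proof -
    have io: "integrable M (\<lambda>\<omega>. out_abs (cfg \<omega>) i)" by (rule deg_integrable, (rule deg_intros i)+, simp)
    have ia: "integrable M (\<lambda>\<omega>. \<bar>total (cfg \<omega>)\<bar>)" by (rule deg_integrable, (rule deg_intros)+, simp)
    have "expectation (\<lambda>\<omega>. \<bar>total (zero_on (A i) (cfg \<omega>))\<bar>) \<le> expectation (\<lambda>\<omega>. \<bar>total (cfg \<omega>)\<bar> + out_abs (cfg \<omega>) i)"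
      using total_zero_on_le[OF i] io ia by (intro integral_mono it) auto
    also have "\<dots> \<le> 1 + 1"
      using io ia expectation_abs_total small_second(2)[OF A_sub[OF i] card_A[OF i]]
      by (simp add: out_abs_def)
    finally have "expectation (\<lambda>\<omega>. \<bar>total (zero_on (A i) (cfg \<omega>))\<bar>) \<le> 2" by simp
    moreover have "expectation (\<lambda>\<omega>. \<bar>X i \<omega>\<bar> ^ 3 * \<bar>total (zero_on (A i) (cfg \<omega>))\<bar>)
       = expectation (\<lambda>\<omega>. \<bar>X i \<omega>\<bar> ^ 3) * expectation (\<lambda>\<omega>. \<bar>total (zero_on (A i) (cfg \<omega>))\<bar>)"
      using i1(1)[OF i] it by (intro expectation_single[OF i, where g="\<lambda>x. \<bar>x\<bar> ^ 3"] functional_comp1[OF functional_total]) auto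
    ultimately show ?thesis
      using mult_left_mono[of "expectation (\<lambda>\<omega>. \<bar>total (zero_on (A i) (cfg \<omega>))\<bar>)" 2 "expectation (\<lambda>\<omega>. \<bar>X i \<omega>\<bar> ^ 3)"] by simp
  qed
  have ic: "integrable M (\<lambda>\<omega>. cube_sum (cfg \<omega>))" by (rule deg_integrable, (rule deg_intros)+, simp)
  have i4: "integrable M (\<lambda>\<omega>. fourth_sum (cfg \<omega>))" by (rule deg_integrable, (rule deg_intros)+, simp)
  have i5: "integrable M (\<lambda>\<omega>. \<Sum>i\<in>{1..n}. \<bar>X i \<omega>\<bar> ^ 3 * \<bar>total (zero_on (A i) (cfg \<omega>))\<bar>)"
    by (rule deg_integrable, (rule deg_intros | assumption)+, simp)
  have "expectation (\<lambda>\<omega>. cube_sum (cfg \<omega>) * \<bar>total (cfg \<omega>)\<bar>)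
     \<le> expectation (\<lambda>\<omega>. (\<Sum>i\<in>{1..n}. \<bar>X i \<omega>\<bar> ^ 3 * \<bar>total (zero_on (A i) (cfg \<omega>))\<bar>) + k * fourth_sum (cfg \<omega>))"
  proof (rule integral_mono)
    show "integrable M (\<lambda>\<omega>. cube_sum (cfg \<omega>) * \<bar>total (cfg \<omega>)\<bar>)"
      by (rule deg_integrable, (rule deg_intros)+, simp)
    show "integrable M (\<lambda>\<omega>. (\<Sum>i\<in>{1..n}. \<bar>X i \<omega>\<bar> ^ 3 * \<bar>total (zero_on (A i) (cfg \<omega>))\<bar>) + k * fourth_sum (cfg \<omega>))"
      using i5 i4 by simp
    fix \<omega>
    have "cube_sum (cfg \<omega>) * \<bar>total (cfg \<omega>)\<bar> = (\<Sum>i\<in>{1..n}. \<bar>X i \<omega>\<bar> ^ 3 * \<bar>total (cfg \<omega>)\<bar>)"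
      by (simp add: cube_sum_def sum_distrib_right)
    also have "\<dots> \<le> (\<Sum>i\<in>{1..n}. \<bar>X i \<omega>\<bar> ^ 3 * (\<bar>total (zero_on (A i) (cfg \<omega>))\<bar> + out_abs (cfg \<omega>) i))"
    proof (intro sum_mono mult_left_mono)
      fix i assume "i \<in> {1..n}"
      then have "\<bar>total (cfg \<omega>) - total (zero_on (A i) (cfg \<omega>))\<bar> \<le> out_abs (cfg \<omega>) i"
        unfolding total_def out_abs_def by (intro lin_zero_on_diff_le A_sub) auto
      then show "\<bar>total (cfg \<omega>)\<bar> \<le> \<bar>total (zero_on (A i) (cfg \<omega>))\<bar> + out_abs (cfg \<omega>) i" by linarith
    qed auto
    also have "\<dots> \<le> (\<Sum>i\<in>{1..n}. \<bar>X i \<omega>\<bar> ^ 3 * \<bar>total (zero_on (A i) (cfg \<omega>))\<bar>) + k * fourth_sum (cfg \<omega>)"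
      using sum_cube_out[of "cfg \<omega>"] by (simp add: distrib_left sum.distrib)
    finally show "cube_sum (cfg \<omega>) * \<bar>total (cfg \<omega>)\<bar> \<le> (\<Sum>i\<in>{1..n}. \<bar>X i \<omega>\<bar> ^ 3 * \<bar>total (zero_on (A i) (cfg \<omega>))\<bar>) + k * fourth_sum (cfg \<omega>)" .
  qed
  also have "\<dots> = (\<Sum>i\<in>{1..n}. expectation (\<lambda>\<omega>. \<bar>X i \<omega>\<bar> ^ 3 * \<bar>total (zero_on (A i) (cfg \<omega>))\<bar>)) + k * expectation (\<lambda>\<omega>. fourth_sum (cfg \<omega>))"
    using i5 i4 i1(3) by (simp add: Bochner_Integration.integral_sum)
  also have "\<dots> \<le> (\<Sum>i\<in>{1..n}. 2 * expectation (\<lambda>\<omega>. \<bar>X i \<omega>\<bar> ^ 3)) + k * expectation (\<lambda>\<omega>. fourth_sum (cfg \<omega>))"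
    by (intro add_right_mono sum_mono single)
  also have "(\<Sum>i\<in>{1..n}. 2 * expectation (\<lambda>\<omega>. \<bar>X i \<omega>\<bar> ^ 3)) = 2 * expectation (\<lambda>\<omega>. cube_sum (cfg \<omega>))"
    unfolding cube_sum_def using i1(1) by (simp add: Bochner_Integration.integral_sum sum_distrib_left)
  finally have "k\<^sup>2 * expectation (\<lambda>\<omega>. cube_sum (cfg \<omega>) * \<bar>total (cfg \<omega>)\<bar>)
     \<le> k\<^sup>2 * (2 * expectation (\<lambda>\<omega>. cube_sum (cfg \<omega>)) + k * expectation (\<lambda>\<omega>. fourth_sum (cfg \<omega>)))"
    by (intro mult_left_mono) auto
  also have "\<dots> = 2 * (k\<^sup>2 * expectation (\<lambda>\<omega>. cube_sum (cfg \<omega>))) + k ^ 3 * expectation (\<lambda>\<omega>. fourth_sum (cfg \<omega>))"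
    by (simp add: algebra_simps power2_eq_square power3_eq_cube)
  also have "\<dots> \<le> 2 * b + b" using cube_le k_cube_fourth b_le_1(2) by linarith
  finally show ?thesis by simp
qed

text \<open>The same argument for products of two neighbours, which are independent of the variables outside \<open>A2 i l\<close>.\<close>

lemma expectation_pair_lin_square:
  assumes c: "\<And>i. i \<in> {1..n} \<Longrightarrow> 0 \<le> c i" "\<And>i. i \<in> {1..n} \<Longrightarrow> c i \<le> 1"
  shows "expectation (\<lambda>\<omega>. (\<Sum>i\<in>{1..n}. \<bar>X i \<omega>\<bar> * out_abs (cfg \<omega>) i) * (lin c (cfg \<omega>))\<^sup>2) \<le> 10 * lam\<^sup>2"
proof -
  let ?L = "\<lambda>i l \<omega>. lin c (zero_on (A2 i l) (cfg \<omega>))"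
  have X_l: "l \<in> {1..n}" if "i \<in> {1..n}" "l \<in> A i" for i l using in_A that .
  have ip: "integrable M (\<lambda>\<omega>. \<bar>X i \<omega>\<bar> * \<bar>X l \<omega>\<bar>)"
      "integrable M (\<lambda>\<omega>. \<bar>X i \<omega>\<bar> * \<bar>X l \<omega>\<bar> * (?L i l \<omega>)\<^sup>2)"
    if "i \<in> {1..n}" "l \<in> A i" for i l
    by (rule deg_integrable, (rule deg_intros that X_l[OF that])+, simp)+
  have iL: "integrable M (\<lambda>\<omega>. (lin c (zero_on B (cfg \<omega>)))\<^sup>2)" "integrable M (\<lambda>\<omega>. (lin c (cfg \<omega>))\<^sup>2)" for B
    by (rule deg_integrable, (rule deg_intros)+, simp)+
  have close: "(lin c (zero_on (A2 i l) v))\<^sup>2 \<le> 2 * (lin c v)\<^sup>2 + 2 * (pair_abs v i l)\<^sup>2"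
    "(lin c v)\<^sup>2 \<le> 2 * (lin c (zero_on (A2 i l) v))\<^sup>2 + 2 * (pair_abs v i l)\<^sup>2"
    if "i \<in> {1..n}" "l \<in> A i" for i l v
  proof -
    have d: "\<bar>lin c v - lin c (zero_on (A2 i l) v)\<bar> \<le> pair_abs v i l"
      unfolding pair_abs_def by (intro lin_zero_on_diff_le A2_sub that c)
    have sq: "p\<^sup>2 \<le> 2 * q\<^sup>2 + 2 * y\<^sup>2" if "\<bar>q - p\<bar> \<le> y" for p q y :: real
    proof -
      have "\<bar>p\<bar> \<le> \<bar>q\<bar> + y" using that by linarith
      then have "\<bar>p\<bar>\<^sup>2 \<le> (\<bar>q\<bar> + y)\<^sup>2" by (intro power_mono) auto
      also have "\<dots> \<le> 2 * q\<^sup>2 + 2 * y\<^sup>2" using sum_squares_bound[of "\<bar>q\<bar>" y] by (simp add: power2_sum)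
      finally show ?thesis by simp
    qed
    show "(lin c (zero_on (A2 i l) v))\<^sup>2 \<le> 2 * (lin c v)\<^sup>2 + 2 * (pair_abs v i l)\<^sup>2" by (rule sq[OF d])
    show "(lin c v)\<^sup>2 \<le> 2 * (lin c (zero_on (A2 i l) v))\<^sup>2 + 2 * (pair_abs v i l)\<^sup>2"
      by (rule sq) (use d in linarith)
  qed
  have EL: "expectation (\<lambda>\<omega>. (?L i l \<omega>)\<^sup>2) \<le> 4 * lam" if il: "i \<in> {1..n}" "l \<in> A i" for i l
  proof -
    have i2: "integrable M (\<lambda>\<omega>. (pair_abs (cfg \<omega>) i l)\<^sup>2)"
      by (rule deg_integrable, (rule deg_intros il)+, simp)
    have "expectation (\<lambda>\<omega>. (?L i l \<omega>)\<^sup>2) \<le> expectation (\<lambda>\<omega>. 2 * (lin c (cfg \<omega>))\<^sup>2 + 2 * (pair_abs (cfg \<omega>) i l)\<^sup>2)"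
      using i2 iL by (intro integral_mono close il) auto
    also have "\<dots> = 2 * expectation (\<lambda>\<omega>. (lin c (cfg \<omega>))\<^sup>2) + 2 * expectation (\<lambda>\<omega>. (pair_abs (cfg \<omega>) i l)\<^sup>2)"
      using i2 iL by simp
    also have "\<dots> \<le> 2 * lam + 2 * 1"
      using small_second(1)[OF A2_sub[OF il] card_A2[OF il]] expectation_lin_square[OF c]
      unfolding pair_abs_def by (intro add_mono mult_left_mono) auto
    finally show ?thesis using lam_ge_1 by linarith
  qed
  have pair: "expectation (\<lambda>\<omega>. \<bar>X i \<omega>\<bar> * \<bar>X l \<omega>\<bar> * (?L i l \<omega>)\<^sup>2) \<le> 4 * lam * expectation (\<lambda>\<omega>. \<bar>X i \<omega>\<bar> * \<bar>X l \<omega>\<bar>)"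
    if il: "i \<in> {1..n}" "l \<in> A i" for i l
  proof -
    have "expectation (\<lambda>\<omega>. \<bar>X i \<omega>\<bar> * \<bar>X l \<omega>\<bar> * (?L i l \<omega>)\<^sup>2)
      = expectation (\<lambda>\<omega>. \<bar>X i \<omega>\<bar> * \<bar>X l \<omega>\<bar>) * expectation (\<lambda>\<omega>. (?L i l \<omega>)\<^sup>2)"
      by (rule expectation_pair[OF il _ functional_comp1[OF functional_lin, of "\<lambda>x. x\<^sup>2"], of "\<lambda>s t. \<bar>s\<bar> * \<bar>t\<bar>"])
        (use ip[OF il] iL in auto)
    also have "\<dots> \<le> expectation (\<lambda>\<omega>. \<bar>X i \<omega>\<bar> * \<bar>X l \<omega>\<bar>) * (4 * lam)"
      by (intro mult_left_mono EL il Bochner_Integration.integral_nonneg) auto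
    finally show ?thesis by (simp add: mult.commute)
  qed
  have i4: "integrable M (\<lambda>\<omega>. fourth_sum (cfg \<omega>))" by (rule deg_integrable, (rule deg_intros)+, simp)
  have i5: "integrable M (\<lambda>\<omega>. \<Sum>i\<in>{1..n}. \<Sum>l\<in>A i. \<bar>X i \<omega>\<bar> * \<bar>X l \<omega>\<bar> * (?L i l \<omega>)\<^sup>2)"
    by (intro Bochner_Integration.integrable_sum ip)
  have "expectation (\<lambda>\<omega>. (\<Sum>i\<in>{1..n}. \<bar>X i \<omega>\<bar> * out_abs (cfg \<omega>) i) * (lin c (cfg \<omega>))\<^sup>2)
     \<le> expectation (\<lambda>\<omega>. 2 * (\<Sum>i\<in>{1..n}. \<Sum>l\<in>A i. \<bar>X i \<omega>\<bar> * \<bar>X l \<omega>\<bar> * (?L i l \<omega>)\<^sup>2) + 2 * (k * (k\<^sup>2 + t) * fourth_sum (cfg \<omega>)))"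
  proof (rule integral_mono)
    show "integrable M (\<lambda>\<omega>. (\<Sum>i\<in>{1..n}. \<bar>X i \<omega>\<bar> * out_abs (cfg \<omega>) i) * (lin c (cfg \<omega>))\<^sup>2)"
      by (rule deg_integrable, (rule deg_intros | assumption)+, simp)
    show "integrable M (\<lambda>\<omega>. 2 * (\<Sum>i\<in>{1..n}. \<Sum>l\<in>A i. \<bar>X i \<omega>\<bar> * \<bar>X l \<omega>\<bar> * (?L i l \<omega>)\<^sup>2) + 2 * (k * (k\<^sup>2 + t) * fourth_sum (cfg \<omega>)))"
      by (intro Bochner_Integration.integrable_add integrable_mult_right i4 i5)
    fix \<omega>
    have "(\<Sum>i\<in>{1..n}. \<bar>X i \<omega>\<bar> * out_abs (cfg \<omega>) i) * (lin c (cfg \<omega>))\<^sup>2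
       = (\<Sum>i\<in>{1..n}. \<Sum>l\<in>A i. \<bar>X i \<omega>\<bar> * \<bar>X l \<omega>\<bar> * (lin c (cfg \<omega>))\<^sup>2)"
      by (simp add: out_abs_def sum_distrib_left sum_distrib_right mult.assoc)
    also have "\<dots> \<le> (\<Sum>i\<in>{1..n}. \<Sum>l\<in>A i. \<bar>X i \<omega>\<bar> * \<bar>X l \<omega>\<bar> * (2 * (?L i l \<omega>)\<^sup>2 + 2 * (pair_abs (cfg \<omega>) i l)\<^sup>2))"
      by (intro sum_mono mult_left_mono close) auto
    also have "\<dots> = 2 * (\<Sum>i\<in>{1..n}. \<Sum>l\<in>A i. \<bar>X i \<omega>\<bar> * \<bar>X l \<omega>\<bar> * (?L i l \<omega>)\<^sup>2)
       + 2 * (\<Sum>i\<in>{1..n}. \<Sum>l\<in>A i. \<bar>X i \<omega>\<bar> * \<bar>X l \<omega>\<bar> * (pair_abs (cfg \<omega>) i l)\<^sup>2)"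
      by (simp add: sum_distrib_left sum.distrib[symmetric] algebra_simps)
    also have "\<dots> \<le> 2 * (\<Sum>i\<in>{1..n}. \<Sum>l\<in>A i. \<bar>X i \<omega>\<bar> * \<bar>X l \<omega>\<bar> * (?L i l \<omega>)\<^sup>2) + 2 * (k * (k\<^sup>2 + t) * fourth_sum (cfg \<omega>))"
      by (intro add_left_mono mult_left_mono sum_pair_abs_square) auto
    finally show "(\<Sum>i\<in>{1..n}. \<bar>X i \<omega>\<bar> * out_abs (cfg \<omega>) i) * (lin c (cfg \<omega>))\<^sup>2
       \<le> 2 * (\<Sum>i\<in>{1..n}. \<Sum>l\<in>A i. \<bar>X i \<omega>\<bar> * \<bar>X l \<omega>\<bar> * (?L i l \<omega>)\<^sup>2) + 2 * (k * (k\<^sup>2 + t) * fourth_sum (cfg \<omega>))" .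
  qed
  also have "\<dots> = 2 * (\<Sum>i\<in>{1..n}. \<Sum>l\<in>A i. expectation (\<lambda>\<omega>. \<bar>X i \<omega>\<bar> * \<bar>X l \<omega>\<bar> * (?L i l \<omega>)\<^sup>2))
      + 2 * (k * (k\<^sup>2 + t) * expectation (\<lambda>\<omega>. fourth_sum (cfg \<omega>)))"
    using i4 i5 ip(2) by (simp add: Bochner_Integration.integral_sum)
  also have "\<dots> \<le> 2 * (\<Sum>i\<in>{1..n}. \<Sum>l\<in>A i. 4 * lam * expectation (\<lambda>\<omega>. \<bar>X i \<omega>\<bar> * \<bar>X l \<omega>\<bar>)) + 2 * b\<^sup>2"
    by (intro add_mono mult_left_mono sum_mono pair fourth_le) auto
  also have "(\<Sum>i\<in>{1..n}. \<Sum>l\<in>A i. 4 * lam * expectation (\<lambda>\<omega>. \<bar>X i \<omega>\<bar> * \<bar>X l \<omega>\<bar>))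
      = 4 * lam * expectation (\<lambda>\<omega>. \<Sum>i\<in>{1..n}. \<bar>X i \<omega>\<bar> * out_abs (cfg \<omega>) i)"
    unfolding out_abs_def using ip(1)
    by (simp add: Bochner_Integration.integral_sum sum_distrib_left)
  also have "2 * (4 * lam * expectation (\<lambda>\<omega>. \<Sum>i\<in>{1..n}. \<bar>X i \<omega>\<bar> * out_abs (cfg \<omega>) i)) + 2 * b\<^sup>2
      \<le> 2 * (4 * lam * lam) + 2 * lam\<^sup>2"
  proof -
    have "1 \<le> lam\<^sup>2" using lam_ge_1 by (rule one_le_power)
    then have "b\<^sup>2 \<le> lam\<^sup>2" using b_le_1(3) by linarith
    then show ?thesis using expectation_abs_out_le lam_ge_1 by (intro add_mono mult_left_mono) auto
  qed
  finally show ?thesis by (simp add: power2_eq_square)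
qed

end

section \<open>A law of large numbers for pair sums\<close>

context normalized_field
begin

definition pair_sum :: "(real \<Rightarrow> real \<Rightarrow> real) \<Rightarrow> 'a \<Rightarrow> real" where
  "pair_sum h \<omega> = (\<Sum>i\<in>{1..n}. \<Sum>l\<in>A i. h (X i \<omega>) (X l \<omega>))"

definition pairs :: "(nat \<times> nat) set" where "pairs = (SIGMA i:{1..n}. A i)"

definition linked :: "nat \<times> nat \<Rightarrow> nat \<times> nat \<Rightarrow> bool" where
  "linked p q \<longleftrightarrow> fst q \<in> A2 (fst p) (snd p) \<or> snd q \<in> A2 (fst p) (snd p)"

lemma finite_pairs [simp]: "finite pairs" unfolding pairs_def by (intro finite_SigmaI) auto

lemma pairsD: "p \<in> pairs \<Longrightarrow> fst p \<in> {1..n}" "p \<in> pairs \<Longrightarrow> snd p \<in> A (fst p)" "p \<in> pairs \<Longrightarrow> snd p \<in> {1..n}"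
  unfolding pairs_def using in_A[of "fst p" "snd p"] by (auto simp del: One_nat_def)

lemma sum_pairs: "(\<Sum>p\<in>pairs. f (fst p) (snd p)) = (\<Sum>i\<in>{1..n}. \<Sum>l\<in>A i. f i l)"
  unfolding pairs_def by (subst sum.Sigma) (auto simp: case_prod_beta)

lemma sum_linked_le:
  "(\<Sum>p\<in>pairs. \<Sum>q\<in>pairs. if linked p q then \<bar>v (fst p)\<bar> * \<bar>v (snd p)\<bar> * (\<bar>v (fst q)\<bar> * \<bar>v (snd q)\<bar>) else 0)
    \<le> 2 * (k * (k\<^sup>2 + t) * fourth_sum v)"
proof -
  have "(\<Sum>q\<in>pairs. if linked p q then \<bar>v (fst p)\<bar> * \<bar>v (snd p)\<bar> * (\<bar>v (fst q)\<bar> * \<bar>v (snd q)\<bar>) else 0)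
     \<le> (\<Sum>m\<in>A2 (fst p) (snd p). \<bar>v (fst p)\<bar> * \<bar>v (snd p)\<bar> * (\<bar>v m\<bar> * (out_abs v m + in_abs v m)))"
    if p: "p \<in> pairs" for p
  proof -
    let ?B = "A2 (fst p) (snd p)" and ?c = "\<bar>v (fst p)\<bar> * \<bar>v (snd p)\<bar>"
    have "(\<Sum>q\<in>pairs. if linked p q then ?c * (\<bar>v (fst q)\<bar> * \<bar>v (snd q)\<bar>) else 0)
       \<le> (\<Sum>q\<in>pairs. ?c * ((if fst q \<in> ?B then \<bar>v (fst q)\<bar> * \<bar>v (snd q)\<bar> else 0) + (if snd q \<in> ?B then \<bar>v (fst q)\<bar> * \<bar>v (snd q)\<bar> else 0)))"
    proof (rule sum_mono)
      fix q
      have "(if linked p q then \<bar>v (fst q)\<bar> * \<bar>v (snd q)\<bar> else 0) \<le>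
        (if fst q \<in> ?B then \<bar>v (fst q)\<bar> * \<bar>v (snd q)\<bar> else 0) + (if snd q \<in> ?B then \<bar>v (fst q)\<bar> * \<bar>v (snd q)\<bar> else 0)"
        unfolding linked_def by auto
      then have "?c * (if linked p q then \<bar>v (fst q)\<bar> * \<bar>v (snd q)\<bar> else 0) \<le>
        ?c * ((if fst q \<in> ?B then \<bar>v (fst q)\<bar> * \<bar>v (snd q)\<bar> else 0) + (if snd q \<in> ?B then \<bar>v (fst q)\<bar> * \<bar>v (snd q)\<bar> else 0))"
        by (intro mult_left_mono) auto
      then show "(if linked p q then ?c * (\<bar>v (fst q)\<bar> * \<bar>v (snd q)\<bar>) else 0) \<le>
        ?c * ((if fst q \<in> ?B then \<bar>v (fst q)\<bar> * \<bar>v (snd q)\<bar> else 0) + (if snd q \<in> ?B then \<bar>v (fst q)\<bar> * \<bar>v (snd q)\<bar> else 0))"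
        by (simp split: if_splits)
    qed
    also have "\<dots> = ?c * (\<Sum>q\<in>pairs. (if fst q \<in> ?B then \<bar>v (fst q)\<bar> * \<bar>v (snd q)\<bar> else 0) + (if snd q \<in> ?B then \<bar>v (fst q)\<bar> * \<bar>v (snd q)\<bar> else 0))"
      by (rule sum_distrib_left[symmetric])
    also have "(\<Sum>q\<in>pairs. (if fst q \<in> ?B then \<bar>v (fst q)\<bar> * \<bar>v (snd q)\<bar> else 0) + (if snd q \<in> ?B then \<bar>v (fst q)\<bar> * \<bar>v (snd q)\<bar> else 0))
       = (\<Sum>l\<in>?B. \<bar>v l\<bar> * (out_abs v l + in_abs v l))"
      unfolding sum_pairs[of "\<lambda>j l. (if j \<in> ?B then \<bar>v j\<bar> * \<bar>v l\<bar> else 0) + (if l \<in> ?B then \<bar>v j\<bar> * \<bar>v l\<bar> else 0)"]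
      by (rule sum_touching[OF A2_sub[OF pairsD(1,2)[OF p]]])
    finally show ?thesis by (simp only: sum_distrib_left)
  qed
  then have "(\<Sum>p\<in>pairs. \<Sum>q\<in>pairs. if linked p q then \<bar>v (fst p)\<bar> * \<bar>v (snd p)\<bar> * (\<bar>v (fst q)\<bar> * \<bar>v (snd q)\<bar>) else 0)
     \<le> (\<Sum>p\<in>pairs. \<Sum>m\<in>A2 (fst p) (snd p). \<bar>v (fst p)\<bar> * \<bar>v (snd p)\<bar> * (\<bar>v m\<bar> * (out_abs v m + in_abs v m)))"
    by (intro sum_mono)
  also have "\<dots> \<le> 2 * (k * (k\<^sup>2 + t) * fourth_sum v)"
    unfolding sum_pairs[of "\<lambda>i l. \<Sum>m\<in>A2 i l. \<bar>v i\<bar> * \<bar>v l\<bar> * (\<bar>v m\<bar> * (out_abs v m + in_abs v m))"]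
    by (rule sum_dependent_quadruples)
  finally show ?thesis .
qed

lemma functional_coordinate: "i \<in> {1..n} \<Longrightarrow> functional (\<lambda>v. v i)"
  unfolding functional_def by (intro conjI allI impI measurable_component_singleton) (assumption | erule bspec)+

context
  fixes h :: "real \<Rightarrow> real \<Rightarrow> real"
  assumes h_meas: "(\<lambda>(s, u). h s u) \<in> borel_measurable (borel \<Otimes>\<^sub>M borel)"
    and h_nonneg: "\<And>s u. 0 \<le> h s u" and h_le: "\<And>s u. h s u \<le> \<bar>s\<bar> * \<bar>u\<bar>"
begin

lemma deg_pair_fun:
  assumes "i \<in> {1..n}" "l \<in> {1..n}" shows "deg 2 (\<lambda>\<omega>. h (X i \<omega>) (X l \<omega>))"
proof -
  note [measurable] = h_meas
  have 1: "(\<lambda>\<omega>. (\<lambda>(s, u). h s u) (X i \<omega>, X l \<omega>)) \<in> borel_measurable M" using assms by measurable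
  have "deg (1 + 1) (\<lambda>\<omega>. \<bar>X i \<omega>\<bar> * \<bar>X l \<omega>\<bar>)" using assms by (intro deg_mult deg_abs_X)
  then obtain c where "0 \<le> c" "\<And>\<omega>. \<bar>\<bar>X i \<omega>\<bar> * \<bar>X l \<omega>\<bar>\<bar> \<le> c * mass \<omega> ^ (1 + 1)" unfolding deg_def by blast
  moreover have "\<bar>h (X i \<omega>) (X l \<omega>)\<bar> \<le> \<bar>\<bar>X i \<omega>\<bar> * \<bar>X l \<omega>\<bar>\<bar>" for \<omega>
    using h_nonneg[of "X i \<omega>" "X l \<omega>"] h_le[of "X i \<omega>" "X l \<omega>"] by simp
  ultimately show ?thesis using 1 unfolding deg_def one_add_one
    by (intro conjI exI[of _ c]) (auto intro: order_trans)
qed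

lemma deg_pair_sum: "deg 2 (pair_sum h)"
  unfolding pair_sum_def[abs_def] by (intro deg_sum deg_pair_fun) (assumption | rule in_A)+

text \<open>Only linked pairs contribute to the variance. As \<open>h\<close> is nonnegative, the subtracted products of expectations may be
  dropped for these.\<close>

lemma pair_sum_variance:
  "expectation (\<lambda>\<omega>. (pair_sum h \<omega> - expectation (pair_sum h))\<^sup>2)
    \<le> (\<Sum>p\<in>pairs. \<Sum>q\<in>pairs. if linked p q then expectation (\<lambda>\<omega>. h (X (fst p) \<omega>) (X (snd p) \<omega>) * h (X (fst q) \<omega>) (X (snd q) \<omega>)) else 0)"
proof -
  let ?H = "\<lambda>p \<omega>. h (X (fst p) \<omega>) (X (snd p) \<omega>)"
  have dH: "deg 2 (?H p)" if "p \<in> pairs" for p using pairsD[OF that] by (intro deg_pair_fun)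
  have iH: "integrable M (?H p)" if "p \<in> pairs" for p by (rule deg_integrable[OF dH[OF that]]) simp
  have iHH: "integrable M (\<lambda>\<omega>. ?H p \<omega> * ?H q \<omega>)" if "p \<in> pairs" "q \<in> pairs" for p q
    by (rule deg_integrable[OF deg_mult[OF dH[OF that(1)] dH[OF that(2)]]]) simp
  have ps: "pair_sum h \<omega> = (\<Sum>p\<in>pairs. ?H p \<omega>)" for \<omega>
    unfolding pair_sum_def sum_pairs[of "\<lambda>i l. h (X i \<omega>) (X l \<omega>)"] ..
  have i1: "integrable M (pair_sum h)" by (rule deg_integrable[OF deg_pair_sum]) simp
  have i2: "integrable M (\<lambda>\<omega>. (pair_sum h \<omega>)\<^sup>2)" by (rule deg_integrable[OF deg_power[OF deg_pair_sum]]) simp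
  have "expectation (\<lambda>\<omega>. (pair_sum h \<omega> - expectation (pair_sum h))\<^sup>2)
     = expectation (\<lambda>\<omega>. (pair_sum h \<omega>)\<^sup>2) - (expectation (pair_sum h))\<^sup>2"
    by (rule variance_eq[OF i1 i2])
  also have "expectation (\<lambda>\<omega>. (pair_sum h \<omega>)\<^sup>2) = (\<Sum>p\<in>pairs. \<Sum>q\<in>pairs. expectation (\<lambda>\<omega>. ?H p \<omega> * ?H q \<omega>))"
    unfolding ps power2_eq_square sum_product using iHH
    by (subst Bochner_Integration.integral_sum) (auto simp: Bochner_Integration.integral_sum)
  also have "(expectation (pair_sum h))\<^sup>2 = (\<Sum>p\<in>pairs. \<Sum>q\<in>pairs. expectation (?H p) * expectation (?H q))"
    unfolding ps[abs_def] using iH by (simp add: Bochner_Integration.integral_sum power2_eq_square sum_product)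
  also have "(\<Sum>p\<in>pairs. \<Sum>q\<in>pairs. expectation (\<lambda>\<omega>. ?H p \<omega> * ?H q \<omega>)) - (\<Sum>p\<in>pairs. \<Sum>q\<in>pairs. expectation (?H p) * expectation (?H q))
     = (\<Sum>p\<in>pairs. \<Sum>q\<in>pairs. expectation (\<lambda>\<omega>. ?H p \<omega> * ?H q \<omega>) - expectation (?H p) * expectation (?H q))"
    by (simp only: sum_subtractf)
  also have "\<dots> \<le> (\<Sum>p\<in>pairs. \<Sum>q\<in>pairs. if linked p q then expectation (\<lambda>\<omega>. ?H p \<omega> * ?H q \<omega>) else 0)"
  proof (intro sum_mono)
    fix p q assume p: "p \<in> pairs" and q: "q \<in> pairs"
    show "expectation (\<lambda>\<omega>. ?H p \<omega> * ?H q \<omega>) - expectation (?H p) * expectation (?H q)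
       \<le> (if linked p q then expectation (\<lambda>\<omega>. ?H p \<omega> * ?H q \<omega>) else 0)"
    proof (cases "linked p q")
      case True
      have "0 \<le> expectation (?H p) * expectation (?H q)"
        by (intro mult_nonneg_nonneg Bochner_Integration.integral_nonneg h_nonneg)
      then show ?thesis using True by simp
    next
      case False
      let ?B = "A2 (fst p) (snd p)"
      have same: "?H q \<omega> = h (zero_on ?B (cfg \<omega>) (fst q)) (zero_on ?B (cfg \<omega>) (snd q))" for \<omega>
        using False by (simp add: zero_on_def linked_def)
      have "expectation (\<lambda>\<omega>. ?H p \<omega> * h (zero_on ?B (cfg \<omega>) (fst q)) (zero_on ?B (cfg \<omega>) (snd q)))
         = expectation (?H p) * expectation (\<lambda>\<omega>. h (zero_on ?B (cfg \<omega>) (fst q)) (zero_on ?B (cfg \<omega>) (snd q)))"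
        by (rule expectation_pair[OF pairsD(1,2)[OF p] h_meas
              functional_comp[OF functional_coordinate[OF pairsD(1)[OF q]] functional_coordinate[OF pairsD(3)[OF q]] h_meas]
              iH[OF p] iH[OF q, unfolded same]])
      then show ?thesis using False unfolding same[symmetric] by simp
    qed
  qed
  finally show ?thesis .
qed

end

text \<open>The bound is uniform over families \<open>h m\<close> of functions that share the product \<open>\<bar>s\<bar> * \<bar>u\<bar>\<close> among them. Two families are
  used: the positive and negative part of \<open>s * u\<close>, and its dyadic pieces.\<close>

lemma pair_sum_family_variance:
  fixes h :: "'j \<Rightarrow> real \<Rightarrow> real \<Rightarrow> real"
  assumes fin: "finite J"
    and meas: "\<And>m. m \<in> J \<Longrightarrow> (\<lambda>(s, u). h m s u) \<in> borel_measurable (borel \<Otimes>\<^sub>M borel)"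
    and nonneg: "\<And>m s u. m \<in> J \<Longrightarrow> 0 \<le> h m s u" and le: "\<And>m s u. m \<in> J \<Longrightarrow> h m s u \<le> \<bar>s\<bar> * \<bar>u\<bar>"
    and prod: "\<And>s u s' u'. (\<Sum>m\<in>J. h m s u * h m s' u') \<le> \<bar>s\<bar> * \<bar>u\<bar> * (\<bar>s'\<bar> * \<bar>u'\<bar>)"
  shows "(\<Sum>m\<in>J. expectation (\<lambda>\<omega>. (pair_sum (h m) \<omega> - expectation (pair_sum (h m)))\<^sup>2)) \<le> 2 * b\<^sup>2"
proof -
  let ?H = "\<lambda>m p \<omega>. h m (X (fst p) \<omega>) (X (snd p) \<omega>)"
  let ?G = "\<lambda>p \<omega>. \<bar>X (fst p) \<omega>\<bar> * \<bar>X (snd p) \<omega>\<bar>"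
  have dH: "deg 2 (?H m p)" if "p \<in> pairs" "m \<in> J" for p m
    using pairsD[OF that(1)] by (intro deg_pair_fun meas nonneg le that(2))
  have iHH: "integrable M (\<lambda>\<omega>. ?H m p \<omega> * ?H m q \<omega>)" if "p \<in> pairs" "q \<in> pairs" "m \<in> J" for p q m
    by (rule deg_integrable[OF deg_mult[OF dH[OF that(1,3)] dH[OF that(2,3)]]]) simp
  have dG: "deg 2 (?G p)" if "p \<in> pairs" for p
    using deg_mult[OF deg_abs_X[OF pairsD(1)[OF that]] deg_abs_X[OF pairsD(3)[OF that]]] by (simp only: one_add_one)
  have iGG: "integrable M (\<lambda>\<omega>. ?G p \<omega> * ?G q \<omega>)" if "p \<in> pairs" "q \<in> pairs" for p q
    by (rule deg_integrable[OF deg_mult[OF dG[OF that(1)] dG[OF that(2)]]]) simp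
  have i4: "integrable M (\<lambda>\<omega>. fourth_sum (cfg \<omega>))" by (rule deg_integrable, (rule deg_intros)+, simp)
  have iif: "integrable M (\<lambda>\<omega>. if linked p q then ?G p \<omega> * ?G q \<omega> else 0)" if "p \<in> pairs" "q \<in> pairs" for p q
    using iGG[OF that] by (cases "linked p q") auto
  have "(\<Sum>m\<in>J. expectation (\<lambda>\<omega>. (pair_sum (h m) \<omega> - expectation (pair_sum (h m)))\<^sup>2))
     \<le> (\<Sum>m\<in>J. \<Sum>p\<in>pairs. \<Sum>q\<in>pairs. if linked p q then expectation (\<lambda>\<omega>. ?H m p \<omega> * ?H m q \<omega>) else 0)"
    by (intro sum_mono pair_sum_variance meas nonneg le)
  also have "\<dots> = (\<Sum>p\<in>pairs. \<Sum>m\<in>J. \<Sum>q\<in>pairs. if linked p q then expectation (\<lambda>\<omega>. ?H m p \<omega> * ?H m q \<omega>) else 0)"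
    by (rule sum.swap)
  also have "\<dots> = (\<Sum>p\<in>pairs. \<Sum>q\<in>pairs. \<Sum>m\<in>J. if linked p q then expectation (\<lambda>\<omega>. ?H m p \<omega> * ?H m q \<omega>) else 0)"
    by (intro sum.cong refl sum.swap)
  also have "\<dots> \<le> (\<Sum>p\<in>pairs. \<Sum>q\<in>pairs. expectation (\<lambda>\<omega>. if linked p q then ?G p \<omega> * ?G q \<omega> else 0))"
  proof (intro sum_mono)
    fix p q assume pq: "p \<in> pairs" "q \<in> pairs"
    show "(\<Sum>m\<in>J. if linked p q then expectation (\<lambda>\<omega>. ?H m p \<omega> * ?H m q \<omega>) else 0)
      \<le> expectation (\<lambda>\<omega>. if linked p q then ?G p \<omega> * ?G q \<omega> else 0)"
    proof (cases "linked p q")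
      case True
      have "(\<Sum>m\<in>J. expectation (\<lambda>\<omega>. ?H m p \<omega> * ?H m q \<omega>)) = expectation (\<lambda>\<omega>. \<Sum>m\<in>J. ?H m p \<omega> * ?H m q \<omega>)"
        by (rule Bochner_Integration.integral_sum[symmetric]) (rule iHH[OF pq])
      also have "\<dots> \<le> expectation (\<lambda>\<omega>. ?G p \<omega> * ?G q \<omega>)"
        using iHH[OF pq] iGG[OF pq] prod by (intro integral_mono Bochner_Integration.integrable_sum) auto
      finally show ?thesis using True by simp
    qed simp
  qed
  also have "\<dots> = expectation (\<lambda>\<omega>. \<Sum>p\<in>pairs. \<Sum>q\<in>pairs. if linked p q then ?G p \<omega> * ?G q \<omega> else 0)"
    using iif by (subst Bochner_Integration.integral_sum) (auto simp: Bochner_Integration.integral_sum)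
  also have "\<dots> \<le> expectation (\<lambda>\<omega>. 2 * (k * (k\<^sup>2 + t) * fourth_sum (cfg \<omega>)))"
  proof (rule integral_mono)
    show "integrable M (\<lambda>\<omega>. \<Sum>p\<in>pairs. \<Sum>q\<in>pairs. if linked p q then ?G p \<omega> * ?G q \<omega> else 0)"
      by (intro Bochner_Integration.integrable_sum iif)
    show "integrable M (\<lambda>\<omega>. 2 * (k * (k\<^sup>2 + t) * fourth_sum (cfg \<omega>)))"
      by (intro integrable_mult_right i4)
    show "(\<Sum>p\<in>pairs. \<Sum>q\<in>pairs. if linked p q then ?G p \<omega> * ?G q \<omega> else 0) \<le> 2 * (k * (k\<^sup>2 + t) * fourth_sum (cfg \<omega>))" for \<omega>
      by (rule sum_linked_le)
  qed
  also have "\<dots> = 2 * (k * (k\<^sup>2 + t) * expectation (\<lambda>\<omega>. fourth_sum (cfg \<omega>)))"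
    using i4 by simp
  also have "\<dots> \<le> 2 * b\<^sup>2" using fourth_le by simp
  finally show ?thesis .
qed

lemma abs_le_weighted_square: "\<bar>z\<bar> \<le> b / 2 + z\<^sup>2 / (2 * b)" for z :: real
proof -
  have "2 * (1 * \<bar>z\<bar>) \<le> b * 1\<^sup>2 + \<bar>z\<bar>\<^sup>2 / b" by (rule weighted_square[OF b_pos])
  then show ?thesis by (simp add: field_simps)
qed

section \<open>The normaliser is close to 1\<close>

lemma quad_close_to_1: "expectation (\<lambda>\<omega>. \<bar>quad (cfg \<omega>) - 1\<bar>) \<le> 2 * b"
proof -
  define h where "h m s u = (if m then max 0 (s * u) else max 0 (- (s * u)))" for m :: bool and s u :: real
  have meas: "(\<lambda>(s, u). h m s u) \<in> borel_measurable (borel \<Otimes>\<^sub>M borel)" for m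
    unfolding h_def by measurable
  have nonneg: "0 \<le> h m s u" for m s u by (simp add: h_def)
  have le: "h m s u \<le> \<bar>s\<bar> * \<bar>u\<bar>" for m s u by (simp add: h_def abs_mult[symmetric] abs_ge_minus_self abs_ge_self)
  have pos: "h True s u + h False s u = \<bar>s\<bar> * \<bar>u\<bar>" for s u by (simp add: h_def abs_mult[symmetric])
  have prod: "(\<Sum>m\<in>UNIV. h m s u * h m s' u') \<le> \<bar>s\<bar> * \<bar>u\<bar> * (\<bar>s'\<bar> * \<bar>u'\<bar>)" for s u s' u'
  proof -
    have "0 \<le> h True s u * h False s' u'" "0 \<le> h False s u * h True s' u'"
      using nonneg by (auto intro: mult_nonneg_nonneg)
    then show ?thesis unfolding pos[symmetric] UNIV_bool by (simp add: algebra_simps)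
  qed
  let ?D = "\<lambda>m \<omega>. pair_sum (h m) \<omega> - expectation (pair_sum (h m))"
  have d: "deg 2 (pair_sum (h m))" for m by (rule deg_pair_sum[OF meas nonneg le])
  have i1: "integrable M (pair_sum (h m))" for m by (rule deg_integrable[OF d]) simp
  have iD: "integrable M (\<lambda>\<omega>. \<bar>?D m \<omega>\<bar>)" for m using i1 by simp
  have iD2: "integrable M (\<lambda>\<omega>. (?D m \<omega>)\<^sup>2)" for m
    by (rule deg_integrable[OF deg_power[OF deg_diff[OF d deg_const]]]) simp
  have var: "(\<Sum>m\<in>UNIV. expectation (\<lambda>\<omega>. (?D m \<omega>)\<^sup>2)) \<le> 2 * b\<^sup>2"
    by (rule pair_sum_family_variance) (use meas nonneg le prod in auto)
  have quad: "quad (cfg \<omega>) = pair_sum (h True) \<omega> - pair_sum (h False) \<omega>" for \<omega>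
    unfolding quad_def pair_sum_def sum_subtractf[symmetric]
    by (intro sum.cong refl) (simp add: h_def max_def)
  have E1: "expectation (pair_sum (h True)) - expectation (pair_sum (h False)) = 1"
    using quad_expectation i1 by (simp add: quad[abs_def])
  have "expectation (\<lambda>\<omega>. \<bar>quad (cfg \<omega>) - 1\<bar>) \<le> expectation (\<lambda>\<omega>. \<bar>?D True \<omega>\<bar> + \<bar>?D False \<omega>\<bar>)"
  proof (rule integral_mono)
    show "integrable M (\<lambda>\<omega>. \<bar>quad (cfg \<omega>) - 1\<bar>)" by (rule deg_integrable, (rule deg_intros)+, simp)
    show "integrable M (\<lambda>\<omega>. \<bar>?D True \<omega>\<bar> + \<bar>?D False \<omega>\<bar>)" using iD by simp
    fix \<omega> show "\<bar>quad (cfg \<omega>) - 1\<bar> \<le> \<bar>?D True \<omega>\<bar> + \<bar>?D False \<omega>\<bar>"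
      unfolding quad using E1 by linarith
  qed
  also have "\<dots> = expectation (\<lambda>\<omega>. \<bar>?D True \<omega>\<bar>) + expectation (\<lambda>\<omega>. \<bar>?D False \<omega>\<bar>)"
    using iD by simp
  also have "\<dots> \<le> (b / 2 + expectation (\<lambda>\<omega>. (?D True \<omega>)\<^sup>2) / (2 * b)) + (b / 2 + expectation (\<lambda>\<omega>. (?D False \<omega>)\<^sup>2) / (2 * b))"
  proof -
    have "expectation (\<lambda>\<omega>. \<bar>?D m \<omega>\<bar>) \<le> b / 2 + expectation (\<lambda>\<omega>. (?D m \<omega>)\<^sup>2) / (2 * b)" for m
    proof -
      have "expectation (\<lambda>\<omega>. \<bar>?D m \<omega>\<bar>) \<le> expectation (\<lambda>\<omega>. b / 2 + (?D m \<omega>)\<^sup>2 / (2 * b))"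
        using iD iD2 by (intro integral_mono abs_le_weighted_square) auto
      also have "\<dots> = b / 2 + expectation (\<lambda>\<omega>. (?D m \<omega>)\<^sup>2) / (2 * b)"
        using iD2[of m] by (simp add: prob_space)
      finally show ?thesis .
    qed
    then show ?thesis by (intro add_mono)
  qed
  also have "\<dots> = b + (\<Sum>m\<in>UNIV. expectation (\<lambda>\<omega>. (?D m \<omega>)\<^sup>2)) / (2 * b)"
    by (simp add: UNIV_bool add_divide_distrib)
  also have "\<dots> \<le> b + 2 * b\<^sup>2 / (2 * b)" using var b_pos by (intro add_left_mono divide_right_mono) auto
  also have "\<dots> = 2 * b" using b_pos by (simp add: power2_eq_square)
  finally show ?thesis .
qed

text \<open>The power mean inequality between second and third moments. It shows that the means in the definition of the
  normaliser are negligible, as they carry a factor \<open>k / n\<close>. The number \<open>s\<close> is where \<open>y\<^sup>2 \<le> (2 * y\<^sup>3 + 1) / 3\<close>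
  is applied, with \<open>y = s * \<bar>X i\<bar>\<close>; the choice makes the cubic part at most \<open>2 / 3 * lam\<close>, which is
  absorbed into the left-hand side.\<close>

lemma lam_cube_le: "k / real n * lam ^ 3 \<le> b\<^sup>2"
proof -
  define s where "s = k * lam / b"
  have s: "0 < s" using lam_ge_1 b_pos by (simp add: s_def)
  have n0: "0 < real n" using n_ge_1 by simp
  have ic: "integrable M (\<lambda>\<omega>. cube_sum (cfg \<omega>))" by (rule deg_integrable, (rule deg_intros)+, simp)
  have is2: "integrable M (\<lambda>\<omega>. k * (\<Sum>i\<in>{1..n}. (X i \<omega>)\<^sup>2))"
    by (rule deg_integrable, (rule deg_intros | assumption)+, simp)
  have "lam \<le> expectation (\<lambda>\<omega>. k * (2 * s * cube_sum (cfg \<omega>) + real n / s\<^sup>2) / 3)"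
    unfolding expectation_sum_square[symmetric]
  proof (rule integral_mono[OF is2])
    show "integrable M (\<lambda>\<omega>. k * (2 * s * cube_sum (cfg \<omega>) + real n / s\<^sup>2) / 3)" using ic by simp
    fix \<omega>
    have "(X i \<omega>)\<^sup>2 \<le> (2 * s * \<bar>X i \<omega>\<bar> ^ 3 + 1 / s\<^sup>2) / 3" for i
    proof -
      define y where "y = s * \<bar>X i \<omega>\<bar>"
      have "3 * y\<^sup>2 \<le> 2 * y ^ 3 + 1"
        using young_three[of y y 1] s by (simp add: y_def power2_eq_square)
      then have "3 * y\<^sup>2 / s\<^sup>2 \<le> (2 * y ^ 3 + 1) / s\<^sup>2" by (intro divide_right_mono) auto
      moreover have "3 * y\<^sup>2 / s\<^sup>2 = 3 * (X i \<omega>)\<^sup>2" using s by (simp add: y_def power_mult_distrib)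
      moreover have "(2 * y ^ 3 + 1) / s\<^sup>2 = 2 * s * \<bar>X i \<omega>\<bar> ^ 3 + 1 / s\<^sup>2"
        using s by (simp add: y_def add_divide_distrib power_mult_distrib power2_eq_square power3_eq_cube)
      ultimately show ?thesis by simp
    qed
    then have "(\<Sum>i\<in>{1..n}. (X i \<omega>)\<^sup>2) \<le> (\<Sum>i\<in>{1..n}. (2 * s * \<bar>X i \<omega>\<bar> ^ 3 + 1 / s\<^sup>2) / 3)" by (intro sum_mono)
    also have "\<dots> = (2 * s * cube_sum (cfg \<omega>) + real n / s\<^sup>2) / 3"
      by (simp add: cube_sum_def sum_divide_distrib[symmetric] sum.distrib sum_distrib_left)
    finally have "k * (\<Sum>i\<in>{1..n}. (X i \<omega>)\<^sup>2) \<le> k * ((2 * s * cube_sum (cfg \<omega>) + real n / s\<^sup>2) / 3)"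
      by (intro mult_left_mono) auto
    then show "k * (\<Sum>i\<in>{1..n}. (X i \<omega>)\<^sup>2) \<le> k * (2 * s * cube_sum (cfg \<omega>) + real n / s\<^sup>2) / 3" by simp
  qed
  also have "\<dots> = (2 * (s / k) * (k\<^sup>2 * expectation (\<lambda>\<omega>. cube_sum (cfg \<omega>))) + k * (real n / s\<^sup>2)) / 3"
    using ic by (simp add: prob_space algebra_simps power2_eq_square)
  also have "\<dots> \<le> (2 * (s / k) * b + k * (real n / s\<^sup>2)) / 3"
    using cube_le s by (intro divide_right_mono add_right_mono mult_left_mono) auto
  also have "2 * (s / k) * b = 2 * lam" using b_pos by (simp add: s_def)
  finally have "lam \<le> k * (real n / s\<^sup>2)" by simp
  then have "lam * s\<^sup>2 \<le> k * real n" using s by (simp add: field_simps)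
  then have "k * (k * lam ^ 3) \<le> k * (real n * b\<^sup>2)"
    using b_pos by (simp add: s_def power_divide power_mult_distrib field_simps power2_eq_square power3_eq_cube)
  then have "k * lam ^ 3 \<le> real n * b\<^sup>2" by simp
  then show ?thesis using n0 by (simp add: field_simps)
qed

lemma lam_square_le: "k / real n * lam\<^sup>2 \<le> b"
proof -
  have "k / real n * lam\<^sup>2 \<le> k / real n * lam ^ 3"
    using lam_ge_1 by (intro mult_left_mono power_increasing) auto
  then show ?thesis using lam_cube_le b_le_1(2) by linarith
qed

lemma in_weighted_second_moment: "expectation (\<lambda>\<omega>. (in_weighted (cfg \<omega>))\<^sup>2) \<le> lam"
  unfolding in_weighted_def by (rule expectation_lin_square[OF in_weight_bounds])

lemma mean_term_small: "expectation (\<lambda>\<omega>. \<bar>mean_term (cfg \<omega>)\<bar>) \<le> b"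
proof -
  have i: "integrable M (\<lambda>\<omega>. (total (cfg \<omega>))\<^sup>2)" "integrable M (\<lambda>\<omega>. (in_weighted (cfg \<omega>))\<^sup>2)"
    by (rule deg_integrable, (rule deg_intros)+, simp)+
  have "expectation (\<lambda>\<omega>. \<bar>mean_term (cfg \<omega>)\<bar>)
     \<le> expectation (\<lambda>\<omega>. k / real n * (((total (cfg \<omega>))\<^sup>2 + (in_weighted (cfg \<omega>))\<^sup>2) / 2))"
  proof (rule integral_mono)
    show "integrable M (\<lambda>\<omega>. \<bar>mean_term (cfg \<omega>)\<bar>)" by (rule deg_integrable, (rule deg_intros)+, simp)
    show "integrable M (\<lambda>\<omega>. k / real n * (((total (cfg \<omega>))\<^sup>2 + (in_weighted (cfg \<omega>))\<^sup>2) / 2))"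
      using i by simp
    fix \<omega>
    have "\<bar>mean_term (cfg \<omega>)\<bar> = k / real n * (\<bar>total (cfg \<omega>)\<bar> * \<bar>in_weighted (cfg \<omega>)\<bar>)"
      by (simp add: mean_term_def abs_mult)
    also have "\<dots> \<le> k / real n * (((total (cfg \<omega>))\<^sup>2 + (in_weighted (cfg \<omega>))\<^sup>2) / 2)"
      using sum_squares_bound[of "\<bar>total (cfg \<omega>)\<bar>" "\<bar>in_weighted (cfg \<omega>)\<bar>"] by (intro mult_left_mono) auto
    finally show "\<bar>mean_term (cfg \<omega>)\<bar> \<le> k / real n * (((total (cfg \<omega>))\<^sup>2 + (in_weighted (cfg \<omega>))\<^sup>2) / 2)" .
  qed
  also have "\<dots> = k / real n * ((1 + expectation (\<lambda>\<omega>. (in_weighted (cfg \<omega>))\<^sup>2)) / 2)"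
    using i total_second_moment by simp
  also have "\<dots> \<le> k / real n * lam\<^sup>2"
  proof (intro mult_left_mono)
    have "lam \<le> lam\<^sup>2" using lam_ge_1 power_increasing[of 1 2 lam] by simp
    moreover have "(1 + e) / 2 \<le> lam" if "e \<le> lam" for e using that lam_ge_1 by simp
    from this[OF in_weighted_second_moment]
    have "(1 + expectation (\<lambda>\<omega>. (in_weighted (cfg \<omega>))\<^sup>2)) / 2 \<le> lam" .
    ultimately show "(1 + expectation (\<lambda>\<omega>. (in_weighted (cfg \<omega>))\<^sup>2)) / 2 \<le> lam\<^sup>2" by (rule order_trans[rotated])
  qed simp
  also have "\<dots> \<le> b" by (rule lam_square_le)
  finally show ?thesis .
qed

lemma norm_sq_close_to_1: "expectation (\<lambda>\<omega>. \<bar>norm_sq (cfg \<omega>) - 1\<bar>) \<le> 3 * b"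
proof -
  have i: "integrable M (\<lambda>\<omega>. \<bar>quad (cfg \<omega>) - 1\<bar>)" "integrable M (\<lambda>\<omega>. \<bar>mean_term (cfg \<omega>)\<bar>)"
    "integrable M (\<lambda>\<omega>. \<bar>norm_sq (cfg \<omega>) - 1\<bar>)"
    by (rule deg_integrable, (rule deg_intros)+, simp)+
  have "expectation (\<lambda>\<omega>. \<bar>norm_sq (cfg \<omega>) - 1\<bar>) \<le> expectation (\<lambda>\<omega>. \<bar>quad (cfg \<omega>) - 1\<bar> + \<bar>mean_term (cfg \<omega>)\<bar>)"
    using i by (intro integral_mono) (auto simp: norm_sq_def)
  also have "\<dots> \<le> 3 * b" using i quad_close_to_1 mean_term_small by simp
  finally show ?thesis .
qed

lemma normalised_quad_close_to_1:
  "expectation (\<lambda>\<omega>. \<bar>quad (cfg \<omega>) * (inv_root (norm_sq (cfg \<omega>)))\<^sup>2 - 1\<bar>) \<le> 16 * b"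
proof -
  have i: "integrable M (\<lambda>\<omega>. \<bar>norm_sq (cfg \<omega>) - 1\<bar>)" "integrable M (\<lambda>\<omega>. \<bar>mean_term (cfg \<omega>)\<bar>)"
    by (rule deg_integrable, (rule deg_intros)+, simp)+
  have [measurable]: "(\<lambda>\<omega>. norm_sq (cfg \<omega>)) \<in> borel_measurable M" by (rule deg_measurable[OF deg_norm_sq])
  have r: "deg 0 (\<lambda>\<omega>. (inv_root (norm_sq (cfg \<omega>)))\<^sup>2)"
    by (rule deg_bounded[of _ 4]) (auto intro: inv_root_square_le)
  have "expectation (\<lambda>\<omega>. \<bar>quad (cfg \<omega>) * (inv_root (norm_sq (cfg \<omega>)))\<^sup>2 - 1\<bar>)
     \<le> expectation (\<lambda>\<omega>. 4 * \<bar>norm_sq (cfg \<omega>) - 1\<bar> + 4 * \<bar>mean_term (cfg \<omega>)\<bar>)"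
  proof (rule integral_mono)
    show "integrable M (\<lambda>\<omega>. \<bar>quad (cfg \<omega>) * (inv_root (norm_sq (cfg \<omega>)))\<^sup>2 - 1\<bar>)"
      by (rule deg_integrable, (rule r deg_intros)+, simp)
    show "integrable M (\<lambda>\<omega>. 4 * \<bar>norm_sq (cfg \<omega>) - 1\<bar> + 4 * \<bar>mean_term (cfg \<omega>)\<bar>)" using i by simp
    fix \<omega>
    let ?r = "(inv_root (norm_sq (cfg \<omega>)))\<^sup>2"
    have "quad (cfg \<omega>) * ?r - 1 = (norm_sq (cfg \<omega>) * ?r - 1) + mean_term (cfg \<omega>) * ?r"
      by (simp add: norm_sq_def algebra_simps)
    moreover have "\<bar>mean_term (cfg \<omega>) * ?r\<bar> \<le> \<bar>mean_term (cfg \<omega>)\<bar> * 4"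
      unfolding abs_mult using inv_root_square_le by (intro mult_left_mono) auto
    ultimately show "\<bar>quad (cfg \<omega>) * ?r - 1\<bar> \<le> 4 * \<bar>norm_sq (cfg \<omega>) - 1\<bar> + 4 * \<bar>mean_term (cfg \<omega>)\<bar>"
      using inv_root_normalises[of "norm_sq (cfg \<omega>)"] by linarith
  qed
  also have "\<dots> \<le> 16 * b" using i norm_sq_close_to_1 mean_term_small by simp
  finally show ?thesis .
qed

lemma leave_out_error:
  "expectation (\<lambda>\<omega>. \<Sum>i\<in>{1..n}. \<bar>X i \<omega>\<bar> * \<bar>norm_sq (cfg \<omega>) - norm_sq (zero_on (A i) (cfg \<omega>))\<bar> * (1 + \<bar>total (zero_on (A i) (cfg \<omega>))\<bar>))
    \<le> 66 * b"
proof -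
  let ?P = "\<lambda>\<omega>. \<Sum>i\<in>{1..n}. \<bar>X i \<omega>\<bar> * out_abs (cfg \<omega>) i"
  have i: "integrable M (\<lambda>\<omega>. cube_sum (cfg \<omega>))" "integrable M (\<lambda>\<omega>. cube_sum (cfg \<omega>) * \<bar>total (cfg \<omega>)\<bar>)"
    "integrable M (\<lambda>\<omega>. fourth_sum (cfg \<omega>))"
    by (rule deg_integrable, (rule deg_intros)+, simp)+
  have iP: "integrable M ?P" "integrable M (\<lambda>\<omega>. ?P \<omega> * (total (cfg \<omega>))\<^sup>2)" "integrable M (\<lambda>\<omega>. ?P \<omega> * (in_weighted (cfg \<omega>))\<^sup>2)"
    by (rule deg_integrable, (rule deg_intros | assumption)+, simp)+
  have "expectation (\<lambda>\<omega>. \<Sum>i\<in>{1..n}. \<bar>X i \<omega>\<bar> * \<bar>norm_sq (cfg \<omega>) - norm_sq (zero_on (A i) (cfg \<omega>))\<bar> * (1 + \<bar>total (zero_on (A i) (cfg \<omega>))\<bar>))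
     \<le> expectation (\<lambda>\<omega>. 2 * (k\<^sup>2 * cube_sum (cfg \<omega>)) + 2 * (k\<^sup>2 * (cube_sum (cfg \<omega>) * \<bar>total (cfg \<omega>)\<bar>)) + 3 * (k ^ 3 * fourth_sum (cfg \<omega>))
         + k / real n * (?P \<omega> + ?P \<omega> * (in_weighted (cfg \<omega>))\<^sup>2 + 4 * (?P \<omega> * (total (cfg \<omega>))\<^sup>2) + 4 * (k ^ 3 * fourth_sum (cfg \<omega>))))"
  proof (rule integral_mono)
    show "integrable M (\<lambda>\<omega>. \<Sum>i\<in>{1..n}. \<bar>X i \<omega>\<bar> * \<bar>norm_sq (cfg \<omega>) - norm_sq (zero_on (A i) (cfg \<omega>))\<bar> * (1 + \<bar>total (zero_on (A i) (cfg \<omega>))\<bar>))"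
      by (rule deg_integrable, (rule deg_intros | assumption)+, simp)
    show "integrable M (\<lambda>\<omega>. 2 * (k\<^sup>2 * cube_sum (cfg \<omega>)) + 2 * (k\<^sup>2 * (cube_sum (cfg \<omega>) * \<bar>total (cfg \<omega>)\<bar>)) + 3 * (k ^ 3 * fourth_sum (cfg \<omega>))
         + k / real n * (?P \<omega> + ?P \<omega> * (in_weighted (cfg \<omega>))\<^sup>2 + 4 * (?P \<omega> * (total (cfg \<omega>))\<^sup>2) + 4 * (k ^ 3 * fourth_sum (cfg \<omega>))))"
      by (intro Bochner_Integration.integrable_add integrable_mult_right i iP)
    fix \<omega>
    show "(\<Sum>i\<in>{1..n}. \<bar>X i \<omega>\<bar> * \<bar>norm_sq (cfg \<omega>) - norm_sq (zero_on (A i) (cfg \<omega>))\<bar> * (1 + \<bar>total (zero_on (A i) (cfg \<omega>))\<bar>))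
      \<le> 2 * (k\<^sup>2 * cube_sum (cfg \<omega>)) + 2 * (k\<^sup>2 * (cube_sum (cfg \<omega>) * \<bar>total (cfg \<omega>)\<bar>)) + 3 * (k ^ 3 * fourth_sum (cfg \<omega>))
         + k / real n * (?P \<omega> + ?P \<omega> * (in_weighted (cfg \<omega>))\<^sup>2 + 4 * (?P \<omega> * (total (cfg \<omega>))\<^sup>2) + 4 * (k ^ 3 * fourth_sum (cfg \<omega>)))"
    proof -
      have "2 * k\<^sup>2 * cube_sum (cfg \<omega>) * (1 + \<bar>total (cfg \<omega>)\<bar>) =
          2 * (k\<^sup>2 * cube_sum (cfg \<omega>)) + 2 * (k\<^sup>2 * (cube_sum (cfg \<omega>) * \<bar>total (cfg \<omega>)\<bar>))"
        by (simp add: algebra_simps)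
      moreover have "?P \<omega> * (1 + (in_weighted (cfg \<omega>))\<^sup>2 + 4 * (total (cfg \<omega>))\<^sup>2)
         = ?P \<omega> + ?P \<omega> * (in_weighted (cfg \<omega>))\<^sup>2 + 4 * (?P \<omega> * (total (cfg \<omega>))\<^sup>2)"
        by (simp only: distrib_left mult_1_right mult.left_commute[of _ 4])
      ultimately show ?thesis using sum_leave_out_norm_sq[of "cfg \<omega>"] by simp
    qed
  qed
  also have "\<dots> = 2 * (k\<^sup>2 * expectation (\<lambda>\<omega>. cube_sum (cfg \<omega>))) + 2 * (k\<^sup>2 * expectation (\<lambda>\<omega>. cube_sum (cfg \<omega>) * \<bar>total (cfg \<omega>)\<bar>))
      + 3 * (k ^ 3 * expectation (\<lambda>\<omega>. fourth_sum (cfg \<omega>)))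
      + k / real n * (expectation ?P + expectation (\<lambda>\<omega>. ?P \<omega> * (in_weighted (cfg \<omega>))\<^sup>2)
         + 4 * expectation (\<lambda>\<omega>. ?P \<omega> * (total (cfg \<omega>))\<^sup>2) + 4 * (k ^ 3 * expectation (\<lambda>\<omega>. fourth_sum (cfg \<omega>))))"
    by (simp only: Bochner_Integration.integral_add Bochner_Integration.integrable_add integral_mult_right_zero integrable_mult_right i iP)
  also have "\<dots> \<le> 2 * b + 2 * (3 * b) + 3 * b + k / real n * (lam + 10 * lam\<^sup>2 + 4 * (10 * lam\<^sup>2) + 4 * b\<^sup>2)"
  proof (intro add_mono mult_left_mono)
    show "expectation (\<lambda>\<omega>. ?P \<omega> * (in_weighted (cfg \<omega>))\<^sup>2) \<le> 10 * lam\<^sup>2"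
      unfolding in_weighted_def by (rule expectation_pair_lin_square[OF in_weight_bounds])
    show "expectation (\<lambda>\<omega>. ?P \<omega> * (total (cfg \<omega>))\<^sup>2) \<le> 10 * lam\<^sup>2"
      unfolding total_def by (rule expectation_pair_lin_square) auto
    show "k ^ 3 * expectation (\<lambda>\<omega>. fourth_sum (cfg \<omega>)) \<le> b" using k_cube_fourth b_le_1(2) by linarith
  qed (use cube_le expectation_cube_total expectation_abs_out_le k_cube_fourth in auto)
  also have "k / real n * (lam + 10 * lam\<^sup>2 + 4 * (10 * lam\<^sup>2) + 4 * b\<^sup>2) \<le> k / real n * (55 * lam\<^sup>2)"
  proof (rule mult_left_mono)
    have "lam \<le> lam\<^sup>2" using lam_ge_1 power_increasing[of 1 2 lam] by simp
    moreover have "1 \<le> lam\<^sup>2" using lam_ge_1 by (rule one_le_power)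
    ultimately show "lam + 10 * lam\<^sup>2 + 4 * (10 * lam\<^sup>2) + 4 * b\<^sup>2 \<le> 55 * lam\<^sup>2" using b_le_1(3) by linarith
  qed simp
  also have "k / real n * (55 * lam\<^sup>2) = 55 * (k / real n * lam\<^sup>2)" by simp
  also have "\<dots> \<le> 55 * b" by (intro mult_left_mono lam_square_le) simp
  finally show ?thesis by simp
qed

end

section \<open>Decoupling the Taylor remainders from the ratio\<close>

context normalized_field
begin

text \<open>The variable \<open>ratio\<close> agrees with the self-normalised sum unless the square of the normaliser differs from \<open>1\<close> by
  at least \<open>3 / 4\<close>.\<close>

definition scale :: "'a \<Rightarrow> real" where "scale \<omega> = inv_root (norm_sq (cfg \<omega>))"
definition ratio :: "'a \<Rightarrow> real" where "ratio \<omega> = total (cfg \<omega>) * scale \<omega>"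

lemma scale_bounds: "0 < scale \<omega>" "scale \<omega> \<le> 2" by (auto simp: scale_def inv_root_bounds)

lemma scale_measurable [measurable]: "scale \<in> borel_measurable M"
  unfolding scale_def by (rule measurable_compose[OF deg_measurable[OF deg_norm_sq] inv_root_measurable])

lemma deg_scale: "deg 0 scale"
proof (rule deg_bounded[of _ 2])
  show "\<bar>scale \<omega>\<bar> \<le> 2" for \<omega> using scale_bounds[of \<omega>] by simp
qed simp

lemma deg_ratio: "deg 1 ratio"
  unfolding ratio_def[abs_def] using deg_mult[OF deg_total deg_scale] by simp

lemma ratio_measurable [measurable]: "ratio \<in> borel_measurable M" by (rule deg_measurable[OF deg_ratio])

lemma abs_ratio_le: "\<bar>ratio \<omega>\<bar> \<le> 2 * \<bar>total (cfg \<omega>)\<bar>"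
  using scale_bounds[of \<omega>] mult_left_mono[of "scale \<omega>" 2 "\<bar>total (cfg \<omega>)\<bar>"] by (simp add: ratio_def abs_mult mult.commute)


lemma concentration_cover:
  assumes q: "\<And>e. prob {\<omega>\<in>space M. \<bar>ratio \<omega> - e\<bar> \<le> al} \<le> q" and al: "0 < al"
  shows "prob {\<omega>\<in>space M. \<bar>ratio \<omega> - e\<bar> \<le> real (Suc N) * al} \<le> real (Suc N) * q"
proof -
  have "prob {\<omega>\<in>space M. a \<le> ratio \<omega> \<and> ratio \<omega> \<le> a + 2 * real (Suc N) * al} \<le> real (Suc N) * q" for a
  proof (induction N)
    case 0
    have "{\<omega>\<in>space M. a \<le> ratio \<omega> \<and> ratio \<omega> \<le> a + 2 * real (Suc 0) * al} = {\<omega>\<in>space M. \<bar>ratio \<omega> - (a + al)\<bar> \<le> al}"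
      by (auto simp: abs_le_iff)
    then show ?case using q[of "a + al"] by simp
  next
    case (Suc N)
    let ?S = "{\<omega>\<in>space M. a \<le> ratio \<omega> \<and> ratio \<omega> \<le> a + 2 * real (Suc N) * al}"
    let ?T = "{\<omega>\<in>space M. \<bar>ratio \<omega> - (a + 2 * real (Suc N) * al + al)\<bar> \<le> al}"
    have "prob {\<omega>\<in>space M. a \<le> ratio \<omega> \<and> ratio \<omega> \<le> a + 2 * real (Suc (Suc N)) * al} \<le> prob (?S \<union> ?T)"
      by (intro finite_measure_mono) (auto simp: abs_le_iff algebra_simps)
    also have "\<dots> \<le> prob ?S + prob ?T" by (intro measure_Un_le) auto
    also have "\<dots> \<le> real (Suc N) * q + q" using Suc q by (intro add_mono)
    finally show ?case by (simp add: algebra_simps)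
  qed
  from this[of "e - real (Suc N) * al"]
  have "prob {\<omega>\<in>space M. e - real (Suc N) * al \<le> ratio \<omega> \<and> ratio \<omega> \<le> e - real (Suc N) * al + 2 * real (Suc N) * al} \<le> real (Suc N) * q" .
  also have "{\<omega>\<in>space M. e - real (Suc N) * al \<le> ratio \<omega> \<and> ratio \<omega> \<le> e - real (Suc N) * al + 2 * real (Suc N) * al}
    = {\<omega>\<in>space M. \<bar>ratio \<omega> - e\<bar> \<le> real (Suc N) * al}" by (auto simp: abs_le_iff algebra_simps)
  finally show ?thesis .
qed

text \<open>The piece of \<open>\<bar>s\<bar> * \<bar>u\<bar> * min 1 w\<close>, with \<open>w = 2 * k * \<bar>u\<bar> / al\<close>, on which \<open>w\<close> lies in the dyadic
  shell \<open>m\<close>. On such a shell the condition that a summand reaches the critical zone becomes a condition on \<open>ratio\<close> alone.\<close>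

definition shell_part :: "real \<Rightarrow> nat \<Rightarrow> real \<Rightarrow> real \<Rightarrow> real" where
  "shell_part al m s u = (if shell (2 * k * \<bar>u\<bar> / al) = m then \<bar>s\<bar> * (\<bar>u\<bar> * min 1 (2 * k * \<bar>u\<bar> / al)) else 0)"

lemma shell_part_measurable: "(\<lambda>(s, u). shell_part al m s u) \<in> borel_measurable (borel \<Otimes>\<^sub>M borel)"
  unfolding shell_part_def by measurable

lemma shell_part_bounds:
  assumes "0 < al" shows "0 \<le> shell_part al m s u" "shell_part al m s u \<le> \<bar>s\<bar> * \<bar>u\<bar>"
proof -
  have 0: "0 \<le> min 1 (2 * k * \<bar>u\<bar> / al)" using assms by simp
  then show "0 \<le> shell_part al m s u" by (simp add: shell_part_def)
  have "\<bar>s\<bar> * (\<bar>u\<bar> * min 1 (2 * k * \<bar>u\<bar> / al)) \<le> \<bar>s\<bar> * (\<bar>u\<bar> * 1)" by (intro mult_left_mono) auto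
  then show "shell_part al m s u \<le> \<bar>s\<bar> * \<bar>u\<bar>" by (simp add: shell_part_def)
qed

lemma shell_part_orthogonal:
  assumes "0 < al"
  shows "(\<Sum>m\<in>{..N}. shell_part al m s u * shell_part al m s' u') \<le> \<bar>s\<bar> * \<bar>u\<bar> * (\<bar>s'\<bar> * \<bar>u'\<bar>)"
proof -
  define m0 where "m0 = shell (2 * k * \<bar>u\<bar> / al)"
  have "(\<Sum>m\<in>{..N}. shell_part al m s u * shell_part al m s' u')
     = (\<Sum>m\<in>{..N}. if m = m0 then shell_part al m0 s u * shell_part al m0 s' u' else 0)"
    by (intro sum.cong refl) (auto simp: shell_part_def m0_def)
  also have "\<dots> \<le> shell_part al m0 s u * shell_part al m0 s' u'"
    using shell_part_bounds(1)[OF assms] by (simp add: sum.delta mult_nonneg_nonneg)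
  also have "\<dots> \<le> \<bar>s\<bar> * \<bar>u\<bar> * (\<bar>s'\<bar> * \<bar>u'\<bar>)"
    by (intro mult_mono shell_part_bounds assms) auto
  finally show ?thesis .
qed

lemma shell_part_weighted:
  assumes "0 < al"
  shows "(\<Sum>m\<in>{..N}. 2 ^ m * shell_part al m s u) \<le> 4 / al * (k * (\<bar>s\<bar> * u\<^sup>2))"
proof -
  define w where "w = 2 * k * \<bar>u\<bar> / al"
  have w0: "0 \<le> w" using assms by (simp add: w_def)
  have "(\<Sum>m\<in>{..N}. 2 ^ m * shell_part al m s u)
     = (\<Sum>m\<in>{..N}. if m = shell w then 2 ^ shell w * (\<bar>s\<bar> * (\<bar>u\<bar> * min 1 w)) else 0)"
    by (intro sum.cong refl) (auto simp: shell_part_def w_def)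
  also have "\<dots> \<le> 2 ^ shell w * (\<bar>s\<bar> * (\<bar>u\<bar> * min 1 w))"
    using w0 by (simp add: sum.delta)
  also have "\<dots> = \<bar>s\<bar> * \<bar>u\<bar> * (min 1 w * 2 ^ shell w)" by (simp add: mult_ac)
  also have "\<dots> \<le> \<bar>s\<bar> * \<bar>u\<bar> * (2 * w)" by (intro mult_left_mono shell_scale w0) auto
  also have "\<dots> = 4 / al * (k * (\<bar>s\<bar> * (\<bar>u\<bar> * \<bar>u\<bar>)))" by (simp add: w_def)
  also have "\<bar>u\<bar> * \<bar>u\<bar> = u\<^sup>2" by (simp add: power2_eq_square)
  finally show ?thesis .
qed

lemma kern_shell_le:
  assumes al: "0 < al" and N: "1 \<le> 2 ^ N * al" and i: "i \<in> {1..n}"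
  shows "kern al (2 * out_abs v i) d
    \<le> 8 * (\<Sum>l\<in>A i. (\<Sum>m\<in>{..N}. if d \<le> 8 * 2 ^ m * al then shell_part al m 1 (v l) else 0) + 2 * k * (v l)\<^sup>2)"
proof -
  have "kern al (2 * out_abs v i) d = kern al (\<Sum>l\<in>A i. 2 * \<bar>v l\<bar>) d"
    by (simp add: out_abs_def sum_distrib_left)
  also have "\<dots> \<le> 4 * (\<Sum>l\<in>A i. if d \<le> 8 * max al (k * (2 * \<bar>v l\<bar>)) then 2 * \<bar>v l\<bar> * min 1 (k * (2 * \<bar>v l\<bar>) / al) else 0)"
    using i by (intro kern_sum_le card_A al k_ge_1) auto
  also have "\<dots> \<le> 4 * (\<Sum>l\<in>A i. 2 * ((\<Sum>m\<in>{..N}. if d \<le> 8 * 2 ^ m * al then shell_part al m 1 (v l) else 0) + 2 * k * (v l)\<^sup>2))"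
  proof (intro mult_left_mono sum_mono)
    fix l
    define w where "w = 2 * k * \<bar>v l\<bar> / al"
    define P where "P m \<longleftrightarrow> d \<le> 8 * 2 ^ m * al" for m
    have w0: "0 \<le> w" using al by (simp add: w_def)
    have wk: "k * (2 * \<bar>v l\<bar>) = w * al" using al by (simp add: w_def)
    have S: "(\<Sum>m\<in>{..N}. if P m then shell_part al m 1 (v l) else 0)
      = (\<Sum>m\<in>{..N}. if m = shell w then (if P (shell w) then \<bar>v l\<bar> * min 1 w else 0) else 0)"
      by (intro sum.cong refl) (auto simp: shell_part_def w_def)
    have S0: "0 \<le> (\<Sum>m\<in>{..N}. if P m then shell_part al m 1 (v l) else 0)"
      using shell_part_bounds(1)[OF al] by (intro sum_nonneg) auto
    have "(if d \<le> 8 * max al (w * al) then \<bar>v l\<bar> * min 1 w else 0)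
       \<le> (\<Sum>m\<in>{..N}. if P m then shell_part al m 1 (v l) else 0) + 2 * k * (v l)\<^sup>2"
    proof (cases "shell w \<le> N")
      case True
      have "1 \<le> (2::real) ^ shell w" by simp
      then have "max al (w * al) \<le> 2 ^ shell w * al"
        using shell_le[of w] al mult_right_mono[of 1 "2 ^ shell w" al] by (auto intro: mult_right_mono)
      then have imp: "d \<le> 8 * max al (w * al) \<Longrightarrow> P (shell w)" unfolding P_def by linarith
      have "(if d \<le> 8 * max al (w * al) then \<bar>v l\<bar> * min 1 w else 0) \<le> (if P (shell w) then \<bar>v l\<bar> * min 1 w else 0)"
        using imp w0 by auto
      also have "\<dots> = (\<Sum>m\<in>{..N}. if P m then shell_part al m 1 (v l) else 0)"
        unfolding S using True by (simp add: sum.delta)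
      also have "\<dots> \<le> (\<Sum>m\<in>{..N}. if P m then shell_part al m 1 (v l) else 0) + 2 * k * (v l)\<^sup>2" by simp
      finally show ?thesis .
    next
      case False
      then have "2 ^ N < w" by (simp add: shell_le_iff)
      then have "2 ^ N * al < w * al" using al by simp
      then have big: "1 \<le> 2 * k * \<bar>v l\<bar>" using N wk by simp
      have "(if d \<le> 8 * max al (w * al) then \<bar>v l\<bar> * min 1 w else 0) \<le> \<bar>v l\<bar>"
        using w0 by (simp add: mult_left_le)
      also have "\<dots> \<le> \<bar>v l\<bar> * (2 * k * \<bar>v l\<bar>)" using mult_left_mono[OF big, of "\<bar>v l\<bar>"] by simp
      also have "\<dots> = 2 * k * (\<bar>v l\<bar> * \<bar>v l\<bar>)" by simp
      also have "\<bar>v l\<bar> * \<bar>v l\<bar> = (v l)\<^sup>2" by (simp add: power2_eq_square)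
      finally show ?thesis using S0 by linarith
    qed
    moreover have "(if d \<le> 8 * max al (k * (2 * \<bar>v l\<bar>)) then 2 * \<bar>v l\<bar> * min 1 (k * (2 * \<bar>v l\<bar>) / al) else 0)
      = 2 * (if d \<le> 8 * max al (w * al) then \<bar>v l\<bar> * min 1 w else 0)"
      unfolding wk using al by simp
    ultimately show "(if d \<le> 8 * max al (k * (2 * \<bar>v l\<bar>)) then 2 * \<bar>v l\<bar> * min 1 (k * (2 * \<bar>v l\<bar>) / al) else 0)
      \<le> 2 * ((\<Sum>m\<in>{..N}. if d \<le> 8 * 2 ^ m * al then shell_part al m 1 (v l) else 0) + 2 * k * (v l)\<^sup>2)"
      unfolding P_def by simp
  qed simp
  also have "\<dots> = 8 * (\<Sum>l\<in>A i. (\<Sum>m\<in>{..N}. if d \<le> 8 * 2 ^ m * al then shell_part al m 1 (v l) else 0) + 2 * k * (v l)\<^sup>2)"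
    by (simp only: sum_distrib_left[symmetric])
  finally show ?thesis .
qed

lemma kern_integrable:
  assumes al: "0 < al"
  shows "integrable M (\<lambda>\<omega>. \<Sum>i\<in>{1..n}. \<bar>X i \<omega>\<bar> * kern al (2 * out_abs (cfg \<omega>) i) \<bar>ratio \<omega> - e\<bar>)"
proof -
  have dk: "deg 1 (\<lambda>\<omega>. kern al (2 * out_abs (cfg \<omega>) i) \<bar>ratio \<omega> - e\<bar>)" if i: "i \<in> {1..n}" for i
  proof -
    have [measurable]: "(\<lambda>\<omega>. out_abs (cfg \<omega>) i) \<in> borel_measurable M" by (rule deg_measurable[OF deg_out[OF i]])
    have m: "(\<lambda>\<omega>. kern al (2 * out_abs (cfg \<omega>) i) \<bar>ratio \<omega> - e\<bar>) \<in> borel_measurable M"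
      unfolding kern_def by measurable
    obtain c where c: "0 \<le> c" "\<And>\<omega>. \<bar>2 * out_abs (cfg \<omega>) i\<bar> \<le> c * mass \<omega> ^ 1"
      using deg_cmult[OF deg_out[OF i], of 2] unfolding deg_def by blast
    have "\<bar>kern al (2 * out_abs (cfg \<omega>) i) \<bar>ratio \<omega> - e\<bar>\<bar> \<le> c * mass \<omega> ^ 1" for \<omega>
      using c(2)[of \<omega>] kern_le[OF al, of "2 * out_abs (cfg \<omega>) i" "\<bar>ratio \<omega> - e\<bar>"]
        kern_nonneg[OF al, of "2 * out_abs (cfg \<omega>) i" "\<bar>ratio \<omega> - e\<bar>"] by simp
    then show ?thesis using m c(1) unfolding deg_def by blast
  qed
  show ?thesis by (rule deg_integrable, (rule dk deg_intros | assumption)+, simp)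
qed

text \<open>The core of the proof. The remainder in Stein's identity couples \<open>ratio\<close> with third-order products \<open>\<bar>X i\<bar> * (Y i)\<^sup>2\<close>, and
  nothing is assumed about the joint law of three variables and the rest. By \<open>kern_sum_le\<close> and the decomposition into shells,
  the remainder is at most a sum over \<open>m\<close> of a pair sum \<open>?psi m\<close> times the indicator of \<open>\<bar>ratio - e\<bar> \<le> 8 * 2 ^ m * al\<close>. Each
  \<open>?psi m\<close> obeys the law of large numbers, so it may be replaced by its expectation, at the cost of its variance.
  What remains is the expectation times a probability, which is at most \<open>8 * 2 ^ m * q\<close>. The sum of \<open>2 ^ m\<close> times the
  expectation of \<open>?psi m\<close> is a third moment divided by \<open>al\<close>, the variances add up to \<open>2 * b\<^sup>2\<close>, and shells beyond \<open>2 ^ N\<close>, of order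
  \<open>1 / al\<close>, are dominated by third moments directly.\<close>

lemma kern_sum_expectation:
  assumes al: "0 < al" "al \<le> 1"
    and q: "\<And>e. prob {\<omega>\<in>space M. \<bar>ratio \<omega> - e\<bar> \<le> al} \<le> q"
  shows "expectation (\<lambda>\<omega>. \<Sum>i\<in>{1..n}. \<bar>X i \<omega>\<bar> * kern al (2 * out_abs (cfg \<omega>) i) \<bar>ratio \<omega> - e\<bar>) \<le> 384 * q * b / al + 24 * b"
proof -
  define N where "N = shell (1 / al)"
  have N1: "1 \<le> 2 ^ N * al" using shell_le[of "1 / al"] al by (simp add: N_def divide_le_eq)
  have "min 1 (1 / al) * 2 ^ N \<le> 2 * (1 / al)" unfolding N_def using al by (intro shell_scale) simp
  then have N2: "2 ^ N \<le> 2 / al" using al by (simp add: min_def divide_simps split: if_splits)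
  have q0: "0 \<le> q" using q[of 0] measure_nonneg order_trans by blast
  let ?psi = "\<lambda>m. pair_sum (shell_part al m)"
  let ?D = "\<lambda>m \<omega>. ?psi m \<omega> - expectation (?psi m)"
  let ?P = "\<lambda>m \<omega>. \<bar>ratio \<omega> - e\<bar> \<le> 8 * 2 ^ m * al"
  let ?top = "\<lambda>\<omega>. k * (\<Sum>i\<in>{1..n}. \<Sum>l\<in>A i. \<bar>X i \<omega>\<bar> * (X l \<omega>)\<^sup>2)"
  have d: "deg 2 (?psi m)" for m by (rule deg_pair_sum[OF shell_part_measurable shell_part_bounds[OF al(1)]])
  have i1: "integrable M (?psi m)" for m by (rule deg_integrable[OF d]) simp
  have iP: "integrable M (\<lambda>\<omega>. if ?P m \<omega> then ?psi m \<omega> else 0)" for m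
    by (rule deg_integrable[OF deg_if[OF d]]) auto
  have iD2: "integrable M (\<lambda>\<omega>. (?D m \<omega>)\<^sup>2)" for m
    by (rule deg_integrable[OF deg_power[OF deg_diff[OF d deg_const]]]) simp
  have itop: "integrable M ?top"
    by (rule deg_integrable, (rule deg_intros | assumption | rule in_A)+, simp)
  have ic: "integrable M (\<lambda>\<omega>. cube_sum (cfg \<omega>))" by (rule deg_integrable, (rule deg_intros)+, simp)
  have psi0: "0 \<le> expectation (?psi m)" for m
    unfolding pair_sum_def using shell_part_bounds(1)[OF al(1)] by (intro Bochner_Integration.integral_nonneg sum_nonneg)
  have prob_P: "prob {\<omega>\<in>space M. ?P m \<omega>} \<le> 8 * 2 ^ m * q" for m
  proof -
    obtain j where j: "8 * 2 ^ m = Suc j" by (metis Suc_pred' zero_less_numeral zero_less_power nat_0_less_mult_iff)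
    then have "real (Suc j) = 8 * 2 ^ m" by (metis of_nat_mult of_nat_numeral of_nat_power)
    then show ?thesis using concentration_cover[OF q al(1), of e j] by simp
  qed
  have pointwise: "(\<Sum>i\<in>{1..n}. \<bar>X i \<omega>\<bar> * kern al (2 * out_abs (cfg \<omega>) i) \<bar>ratio \<omega> - e\<bar>)
     \<le> 8 * (\<Sum>m\<in>{..N}. if ?P m \<omega> then ?psi m \<omega> else 0) + 16 * ?top \<omega>" for \<omega>
  proof -
    have sp: "\<bar>s\<bar> * (if Q then shell_part al m 1 u else 0) = (if Q then shell_part al m s u else 0)" for s u m Q
      by (simp add: shell_part_def)
    have "(\<Sum>i\<in>{1..n}. \<bar>X i \<omega>\<bar> * kern al (2 * out_abs (cfg \<omega>) i) \<bar>ratio \<omega> - e\<bar>)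
      \<le> (\<Sum>i\<in>{1..n}. \<bar>X i \<omega>\<bar> * (8 * (\<Sum>l\<in>A i. (\<Sum>m\<in>{..N}. if ?P m \<omega> then shell_part al m 1 (X l \<omega>) else 0) + 2 * k * (X l \<omega>)\<^sup>2)))"
      by (intro sum_mono mult_left_mono kern_shell_le al N1) auto
    also have "\<dots> = 8 * (\<Sum>i\<in>{1..n}. \<Sum>l\<in>A i. \<Sum>m\<in>{..N}. \<bar>X i \<omega>\<bar> * (if ?P m \<omega> then shell_part al m 1 (X l \<omega>) else 0)) + 16 * ?top \<omega>"
      by (simp add: sum_distrib_left sum.distrib distrib_left mult_ac)
    also have "(\<Sum>i\<in>{1..n}. \<Sum>l\<in>A i. \<Sum>m\<in>{..N}. \<bar>X i \<omega>\<bar> * (if ?P m \<omega> then shell_part al m 1 (X l \<omega>) else 0))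
       = (\<Sum>i\<in>{1..n}. \<Sum>m\<in>{..N}. \<Sum>l\<in>A i. if ?P m \<omega> then shell_part al m (X i \<omega>) (X l \<omega>) else 0)"
      unfolding sp by (intro sum.cong refl sum.swap)
    also have "\<dots> = (\<Sum>m\<in>{..N}. \<Sum>i\<in>{1..n}. \<Sum>l\<in>A i. if ?P m \<omega> then shell_part al m (X i \<omega>) (X l \<omega>) else 0)"
      by (rule sum.swap)
    also have "\<dots> = (\<Sum>m\<in>{..N}. if ?P m \<omega> then ?psi m \<omega> else 0)"
      by (intro sum.cong refl) (simp add: pair_sum_def)
    finally show ?thesis .
  qed
  have each: "expectation (\<lambda>\<omega>. if ?P m \<omega> then ?psi m \<omega> else 0)
     \<le> (expectation (?psi m) + b / 2) * (8 * 2 ^ m * q) + expectation (\<lambda>\<omega>. (?D m \<omega>)\<^sup>2) / (2 * b)" for m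
  proof -
    have iI: "integrable M (indicator {\<omega>\<in>space M. ?P m \<omega>} :: 'a \<Rightarrow> real)"
      by (intro integrable_real_indicator) (auto simp: less_top[symmetric])
    \<comment> \<open>\<open>\<bar>?D m\<bar> \<le> b / 2 + (?D m)\<^sup>2 / (2 * b)\<close>: the variances can be summed over \<open>m\<close>, and the first term meets a probability\<close>
    have "expectation (\<lambda>\<omega>. if ?P m \<omega> then ?psi m \<omega> else 0)
       \<le> expectation (\<lambda>\<omega>. (expectation (?psi m) + b / 2) * indicator {\<omega>\<in>space M. ?P m \<omega>} \<omega> + (?D m \<omega>)\<^sup>2 / (2 * b))"
    proof (rule integral_mono[OF iP])
      show "integrable M (\<lambda>\<omega>. (expectation (?psi m) + b / 2) * indicator {\<omega>\<in>space M. ?P m \<omega>} \<omega> + (?D m \<omega>)\<^sup>2 / (2 * b))"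
        by (intro Bochner_Integration.integrable_add integrable_mult_right integrable_divide iD2 iI)
      fix \<omega> assume "\<omega> \<in> space M"
      then show "(if ?P m \<omega> then ?psi m \<omega> else 0) \<le> (expectation (?psi m) + b / 2) * indicator {\<omega>\<in>space M. ?P m \<omega>} \<omega> + (?D m \<omega>)\<^sup>2 / (2 * b)"
        using abs_le_weighted_square[of "?D m \<omega>"] b_pos by (auto simp: indicator_def)
    qed
    also have "\<dots> = (expectation (?psi m) + b / 2) * prob {\<omega>\<in>space M. ?P m \<omega>} + expectation (\<lambda>\<omega>. (?D m \<omega>)\<^sup>2) / (2 * b)"
      unfolding Bochner_Integration.integral_add[OF integrable_mult_right[OF iI] integrable_divide[OF iD2]]
      by (simp add: Int_absorb2)
    also have "\<dots> \<le> (expectation (?psi m) + b / 2) * (8 * 2 ^ m * q) + expectation (\<lambda>\<omega>. (?D m \<omega>)\<^sup>2) / (2 * b)"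
      using psi0[of m] b_pos by (intro add_right_mono mult_left_mono prob_P) auto
    finally show ?thesis .
  qed
  have var: "(\<Sum>m\<in>{..N}. expectation (\<lambda>\<omega>. (?D m \<omega>)\<^sup>2)) \<le> 2 * b\<^sup>2"
    by (rule pair_sum_family_variance) (auto intro: shell_part_measurable shell_part_bounds al shell_part_orthogonal)
  have top_le: "expectation ?top \<le> b"
  proof -
    have "expectation ?top \<le> expectation (\<lambda>\<omega>. k\<^sup>2 * cube_sum (cfg \<omega>))"
      using itop ic by (intro integral_mono) (auto simp only: intro: sum_abs_member_square integrable_mult_right)
    then show ?thesis using cube_le ic by simp
  qed
  have weighted: "(\<Sum>m\<in>{..N}. 2 ^ m * expectation (?psi m)) \<le> 4 / al * b"
  proof -
    have "(\<Sum>m\<in>{..N}. 2 ^ m * expectation (?psi m)) = expectation (\<lambda>\<omega>. \<Sum>m\<in>{..N}. 2 ^ m * ?psi m \<omega>)"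
      using i1 by (simp add: Bochner_Integration.integral_sum)
    also have "\<dots> \<le> expectation (\<lambda>\<omega>. 4 / al * ?top \<omega>)"
    proof (rule integral_mono)
      show "integrable M (\<lambda>\<omega>. \<Sum>m\<in>{..N}. 2 ^ m * ?psi m \<omega>)" using i1 by simp
      show "integrable M (\<lambda>\<omega>. 4 / al * ?top \<omega>)" using itop by (rule integrable_mult_right)
      fix \<omega>
      have "(\<Sum>m\<in>{..N}. 2 ^ m * ?psi m \<omega>) = (\<Sum>m\<in>{..N}. \<Sum>i\<in>{1..n}. \<Sum>l\<in>A i. 2 ^ m * shell_part al m (X i \<omega>) (X l \<omega>))"
        by (simp add: pair_sum_def sum_distrib_left)
      also have "\<dots> = (\<Sum>i\<in>{1..n}. \<Sum>m\<in>{..N}. \<Sum>l\<in>A i. 2 ^ m * shell_part al m (X i \<omega>) (X l \<omega>))"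
        by (rule sum.swap)
      also have "\<dots> = (\<Sum>i\<in>{1..n}. \<Sum>l\<in>A i. \<Sum>m\<in>{..N}. 2 ^ m * shell_part al m (X i \<omega>) (X l \<omega>))"
        by (intro sum.cong refl sum.swap)
      also have "\<dots> \<le> (\<Sum>i\<in>{1..n}. \<Sum>l\<in>A i. 4 / al * (k * (\<bar>X i \<omega>\<bar> * (X l \<omega>)\<^sup>2)))"
        by (intro sum_mono shell_part_weighted al)
      also have "\<dots> = 4 / al * ?top \<omega>" by (simp only: sum_distrib_left)
      finally show "(\<Sum>m\<in>{..N}. 2 ^ m * ?psi m \<omega>) \<le> 4 / al * ?top \<omega>" .
    qed
    also have "\<dots> = 4 / al * expectation ?top" by (rule integral_mult_right_zero)
    also have "\<dots> \<le> 4 / al * b" using top_le al by (intro mult_left_mono) auto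
    finally show ?thesis .
  qed
  have geo: "(\<Sum>m\<in>{..N}. (2::real) ^ m) \<le> 4 / al"
  proof -
    have "(\<Sum>m\<in>{..N}. (2::real) ^ m) = 2 ^ Suc N - 1" by (simp add: lessThan_Suc_atMost[symmetric] sum_gp_strict)
    also have "\<dots> \<le> 2 * (2 / al)" using N2 by simp
    finally show ?thesis by simp
  qed
  have isum: "integrable M (\<lambda>\<omega>. \<Sum>m\<in>{..N}. if ?P m \<omega> then ?psi m \<omega> else 0)"
    by (intro Bochner_Integration.integrable_sum iP)
  have "expectation (\<lambda>\<omega>. \<Sum>i\<in>{1..n}. \<bar>X i \<omega>\<bar> * kern al (2 * out_abs (cfg \<omega>) i) \<bar>ratio \<omega> - e\<bar>)
    \<le> expectation (\<lambda>\<omega>. 8 * (\<Sum>m\<in>{..N}. if ?P m \<omega> then ?psi m \<omega> else 0) + 16 * ?top \<omega>)"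
  proof (rule integral_mono[OF _ _ pointwise])
    show "integrable M (\<lambda>\<omega>. \<Sum>i\<in>{1..n}. \<bar>X i \<omega>\<bar> * kern al (2 * out_abs (cfg \<omega>) i) \<bar>ratio \<omega> - e\<bar>)"
      by (rule kern_integrable[OF al(1)])
    show "integrable M (\<lambda>\<omega>. 8 * (\<Sum>m\<in>{..N}. if ?P m \<omega> then ?psi m \<omega> else 0) + 16 * ?top \<omega>)"
      by (intro Bochner_Integration.integrable_add integrable_mult_right[OF isum] integrable_mult_right[OF itop])
  qed
  also have "\<dots> = 8 * expectation (\<lambda>\<omega>. \<Sum>m\<in>{..N}. if ?P m \<omega> then ?psi m \<omega> else 0) + 16 * expectation ?top"
    unfolding Bochner_Integration.integral_add[OF integrable_mult_right[OF isum] integrable_mult_right[OF itop]]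
      integral_mult_right_zero ..
  also have "expectation (\<lambda>\<omega>. \<Sum>m\<in>{..N}. if ?P m \<omega> then ?psi m \<omega> else 0) = (\<Sum>m\<in>{..N}. expectation (\<lambda>\<omega>. if ?P m \<omega> then ?psi m \<omega> else 0))"
    by (rule Bochner_Integration.integral_sum[OF iP])
  also have "8 * \<dots> + 16 * expectation ?top
     \<le> 8 * (\<Sum>m\<in>{..N}. (expectation (?psi m) + b / 2) * (8 * 2 ^ m * q) + expectation (\<lambda>\<omega>. (?D m \<omega>)\<^sup>2) / (2 * b)) + 16 * b"
    by (intro add_mono mult_left_mono sum_mono each top_le) auto
  also have "(\<Sum>m\<in>{..N}. (expectation (?psi m) + b / 2) * (8 * 2 ^ m * q) + expectation (\<lambda>\<omega>. (?D m \<omega>)\<^sup>2) / (2 * b))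
     = 8 * q * ((\<Sum>m\<in>{..N}. 2 ^ m * expectation (?psi m)) + b / 2 * (\<Sum>m\<in>{..N}. 2 ^ m)) + (\<Sum>m\<in>{..N}. expectation (\<lambda>\<omega>. (?D m \<omega>)\<^sup>2)) / (2 * b)"
    by (simp only: sum_distrib_left sum_divide_distrib sum.distrib[symmetric]) (intro sum.cong refl, simp add: algebra_simps)
  also have "\<dots> \<le> 8 * q * (4 / al * b + b / 2 * (4 / al)) + 2 * b\<^sup>2 / (2 * b)"
    using q0 b_pos by (intro add_mono mult_left_mono weighted geo divide_right_mono var) auto
  also have "\<dots> = 48 * q * b / al + b" using b_pos by (simp add: power2_eq_square field_simps)
  finally show ?thesis by (simp add: algebra_simps)
qed

end

section \<open>Stein's identity for the ratio\<close>

context normalized_field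
begin

definition nbhd :: "nat \<Rightarrow> 'a \<Rightarrow> real" where "nbhd i \<omega> = (\<Sum>l\<in>A i. X l \<omega>)"

lemma abs_nbhd_le: "\<bar>nbhd i \<omega>\<bar> \<le> out_abs (cfg \<omega>) i"
  unfolding nbhd_def out_abs_def by (rule sum_abs)

lemma abs_scale_nbhd_le: "\<bar>scale \<omega> * nbhd i \<omega>\<bar> \<le> 2 * out_abs (cfg \<omega>) i"
  unfolding abs_mult using scale_bounds[of \<omega>] abs_nbhd_le[of i \<omega>] by (intro mult_mono) auto

lemma ratio_leave_out:
  "i \<in> {1..n} \<Longrightarrow> ratio \<omega> - scale \<omega> * nbhd i \<omega> = total (zero_on (A i) (cfg \<omega>)) * scale \<omega>"
  using total_minus_zero_on[OF A_sub, of i "cfg \<omega>"] unfolding ratio_def nbhd_def by (simp add: algebra_simps)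

lemma scaled_test_lipschitz:
  fixes F :: "real \<Rightarrow> real"
  assumes F: "\<And>x. \<bar>F x\<bar> \<le> c" and lip: "\<And>x y. \<bar>F x - F y\<bar> \<le> c * \<bar>x - y\<bar>"
  shows "\<bar>inv_root s * F (w * inv_root s) - inv_root s' * F (w * inv_root s')\<bar> \<le> 8 * c * (\<bar>s - s'\<bar> * (1 + \<bar>w\<bar>))"
proof -
  define r r' where "r = inv_root s" and "r' = inv_root s'"
  have c: "0 \<le> c" using F[of 0] by simp
  have rr: "\<bar>r - r'\<bar> \<le> 4 * \<bar>s - s'\<bar>" unfolding r_def r'_def by (rule inv_root_lipschitz)
  have r': "0 \<le> r'" "r' \<le> 2" using inv_root_bounds[of s'] by (auto simp: r'_def)
  have "r * F (w * r) - r' * F (w * r') = (r - r') * F (w * r) + r' * (F (w * r) - F (w * r'))"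
    by (simp add: algebra_simps)
  then have "\<bar>r * F (w * r) - r' * F (w * r')\<bar> \<le> \<bar>r - r'\<bar> * \<bar>F (w * r)\<bar> + r' * \<bar>F (w * r) - F (w * r')\<bar>"
    using abs_triangle_ineq[of "(r - r') * F (w * r)" "r' * (F (w * r) - F (w * r'))"] r' by (simp add: abs_mult)
  also have "\<dots> \<le> \<bar>r - r'\<bar> * c + 2 * (c * \<bar>w * r - w * r'\<bar>)"
    using r' c by (intro add_mono mult_mono F lip) auto
  also have "\<bar>w * r - w * r'\<bar> = \<bar>w\<bar> * \<bar>r - r'\<bar>"
    by (simp only: right_diff_distrib[symmetric] abs_mult)
  also have "\<bar>r - r'\<bar> * c + 2 * (c * (\<bar>w\<bar> * \<bar>r - r'\<bar>)) = c * \<bar>r - r'\<bar> * (1 + 2 * \<bar>w\<bar>)"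
    by (simp add: algebra_simps)
  also have "\<dots> \<le> c * (4 * \<bar>s - s'\<bar>) * (2 * (1 + \<bar>w\<bar>))"
    using c rr by (intro mult_mono mult_left_mono) auto
  finally show ?thesis by (simp add: r_def r'_def mult_ac)
qed

text \<open>Write \<open>H w s = r * F (w * r)\<close> with \<open>r = inv_root s\<close>, so that \<open>ratio * F ratio\<close> is the sum of \<open>X i * H S T\<close>, where \<open>T\<close> is
  the square of the normaliser. With \<open>A i\<close> left out in both arguments, \<open>H\<close> is independent of the centred \<open>X i\<close> and bounded, and the
  expectation vanishes. Changing \<open>S\<close> gives \<open>X i * Y i * r\<^sup>2 * g ratio\<close> and the Taylor remainder \<open>R i\<close>; these main terms
  add up to \<open>quad * r\<^sup>2 * g ratio\<close>, and \<open>quad * r\<^sup>2\<close> is close to \<open>1\<close> in \<open>L\<^sup>1\<close>. Changing \<open>T\<close> costs \<open>leave_out_error\<close>.\<close>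

lemma stein_identity:
  fixes F g :: "real \<Rightarrow> real"
  assumes dF: "\<And>x. (F has_real_derivative g x) (at x)" and g_meas [measurable]: "g \<in> borel_measurable borel"
    and Fc: "\<And>x. \<bar>F x\<bar> \<le> c" and gc: "\<And>x. \<bar>g x\<bar> \<le> c"
    and rem: "\<And>i \<omega>. i \<in> {1..n} \<Longrightarrow> \<bar>F (ratio \<omega> - scale \<omega> * nbhd i \<omega>) - F (ratio \<omega>) + scale \<omega> * nbhd i \<omega> * g (ratio \<omega>)\<bar> \<le> R i \<omega>"
    and R_int: "integrable M (\<lambda>\<omega>. \<Sum>i\<in>{1..n}. \<bar>X i \<omega>\<bar> * R i \<omega>)"
  shows "\<bar>expectation (\<lambda>\<omega>. ratio \<omega> * F (ratio \<omega>)) - expectation (\<lambda>\<omega>. g (ratio \<omega>))\<bar>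
    \<le> 544 * c * b + 2 * expectation (\<lambda>\<omega>. \<Sum>i\<in>{1..n}. \<bar>X i \<omega>\<bar> * R i \<omega>)"
proof -
  have c0: "0 \<le> c" using Fc[of 0] by simp
  have F_cont: "continuous_on UNIV F" using dF by (intro DERIV_continuous_on) auto
  have F_meas [measurable]: "F \<in> borel_measurable borel" by (rule borel_measurable_continuous_onI[OF F_cont])
  have lip: "\<bar>F x - F y\<bar> \<le> c * \<bar>x - y\<bar>" for x y
  proof -
    have "norm (F x - F y) \<le> c * norm (x - y)"
      using gc by (intro field_differentiable_bound[where S=UNIV and f'=g]) (auto intro: dF)
    then show ?thesis by simp
  qed
  define H where "H w s = inv_root s * F (w * inv_root s)" for w s
  define Hi where "Hi i \<omega> = H (total (zero_on (A i) (cfg \<omega>))) (norm_sq (zero_on (A i) (cfg \<omega>)))" for i \<omega>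
  have H_meas: "(\<lambda>(w, s). H w s) \<in> borel_measurable (borel \<Otimes>\<^sub>M borel)" unfolding H_def by measurable
  have H_fun: "functional (\<lambda>v. H (total v) (norm_sq v))"
    by (rule functional_comp[OF functional_total functional_norm_sq H_meas])
  have H_bound: "\<bar>H w s\<bar> \<le> 2 * c" for w s
    unfolding H_def abs_mult using inv_root_bounds[of s] Fc c0 by (intro mult_mono) auto
  have dHi: "deg 0 (Hi i)" for i
  proof (rule deg_bounded[of _ "2 * c"])
    have [measurable]: "(\<lambda>\<omega>. total (zero_on (A i) (cfg \<omega>))) \<in> borel_measurable M"
      "(\<lambda>\<omega>. norm_sq (zero_on (A i) (cfg \<omega>))) \<in> borel_measurable M"
      by (rule deg_measurable[OF deg_total0], rule deg_measurable[OF deg_norm_sq0])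
    show "Hi i \<in> borel_measurable M" unfolding Hi_def[abs_def] H_def by measurable
    show "\<bar>Hi i \<omega>\<bar> \<le> 2 * c" for \<omega> unfolding Hi_def by (rule H_bound)
  qed
  have dFr: "deg 0 (\<lambda>\<omega>. F (ratio \<omega>))" by (rule deg_bounded[OF _ Fc]) measurable
  have dgr: "deg 0 (\<lambda>\<omega>. g (ratio \<omega>))" by (rule deg_bounded[OF _ gc]) measurable
  have iXH: "integrable M (\<lambda>\<omega>. X i \<omega> * Hi i \<omega>)" if "i \<in> {1..n}" for i
    by (rule deg_integrable[OF deg_mult[OF deg_X[OF that] dHi]]) simp
  have XH: "expectation (\<lambda>\<omega>. X i \<omega> * Hi i \<omega>) = 0" if "i \<in> {1..n}" for i
    unfolding Hi_def
    by (rule expectation_centred[OF that H_fun]) (rule deg_integrable[OF dHi, unfolded Hi_def], simp)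
  let ?L = "\<lambda>\<omega>. \<Sum>i\<in>{1..n}. \<bar>X i \<omega>\<bar> * \<bar>norm_sq (cfg \<omega>) - norm_sq (zero_on (A i) (cfg \<omega>))\<bar> * (1 + \<bar>total (zero_on (A i) (cfg \<omega>))\<bar>)"
  let ?B = "\<lambda>\<omega>. c * \<bar>quad (cfg \<omega>) * (scale \<omega>)\<^sup>2 - 1\<bar> + 2 * (\<Sum>i\<in>{1..n}. \<bar>X i \<omega>\<bar> * R i \<omega>) + 8 * c * ?L \<omega>"
  have main: "\<bar>ratio \<omega> * F (ratio \<omega>) - g (ratio \<omega>) - (\<Sum>i\<in>{1..n}. X i \<omega> * Hi i \<omega>)\<bar> \<le> ?B \<omega>" for \<omega>
  proof -
    let ?u = "ratio \<omega>" and ?r = "scale \<omega>"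
    define E where "E i = F (?u - ?r * nbhd i \<omega>) - F ?u + ?r * nbhd i \<omega> * g ?u" for i
    define K where "K i = ?r * F (?u - ?r * nbhd i \<omega>) - Hi i \<omega>" for i
    have "ratio \<omega> * F ?u = total (cfg \<omega>) * (?r * F ?u)" by (simp add: ratio_def)
    also have "\<dots> = (\<Sum>i\<in>{1..n}. X i \<omega> * (?r * F ?u))"
      unfolding total_def lin_def sum_distrib_right by simp
    also have "\<dots> = (\<Sum>i\<in>{1..n}. X i \<omega> * nbhd i \<omega> * (?r\<^sup>2 * g ?u) - X i \<omega> * (?r * E i) + X i \<omega> * K i + X i \<omega> * Hi i \<omega>)"
      by (intro sum.cong refl) (simp add: E_def K_def algebra_simps power2_eq_square)
    also have "\<dots> = (\<Sum>i\<in>{1..n}. X i \<omega> * nbhd i \<omega>) * (?r\<^sup>2 * g ?u) - (\<Sum>i\<in>{1..n}. X i \<omega> * (?r * E i))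
       + (\<Sum>i\<in>{1..n}. X i \<omega> * K i) + (\<Sum>i\<in>{1..n}. X i \<omega> * Hi i \<omega>)"
      by (simp only: sum.distrib sum_subtractf sum_distrib_right)
    also have "(\<Sum>i\<in>{1..n}. X i \<omega> * nbhd i \<omega>) = quad (cfg \<omega>)"
      by (simp add: quad_def nbhd_def sum_distrib_left)
    finally have eq: "ratio \<omega> * F ?u - g ?u - (\<Sum>i\<in>{1..n}. X i \<omega> * Hi i \<omega>) =
        (quad (cfg \<omega>) * ?r\<^sup>2 - 1) * g ?u - (\<Sum>i\<in>{1..n}. X i \<omega> * (?r * E i)) + (\<Sum>i\<in>{1..n}. X i \<omega> * K i)"
      by (simp add: algebra_simps)
    have 1: "\<bar>(quad (cfg \<omega>) * ?r\<^sup>2 - 1) * g ?u\<bar> \<le> c * \<bar>quad (cfg \<omega>) * ?r\<^sup>2 - 1\<bar>"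
      unfolding abs_mult using gc by (subst mult.commute, intro mult_right_mono) auto
    have 2: "\<bar>\<Sum>i\<in>{1..n}. X i \<omega> * (?r * E i)\<bar> \<le> 2 * (\<Sum>i\<in>{1..n}. \<bar>X i \<omega>\<bar> * R i \<omega>)"
    proof -
      have "\<bar>\<Sum>i\<in>{1..n}. X i \<omega> * (?r * E i)\<bar> \<le> (\<Sum>i\<in>{1..n}. \<bar>X i \<omega> * (?r * E i)\<bar>)" by (rule sum_abs)
      also have "\<dots> \<le> (\<Sum>i\<in>{1..n}. \<bar>X i \<omega>\<bar> * (2 * R i \<omega>))"
      proof (rule sum_mono)
        fix i assume i: "i \<in> {1..n}"
        have "\<bar>?r * E i\<bar> \<le> 2 * R i \<omega>"
          unfolding abs_mult E_def using scale_bounds[of \<omega>] by (intro mult_mono rem i) auto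
        then show "\<bar>X i \<omega> * (?r * E i)\<bar> \<le> \<bar>X i \<omega>\<bar> * (2 * R i \<omega>)"
          unfolding abs_mult[of "X i \<omega>"] by (intro mult_left_mono) auto
      qed
      finally show ?thesis by (simp add: sum_distrib_left mult_ac)
    qed
    have 3: "\<bar>\<Sum>i\<in>{1..n}. X i \<omega> * K i\<bar> \<le> 8 * c * ?L \<omega>"
    proof -
      have "\<bar>\<Sum>i\<in>{1..n}. X i \<omega> * K i\<bar> \<le> (\<Sum>i\<in>{1..n}. \<bar>X i \<omega> * K i\<bar>)" by (rule sum_abs)
      also have "\<dots> \<le> (\<Sum>i\<in>{1..n}. \<bar>X i \<omega>\<bar> * (8 * c * (\<bar>norm_sq (cfg \<omega>) - norm_sq (zero_on (A i) (cfg \<omega>))\<bar> * (1 + \<bar>total (zero_on (A i) (cfg \<omega>))\<bar>))))"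
      proof (rule sum_mono)
        fix i assume i: "i \<in> {1..n}"
        have "\<bar>K i\<bar> \<le> 8 * c * (\<bar>norm_sq (cfg \<omega>) - norm_sq (zero_on (A i) (cfg \<omega>))\<bar> * (1 + \<bar>total (zero_on (A i) (cfg \<omega>))\<bar>))"
          unfolding K_def Hi_def H_def ratio_leave_out[OF i] unfolding scale_def by (rule scaled_test_lipschitz[OF Fc lip])
        then show "\<bar>X i \<omega> * K i\<bar> \<le> \<bar>X i \<omega>\<bar> * (8 * c * (\<bar>norm_sq (cfg \<omega>) - norm_sq (zero_on (A i) (cfg \<omega>))\<bar> * (1 + \<bar>total (zero_on (A i) (cfg \<omega>))\<bar>)))"
          unfolding abs_mult[of "X i \<omega>"] by (intro mult_left_mono) auto
      qed
      also have "\<dots> = 8 * c * ?L \<omega>"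
        unfolding sum_distrib_left by (intro sum.cong refl) (simp only: mult_ac)
      finally show ?thesis .
    qed
    show ?thesis unfolding eq using 1 2 3 by linarith
  qed
  have iUF: "integrable M (\<lambda>\<omega>. ratio \<omega> * F (ratio \<omega>))"
    by (rule deg_integrable[OF deg_mult[OF deg_ratio dFr]]) simp
  have ig: "integrable M (\<lambda>\<omega>. g (ratio \<omega>))" by (rule deg_integrable[OF dgr]) simp
  have iS: "integrable M (\<lambda>\<omega>. \<Sum>i\<in>{1..n}. X i \<omega> * Hi i \<omega>)" by (intro Bochner_Integration.integrable_sum iXH)
  have ES: "expectation (\<lambda>\<omega>. \<Sum>i\<in>{1..n}. X i \<omega> * Hi i \<omega>) = 0"
    using XH iXH by (simp add: Bochner_Integration.integral_sum del: One_nat_def)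
  have iQ: "integrable M (\<lambda>\<omega>. \<bar>quad (cfg \<omega>) * (scale \<omega>)\<^sup>2 - 1\<bar>)"
    by (rule deg_integrable, (rule deg_scale deg_intros)+, simp)
  have iL: "integrable M ?L" by (rule deg_integrable, (rule deg_intros | assumption)+, simp)
  have "\<bar>expectation (\<lambda>\<omega>. ratio \<omega> * F (ratio \<omega>)) - expectation (\<lambda>\<omega>. g (ratio \<omega>))\<bar>
     = \<bar>expectation (\<lambda>\<omega>. ratio \<omega> * F (ratio \<omega>) - g (ratio \<omega>) - (\<Sum>i\<in>{1..n}. X i \<omega> * Hi i \<omega>))\<bar>"
    using ES iUF ig iS by simp
  also have "\<dots> \<le> expectation (\<lambda>\<omega>. \<bar>ratio \<omega> * F (ratio \<omega>) - g (ratio \<omega>) - (\<Sum>i\<in>{1..n}. X i \<omega> * Hi i \<omega>)\<bar>)"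
    by (rule integral_abs_bound)
  also have "\<dots> \<le> expectation ?B"
    by (intro integral_mono main integrable_abs Bochner_Integration.integrable_diff iUF ig iS
        Bochner_Integration.integrable_add integrable_mult_right iQ iL R_int)
  also have "\<dots> = c * expectation (\<lambda>\<omega>. \<bar>quad (cfg \<omega>) * (scale \<omega>)\<^sup>2 - 1\<bar>) + 2 * expectation (\<lambda>\<omega>. \<Sum>i\<in>{1..n}. \<bar>X i \<omega>\<bar> * R i \<omega>) + 8 * c * expectation ?L"
    by (simp only: Bochner_Integration.integral_add Bochner_Integration.integrable_add integral_mult_right_zero integrable_mult_right iQ iL R_int)
  also have "\<dots> \<le> c * (16 * b) + 2 * expectation (\<lambda>\<omega>. \<Sum>i\<in>{1..n}. \<bar>X i \<omega>\<bar> * R i \<omega>) + 8 * c * (66 * b)"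
    using c0 unfolding scale_def
    by (intro add_mono mult_left_mono normalised_quad_close_to_1 leave_out_error order_refl) auto
  finally show ?thesis by (simp add: algebra_simps)
qed

lemma expectation_abs_ratio: "expectation (\<lambda>\<omega>. \<bar>ratio \<omega>\<bar>) \<le> 2"
proof -
  have i: "integrable M (\<lambda>\<omega>. \<bar>total (cfg \<omega>)\<bar>)" by (rule deg_integrable, (rule deg_intros)+, simp)
  have "expectation (\<lambda>\<omega>. \<bar>ratio \<omega>\<bar>) \<le> expectation (\<lambda>\<omega>. 2 * \<bar>total (cfg \<omega>)\<bar>)"
    using i by (intro integral_mono abs_ratio_le integrable_mult_right deg_integrable[OF deg_abs[OF deg_ratio]]) auto
  also have "\<dots> \<le> 2" using expectation_abs_total by simp
  finally show ?thesis .
qed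

section \<open>Concentration of the ratio\<close>

text \<open>Let \<open>q\<close> be the supremum of the concentration probabilities of radius \<open>al\<close>. Stein's identity for a tent of width \<open>al\<close>
  bounds each of them by \<open>O(al + b)\<close> plus a remainder that \<open>kern_sum_expectation\<close> bounds by \<open>O(q * b / al + b)\<close>. The width
  \<open>al = 3072 * b\<close> makes the coefficient of \<open>q\<close>, which is \<open>2 * 2 * 384 * b / al\<close>, equal to \<open>1 / 2\<close>, and the inequality can be solved for \<open>q\<close>.\<close>

lemma concentration: "prob {\<omega>\<in>space M. \<bar>ratio \<omega> - e\<bar> \<le> 3072 * b} \<le> 60000 * b"
proof -
  define al where "al = 3072 * b"
  have al: "0 < al" "al \<le> 1" using b_pos b_small by (auto simp: al_def)
  define Q where "Q e = prob {\<omega>\<in>space M. \<bar>ratio \<omega> - e\<bar> \<le> al}" for e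
  define q where "q = (SUP e. Q e)"
  have bdd: "bdd_above (range Q)" by (rule bdd_aboveI[of _ 1]) (auto simp: Q_def)
  have Qq: "Q e \<le> q" for e unfolding q_def by (rule cSUP_upper[OF UNIV_I bdd])
  have q0: "0 \<le> q" using Qq[of 0] measure_nonneg order_trans unfolding Q_def by blast
  have step: "Q e \<le> 8 * al + 2272 * b + q / 2" for e
  proof -
    have tm [measurable]: "tent al e \<in> borel_measurable borel" unfolding tent_def by measurable
    have tb: "\<bar>tent al e x\<bar> \<le> 1" for x using tent_bounds[OF al(1), of e x] by simp
    have Fb: "\<bar>tent_int al e x\<bar> \<le> 2 * al" for x using tent_int_bounds[OF al(1), of e x] by simp
    have tb2: "\<bar>tent al e x\<bar> \<le> 2" "\<bar>tent_int al e x\<bar> \<le> 2" for x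
      using tb[of x] Fb[of x] al by auto
    let ?K = "\<lambda>i \<omega>. kern al (2 * out_abs (cfg \<omega>) i) \<bar>ratio \<omega> - e\<bar>"
    have rem: "\<bar>tent_int al e (ratio \<omega> - scale \<omega> * nbhd i \<omega>) - tent_int al e (ratio \<omega>) + scale \<omega> * nbhd i \<omega> * tent al e (ratio \<omega>)\<bar> \<le> ?K i \<omega>" for i \<omega>
    proof -
      have "\<bar>tent_int al e (ratio \<omega> + - (scale \<omega> * nbhd i \<omega>)) - tent_int al e (ratio \<omega>) - - (scale \<omega> * nbhd i \<omega>) * tent al e (ratio \<omega>)\<bar>
         \<le> kern al \<bar>- (scale \<omega> * nbhd i \<omega>)\<bar> \<bar>ratio \<omega> - e\<bar>" by (rule tent_remainder[OF al(1)])
      also have "\<dots> \<le> ?K i \<omega>" unfolding abs_minus_cancel by (intro kern_mono al abs_scale_nbhd_le) simp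
      finally show ?thesis by simp
    qed
    have it: "integrable M (\<lambda>\<omega>. tent al e (ratio \<omega>))"
      by (rule deg_integrable[OF deg_bounded[of _ 1]]) (use tb in auto)
    have "Q e = expectation (\<lambda>\<omega>. indicator {\<omega>\<in>space M. \<bar>ratio \<omega> - e\<bar> \<le> al} \<omega>)" unfolding Q_def by (simp add: Int_absorb2)
    also have "\<dots> \<le> expectation (\<lambda>\<omega>. 2 * tent al e (ratio \<omega>))"
    proof (rule integral_mono)
      show "integrable M (indicator {\<omega>\<in>space M. \<bar>ratio \<omega> - e\<bar> \<le> al} :: 'a \<Rightarrow> real)"
        by (intro integrable_real_indicator) (auto simp: less_top[symmetric])
      show "indicator {\<omega>\<in>space M. \<bar>ratio \<omega> - e\<bar> \<le> al} \<omega> \<le> 2 * tent al e (ratio \<omega>)" for \<omega>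
        using tent_bounds(1)[OF al(1), of e "ratio \<omega>"] tent_bounds(3)[OF al(1), of "ratio \<omega>" e]
        by (auto simp: indicator_def)
    qed (use it in simp)
    finally have 1: "Q e \<le> 2 * expectation (\<lambda>\<omega>. tent al e (ratio \<omega>))" by simp
    have "\<bar>expectation (\<lambda>\<omega>. ratio \<omega> * tent_int al e (ratio \<omega>)) - expectation (\<lambda>\<omega>. tent al e (ratio \<omega>))\<bar>
       \<le> 544 * 2 * b + 2 * expectation (\<lambda>\<omega>. \<Sum>i\<in>{1..n}. \<bar>X i \<omega>\<bar> * ?K i \<omega>)"
      by (rule stein_identity[OF tent_int_deriv[OF al(1)] tm tb2(2) tb2(1) rem kern_integrable[OF al(1)]])
    then have 2: "expectation (\<lambda>\<omega>. tent al e (ratio \<omega>)) \<le> \<bar>expectation (\<lambda>\<omega>. ratio \<omega> * tent_int al e (ratio \<omega>))\<bar> + 1088 * b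
        + 2 * expectation (\<lambda>\<omega>. \<Sum>i\<in>{1..n}. \<bar>X i \<omega>\<bar> * ?K i \<omega>)" by linarith
    have 3: "expectation (\<lambda>\<omega>. \<Sum>i\<in>{1..n}. \<bar>X i \<omega>\<bar> * ?K i \<omega>) \<le> 384 * q * b / al + 24 * b"
      by (rule kern_sum_expectation[OF al]) (use Qq in \<open>simp add: Q_def\<close>)
    have "384 * q * b / al = q / 8" using b_pos by (simp add: al_def)
    with 3 have 3: "expectation (\<lambda>\<omega>. \<Sum>i\<in>{1..n}. \<bar>X i \<omega>\<bar> * ?K i \<omega>) \<le> q / 8 + 24 * b" by simp
    have Fm [measurable]: "tent_int al e \<in> borel_measurable borel" unfolding tent_int_def by measurable
    have ir: "integrable M (\<lambda>\<omega>. \<bar>ratio \<omega>\<bar>)" by (rule deg_integrable[OF deg_abs[OF deg_ratio]]) simp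
    have "\<bar>expectation (\<lambda>\<omega>. ratio \<omega> * tent_int al e (ratio \<omega>))\<bar> \<le> expectation (\<lambda>\<omega>. \<bar>ratio \<omega> * tent_int al e (ratio \<omega>)\<bar>)"
      by (rule integral_abs_bound)
    also have "\<dots> \<le> expectation (\<lambda>\<omega>. 2 * al * \<bar>ratio \<omega>\<bar>)"
    proof (rule integral_mono)
      show "integrable M (\<lambda>\<omega>. \<bar>ratio \<omega> * tent_int al e (ratio \<omega>)\<bar>)"
        by (rule deg_integrable[OF deg_abs[OF deg_mult[OF deg_ratio deg_bounded[OF _ tb2(2)]]]]) auto
      show "integrable M (\<lambda>\<omega>. 2 * al * \<bar>ratio \<omega>\<bar>)" using ir by simp
      show "\<bar>ratio \<omega> * tent_int al e (ratio \<omega>)\<bar> \<le> 2 * al * \<bar>ratio \<omega>\<bar>" for \<omega>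
        unfolding abs_mult using Fb by (subst mult.commute, intro mult_right_mono) auto
    qed
    also have "\<dots> = 2 * al * expectation (\<lambda>\<omega>. \<bar>ratio \<omega>\<bar>)" by simp
    also have "\<dots> \<le> 2 * al * 2" using al by (intro mult_left_mono expectation_abs_ratio) auto
    finally have 4: "\<bar>expectation (\<lambda>\<omega>. ratio \<omega> * tent_int al e (ratio \<omega>))\<bar> \<le> 4 * al" by simp
    show ?thesis using 1 2 3 4 by linarith
  qed
  have "q \<le> 8 * al + 2272 * b + q / 2" unfolding q_def[of] by (rule cSUP_least) (use step q_def in auto)
  then have "q \<le> 60000 * b" using b_pos by (simp add: al_def)
  then show ?thesis using Qq[of e] by (simp add: Q_def al_def)
qed

end

section \<open>The Kolmogorov distance\<close>

lemma normal_cdf_shift: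
  assumes al: "0 < al"
  shows "cdf std_normal_distribution (z + al) \<le> cdf std_normal_distribution z + al"
proof -
  interpret N: real_distribution std_normal_distribution by (rule real_dist_normal_dist)
  have "emeasure std_normal_distribution {z<..z + al} = (\<integral>\<^sup>+x. ennreal (std_normal_density x) * indicator {z<..z + al} x \<partial>lborel)"
    by (rule emeasure_density) auto
  also have "\<dots> \<le> (\<integral>\<^sup>+x. indicator {z<..z + al} x \<partial>lborel)"
  proof (rule nn_integral_mono)
    fix x :: real
    have "sqrt (2 * pi) \<ge> 1" using pi_gt3 by (intro real_le_rsqrt) auto
    then have "std_normal_density x \<le> 1 * 1"
      unfolding std_normal_density_def by (intro mult_mono) auto
    then show "ennreal (std_normal_density x) * indicator {z<..z + al} x \<le> indicator {z<..z + al} x"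
      by (auto simp: indicator_def)
  qed
  also have "\<dots> = ennreal al" using al by simp
  finally have "measure std_normal_distribution {z<..z + al} \<le> al"
    using al by (simp add: N.emeasure_eq_measure)
  moreover have "cdf std_normal_distribution (z + al) - cdf std_normal_distribution z = measure std_normal_distribution {z<..z + al}"
    using al by (intro N.cdf_diff_eq) auto
  ultimately show ?thesis by linarith
qed

lemma normal_ramp_integral:
  assumes al: "0 < al"
  shows "cdf std_normal_distribution z \<le> (\<integral>x. ramp al z x * std_normal_density x \<partial>lborel)"
    and "(\<integral>x. ramp al z x * std_normal_density x \<partial>lborel) \<le> cdf std_normal_distribution z + al"
proof -
  interpret N: real_distribution std_normal_distribution by (rule real_dist_normal_dist)
  have rm [measurable]: "ramp al z \<in> borel_measurable borel" unfolding ramp_def by measurable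
  have eq: "(\<integral>x. ramp al z x * std_normal_density x \<partial>lborel) = (\<integral>x. ramp al z x \<partial>std_normal_distribution)"
    by (subst integral_density) (auto simp: mult.commute)
  have ir: "integrable std_normal_distribution (ramp al z)"
    by (rule N.integrable_const_bound[of _ 1]) (use ramp_bounds in \<open>auto\<close>)
  have ind: "integrable std_normal_distribution (indicator {..y} :: real \<Rightarrow> real)" for y
    by (intro integrable_real_indicator) (auto simp: N.emeasure_eq_measure)
  have cdf: "(\<integral>x. indicator {..y} x \<partial>std_normal_distribution) = cdf std_normal_distribution y" for y
    by (simp add: cdf_def)
  have "cdf std_normal_distribution z \<le> (\<integral>x. ramp al z x \<partial>std_normal_distribution)"
    unfolding cdf[symmetric] using ramp_bounds ramp_eq_1[OF al]
    by (intro integral_mono ir ind) (auto simp: indicator_def)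
  then show "cdf std_normal_distribution z \<le> (\<integral>x. ramp al z x * std_normal_density x \<partial>lborel)" by (simp add: eq)
  have "(\<integral>x. ramp al z x \<partial>std_normal_distribution) \<le> cdf std_normal_distribution (z + al)"
    unfolding cdf[symmetric] using ramp_bounds ramp_eq_0[OF al]
    by (intro integral_mono ir ind) (auto simp: indicator_def not_le)
  also have "\<dots> \<le> cdf std_normal_distribution z + al" by (rule normal_cdf_shift[OF al])
  finally show "(\<integral>x. ramp al z x * std_normal_density x \<partial>lborel) \<le> cdf std_normal_distribution z + al" by (simp add: eq)
qed

context normalized_field
begin

text \<open>Stein's identity for the solution of the Stein equation of a ramp. Concentration at the same scale \<open>3072 * b\<close> now bounds the kernel part
  of the remainder by a multiple of \<open>b\<close>.\<close>

lemma ramp_expectation: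
  "\<bar>expectation (\<lambda>\<omega>. ramp (3072 * b) z (ratio \<omega>)) - (\<integral>x. ramp (3072 * b) z x * std_normal_density x \<partial>lborel)\<bar> \<le> 20000 * b"
proof -
  define al where "al = 3072 * b"
  have al: "0 < al" "al \<le> 1" using b_pos b_small by (auto simp: al_def)
  obtain f f' c where f: "\<And>w. (f has_real_derivative f' w) (at w)"
    "\<And>w. f' w = w * f w + ramp al z w - c"
    "\<And>w. \<bar>f w\<bar> \<le> 7" "\<And>w. \<bar>f' w\<bar> \<le> 7" "c = (\<integral>x. ramp al z x * std_normal_density x \<partial>lborel)"
    "\<And>u v. \<bar>f (u + v) - f u - v * f' u\<bar> \<le> kern al \<bar>v\<bar> \<bar>u - z\<bar> + 7 * (v\<^sup>2 * (1 + \<bar>u\<bar>))"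
    by (rule stein_ramp[OF al(1), of z]) blast
  have rm [measurable]: "ramp al z \<in> borel_measurable borel" unfolding ramp_def by measurable
  have "continuous_on UNIV f" using f(1) by (intro DERIV_continuous_on) auto
  then have fm [measurable]: "f \<in> borel_measurable borel" by (rule borel_measurable_continuous_onI)
  have f'm: "f' \<in> borel_measurable borel" unfolding f(2)[abs_def] by measurable
  let ?K = "\<lambda>i \<omega>. kern al (2 * out_abs (cfg \<omega>) i) \<bar>ratio \<omega> - z\<bar>"
  let ?S = "\<lambda>i \<omega>. (out_abs (cfg \<omega>) i)\<^sup>2 * (1 + 2 * \<bar>total (cfg \<omega>)\<bar>)"
  have rem: "\<bar>f (ratio \<omega> - scale \<omega> * nbhd i \<omega>) - f (ratio \<omega>) + scale \<omega> * nbhd i \<omega> * f' (ratio \<omega>)\<bar> \<le> ?K i \<omega> + 28 * ?S i \<omega>" for i \<omega>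
  proof -
    let ?v = "scale \<omega> * nbhd i \<omega>"
    have "\<bar>f (ratio \<omega> + - ?v) - f (ratio \<omega>) - - ?v * f' (ratio \<omega>)\<bar>
       \<le> kern al \<bar>- ?v\<bar> \<bar>ratio \<omega> - z\<bar> + 7 * ((- ?v)\<^sup>2 * (1 + \<bar>ratio \<omega>\<bar>))" by (rule f(6))
    also have "\<dots> \<le> ?K i \<omega> + 7 * (4 * (out_abs (cfg \<omega>) i)\<^sup>2 * (1 + 2 * \<bar>total (cfg \<omega>)\<bar>))"
    proof (intro add_mono mult_left_mono mult_mono)
      show "kern al \<bar>- ?v\<bar> \<bar>ratio \<omega> - z\<bar> \<le> ?K i \<omega>"
        unfolding abs_minus_cancel by (intro kern_mono al abs_scale_nbhd_le) simp
      have "\<bar>?v\<bar>\<^sup>2 \<le> (2 * out_abs (cfg \<omega>) i)\<^sup>2" by (intro power_mono abs_scale_nbhd_le) simp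
      then show "(- ?v)\<^sup>2 \<le> 4 * (out_abs (cfg \<omega>) i)\<^sup>2" by (simp add: power_mult_distrib)
    qed (use abs_ratio_le in auto)
    finally show ?thesis by simp
  qed
  have iS: "integrable M (\<lambda>\<omega>. \<Sum>i\<in>{1..n}. \<bar>X i \<omega>\<bar> * ?S i \<omega>)"
    by (rule deg_integrable, (rule deg_intros | assumption)+, simp)
  have iK: "integrable M (\<lambda>\<omega>. \<Sum>i\<in>{1..n}. \<bar>X i \<omega>\<bar> * ?K i \<omega>)" by (rule kern_integrable[OF al(1)])
  have split: "(\<Sum>i\<in>{1..n}. \<bar>X i \<omega>\<bar> * (?K i \<omega> + 28 * ?S i \<omega>)) = (\<Sum>i\<in>{1..n}. \<bar>X i \<omega>\<bar> * ?K i \<omega>) + 28 * (\<Sum>i\<in>{1..n}. \<bar>X i \<omega>\<bar> * ?S i \<omega>)" for \<omega>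
    unfolding sum_distrib_left sum.distrib[symmetric] by (intro sum.cong refl) (simp add: algebra_simps)
  have iR: "integrable M (\<lambda>\<omega>. \<Sum>i\<in>{1..n}. \<bar>X i \<omega>\<bar> * (?K i \<omega> + 28 * ?S i \<omega>))"
    unfolding split by (intro Bochner_Integration.integrable_add integrable_mult_right iK iS)
  have ES: "expectation (\<lambda>\<omega>. \<Sum>i\<in>{1..n}. \<bar>X i \<omega>\<bar> * ?S i \<omega>) \<le> 7 * b"
  proof -
    have i: "integrable M (\<lambda>\<omega>. cube_sum (cfg \<omega>))" "integrable M (\<lambda>\<omega>. cube_sum (cfg \<omega>) * \<bar>total (cfg \<omega>)\<bar>)"
      by (rule deg_integrable, (rule deg_intros)+, simp)+
    have "expectation (\<lambda>\<omega>. \<Sum>i\<in>{1..n}. \<bar>X i \<omega>\<bar> * ?S i \<omega>)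
      \<le> expectation (\<lambda>\<omega>. k\<^sup>2 * cube_sum (cfg \<omega>) + 2 * (k\<^sup>2 * (cube_sum (cfg \<omega>) * \<bar>total (cfg \<omega>)\<bar>)))"
    proof (rule integral_mono[OF iS])
      show "integrable M (\<lambda>\<omega>. k\<^sup>2 * cube_sum (cfg \<omega>) + 2 * (k\<^sup>2 * (cube_sum (cfg \<omega>) * \<bar>total (cfg \<omega>)\<bar>)))"
        by (intro Bochner_Integration.integrable_add integrable_mult_right i)
      fix \<omega>
      have "(\<Sum>i\<in>{1..n}. \<bar>X i \<omega>\<bar> * ?S i \<omega>) = (\<Sum>i\<in>{1..n}. \<bar>X i \<omega>\<bar> * (out_abs (cfg \<omega>) i)\<^sup>2) * (1 + 2 * \<bar>total (cfg \<omega>)\<bar>)"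
        unfolding sum_distrib_right by (simp only: mult.assoc)
      also have "\<dots> \<le> k\<^sup>2 * cube_sum (cfg \<omega>) * (1 + 2 * \<bar>total (cfg \<omega>)\<bar>)"
        by (intro mult_right_mono sum_abs_out_square) auto
      also have "\<dots> = k\<^sup>2 * cube_sum (cfg \<omega>) + 2 * (k\<^sup>2 * (cube_sum (cfg \<omega>) * \<bar>total (cfg \<omega>)\<bar>))"
        by (simp add: algebra_simps)
      finally show "(\<Sum>i\<in>{1..n}. \<bar>X i \<omega>\<bar> * ?S i \<omega>) \<le> k\<^sup>2 * cube_sum (cfg \<omega>) + 2 * (k\<^sup>2 * (cube_sum (cfg \<omega>) * \<bar>total (cfg \<omega>)\<bar>))" .
    qed
    also have "\<dots> = k\<^sup>2 * expectation (\<lambda>\<omega>. cube_sum (cfg \<omega>)) + 2 * (k\<^sup>2 * expectation (\<lambda>\<omega>. cube_sum (cfg \<omega>) * \<bar>total (cfg \<omega>)\<bar>))"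
      by (simp only: Bochner_Integration.integral_add Bochner_Integration.integrable_add integral_mult_right_zero integrable_mult_right i)
    also have "\<dots> \<le> b + 2 * (3 * b)" by (intro add_mono mult_left_mono cube_le expectation_cube_total) auto
    finally show ?thesis by simp
  qed
  have EK: "expectation (\<lambda>\<omega>. \<Sum>i\<in>{1..n}. \<bar>X i \<omega>\<bar> * ?K i \<omega>) \<le> 7524 * b"
  proof -
    have "expectation (\<lambda>\<omega>. \<Sum>i\<in>{1..n}. \<bar>X i \<omega>\<bar> * ?K i \<omega>) \<le> 384 * (60000 * b) * b / al + 24 * b"
      by (rule kern_sum_expectation[OF al]) (use concentration in \<open>simp add: al_def\<close>)
    also have "384 * (60000 * b) * b / al = 7500 * b" using b_pos by (simp add: al_def)
    finally show ?thesis by simp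
  qed
  have st: "\<bar>expectation (\<lambda>\<omega>. ratio \<omega> * f (ratio \<omega>)) - expectation (\<lambda>\<omega>. f' (ratio \<omega>))\<bar>
      \<le> 544 * 7 * b + 2 * expectation (\<lambda>\<omega>. \<Sum>i\<in>{1..n}. \<bar>X i \<omega>\<bar> * (?K i \<omega> + 28 * ?S i \<omega>))"
    by (rule stein_identity[OF f(1) f'm f(3) f(4) rem iR])
  have "expectation (\<lambda>\<omega>. \<Sum>i\<in>{1..n}. \<bar>X i \<omega>\<bar> * (?K i \<omega> + 28 * ?S i \<omega>))
     = expectation (\<lambda>\<omega>. \<Sum>i\<in>{1..n}. \<bar>X i \<omega>\<bar> * ?K i \<omega>) + 28 * expectation (\<lambda>\<omega>. \<Sum>i\<in>{1..n}. \<bar>X i \<omega>\<bar> * ?S i \<omega>)"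
    unfolding split Bochner_Integration.integral_add[OF iK integrable_mult_right[OF iS]] integral_mult_right_zero ..
  with st ES EK have st2: "\<bar>expectation (\<lambda>\<omega>. ratio \<omega> * f (ratio \<omega>)) - expectation (\<lambda>\<omega>. f' (ratio \<omega>))\<bar> \<le> 20000 * b"
    using b_pos by linarith
  have i1: "integrable M (\<lambda>\<omega>. ratio \<omega> * f (ratio \<omega>))"
    by (rule deg_integrable[OF deg_mult[OF deg_ratio deg_bounded[OF _ f(3)]]]) auto
  have i2: "integrable M (\<lambda>\<omega>. ramp al z (ratio \<omega>))"
    by (rule deg_integrable[OF deg_bounded[of _ 1]]) (use ramp_bounds in auto)
  have "expectation (\<lambda>\<omega>. f' (ratio \<omega>)) = expectation (\<lambda>\<omega>. ratio \<omega> * f (ratio \<omega>)) + expectation (\<lambda>\<omega>. ramp al z (ratio \<omega>)) - c"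
    unfolding f(2) using i1 i2 by (simp add: prob_space)
  then show ?thesis using st2 unfolding f(5) al_def by linarith
qed

lemma kolmogorov_ratio: "\<bar>prob {\<omega>\<in>space M. ratio \<omega> \<le> z} - cdf std_normal_distribution z\<bar> \<le> 23072 * b"
proof -
  define al where "al = 3072 * b"
  have al: "0 < al" using b_pos by (auto simp: al_def)
  have rm [measurable]: "ramp al y \<in> borel_measurable borel" for y unfolding ramp_def by measurable
  have i2: "integrable M (\<lambda>\<omega>. ramp al y (ratio \<omega>))" for y
    by (rule deg_integrable[OF deg_bounded[of _ 1]]) (use ramp_bounds in auto)
  have iI: "integrable M (indicator {\<omega>\<in>space M. ratio \<omega> \<le> z} :: 'a \<Rightarrow> real)"
    by (intro integrable_real_indicator) (auto simp: less_top[symmetric])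
  have P: "prob {\<omega>\<in>space M. ratio \<omega> \<le> z} = expectation (indicator {\<omega>\<in>space M. ratio \<omega> \<le> z})"
    by (simp add: Int_absorb2)
  have "prob {\<omega>\<in>space M. ratio \<omega> \<le> z} \<le> expectation (\<lambda>\<omega>. ramp al z (ratio \<omega>))"
    unfolding P using ramp_bounds ramp_eq_1[OF al] by (intro integral_mono iI i2) (auto simp: indicator_def)
  moreover have "expectation (\<lambda>\<omega>. ramp al (z - al) (ratio \<omega>)) \<le> prob {\<omega>\<in>space M. ratio \<omega> \<le> z}"
    unfolding P using ramp_bounds ramp_eq_0[OF al, of "z - al"]
    by (intro integral_mono iI i2) (auto simp: indicator_def not_le)
  moreover have "cdf std_normal_distribution z \<le> cdf std_normal_distribution (z - al) + al"
    using normal_ramp_integral[OF al, of "z - al"] normal_cdf_shift[OF al, of "z - al"] by simp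
  ultimately show ?thesis
    using ramp_expectation[of z] ramp_expectation[of "z - al"]
      normal_ramp_integral[OF al, of z] normal_ramp_integral[OF al, of "z - al"]
    unfolding al_def by linarith
qed

lemma kolmogorov_version:
  assumes V [measurable]: "V \<in> borel_measurable M"
    and version: "\<And>\<omega>. \<omega> \<in> space M \<Longrightarrow> 0 < norm_sq (cfg \<omega>) \<Longrightarrow> V \<omega> = total (cfg \<omega>) / sqrt (norm_sq (cfg \<omega>))"
  shows "\<bar>prob {\<omega>\<in>space M. V \<omega> \<le> z} - cdf std_normal_distribution z\<bar> \<le> 24000 * b"
proof -
  have [measurable]: "(\<lambda>\<omega>. norm_sq (cfg \<omega>)) \<in> borel_measurable M" by (rule deg_measurable[OF deg_norm_sq])
  let ?Bad = "{\<omega>\<in>space M. 3 / 4 \<le> \<bar>norm_sq (cfg \<omega>) - 1\<bar>}"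
  have same: "V \<omega> = ratio \<omega>" if "\<omega> \<in> space M" "\<omega> \<notin> ?Bad" for \<omega>
  proof -
    have "\<bar>norm_sq (cfg \<omega>) - 1\<bar> < 3 / 4" using that by simp
    then have r: "1 / 4 < norm_sq (cfg \<omega>)" "norm_sq (cfg \<omega>) < 7 / 4" by linarith+
    then have "quarter_clamp (norm_sq (cfg \<omega>)) = norm_sq (cfg \<omega>)" by (simp add: quarter_clamp_def)
    then show ?thesis using version[OF that(1)] r by (simp add: ratio_def scale_def inv_root_def)
  qed
  have iD: "integrable M (\<lambda>\<omega>. \<bar>norm_sq (cfg \<omega>) - 1\<bar>)" by (rule deg_integrable, (rule deg_intros)+, simp)
  have "prob ?Bad \<le> expectation (\<lambda>\<omega>. \<bar>norm_sq (cfg \<omega>) - 1\<bar>) / (3 / 4)"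
    by (rule integral_Markov_inequality_measure[OF iD]) auto
  also have "\<dots> \<le> 4 * b" using norm_sq_close_to_1 by simp
  finally have bad: "prob ?Bad \<le> 4 * b" .
  have "prob {\<omega>\<in>space M. V \<omega> \<le> z} \<le> prob ({\<omega>\<in>space M. ratio \<omega> \<le> z} \<union> ?Bad)"
    using same by (intro finite_measure_mono) auto
  also have "\<dots> \<le> prob {\<omega>\<in>space M. ratio \<omega> \<le> z} + prob ?Bad" by (intro measure_Un_le) auto
  finally have 1: "prob {\<omega>\<in>space M. V \<omega> \<le> z} \<le> prob {\<omega>\<in>space M. ratio \<omega> \<le> z} + prob ?Bad" .
  have "prob {\<omega>\<in>space M. ratio \<omega> \<le> z} \<le> prob ({\<omega>\<in>space M. V \<omega> \<le> z} \<union> ?Bad)"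
    using same by (intro finite_measure_mono) auto
  also have "\<dots> \<le> prob {\<omega>\<in>space M. V \<omega> \<le> z} + prob ?Bad" by (intro measure_Un_le) auto
  finally show ?thesis using 1 bad kolmogorov_ratio[of z] b_pos by linarith
qed

end

section \<open>Rescaling, and the bound in extended reals\<close>

context local_dependence
begin

abbreviation K :: real where "K \<equiv> real (kappa n A A2)"
abbreviation \<tau> :: real where "\<tau> \<equiv> real (tau n A A2)"

lemma X_meas [measurable]: "i \<in> {1..n} \<Longrightarrow> X i \<in> borel_measurable M"
  using X_random_variable by simp

lemma finite_sigma: "finite (SIGMA i:{1..n}. A i)"
  using A_subset by (intro finite_SigmaI) (auto intro: finite_subset simp del: One_nat_def)

lemma card_N_le: "i \<in> {1..n} \<Longrightarrow> card (N_set n A i) \<le> kappa n A A2"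
  unfolding kappa_def by (intro max.coboundedI1 cSUP_upper) auto

lemma card_A2_le: "i \<in> {1..n} \<Longrightarrow> j \<in> A i \<Longrightarrow> card (A2 i j) \<le> kappa n A A2"
proof -
  assume "i \<in> {1..n}" "j \<in> A i"
  then have "(i, j) \<in> (SIGMA i:{1..n}. A i)" by auto
  from cSUP_upper[OF this, of "\<lambda>(i, j). card (A2 i j)"] finite_sigma
  have "card (A2 i j) \<le> (SUP (i, j)\<in>(SIGMA i:{1..n}. A i). card (A2 i j))" by simp
  then show ?thesis unfolding kappa_def by (rule max.coboundedI2)
qed

lemma card_A_le: assumes i: "i \<in> {1..n}" shows "card (A i) \<le> kappa n A A2"
proof (cases "A i = {}")
  case False
  then obtain j where j: "j \<in> A i" by auto
  have "card (A i) \<le> card (A2 i j)"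
    using A2_supset[OF i j] A2_subset[OF i j] by (intro card_mono) (auto intro: finite_subset)
  then show ?thesis using card_A2_le[OF i j] by linarith
qed simp

lemma card_D_le: "i \<in> {1..n} \<Longrightarrow> card (D_set n A A2 i) \<le> tau n A A2"
  unfolding tau_def by (intro cSUP_upper) auto

text \<open>If \<open>A i\<close> is empty, then \<open>X i\<close> is independent of itself, so the event \<open>X i > 0\<close> has probability \<open>0\<close> or \<open>1\<close>. As the mean is \<open>0\<close>, the
  variable vanishes.\<close>

lemma AE_zero_if_no_neighbours:
  assumes i: "i \<in> {1..n}" and "A i = {}"
  shows "AE \<omega> in M. X i \<omega> = 0"
proof -
  let ?f = "\<lambda>x::real. indicator {0<..} x :: real"
  have "indep_var borel ((\<lambda>v. ?f (v i)) \<circ> (\<lambda>\<omega>. \<lambda>k\<in>{i}. X k \<omega>)) borel ((\<lambda>v. ?f (v i)) \<circ> (\<lambda>\<omega>. \<lambda>k\<in>{1..n} - A i. X k \<omega>))"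
    by (rule indep_var_compose[OF A_indep[OF i]])
      (use i assms(2) in \<open>auto intro!: measurable_compose[OF measurable_component_singleton] borel_measurable_indicator simp del: One_nat_def\<close>)
  then have ind: "indep_var borel (\<lambda>\<omega>. ?f (X i \<omega>)) borel (\<lambda>\<omega>. ?f (X i \<omega>))"
    using i assms(2) by (simp add: comp_def)
  have int: "integrable M (\<lambda>\<omega>. ?f (X i \<omega>))"
    by (rule integrable_const_bound[of _ 1]) (use i in auto)
  let ?p = "expectation (\<lambda>\<omega>. ?f (X i \<omega>))"
  have "expectation (\<lambda>\<omega>. ?f (X i \<omega>) * ?f (X i \<omega>)) = ?p * ?p"
    by (rule indep_var_lebesgue_integral[OF ind int int])
  moreover have "?f (X i \<omega>) * ?f (X i \<omega>) = ?f (X i \<omega>)" for \<omega> by (simp add: indicator_def)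
  ultimately have "?p * (1 - ?p) = 0" by (simp add: algebra_simps)
  then consider "?p = 0" | "expectation (\<lambda>\<omega>. 1 - ?f (X i \<omega>)) = 0" using int by (auto simp: prob_space)
  then show ?thesis
  proof cases
    case 1
    then have "AE \<omega> in M. ?f (X i \<omega>) = 0" using integral_nonneg_eq_0_iff_AE[OF int] by auto
    then have neg: "AE \<omega> in M. 0 \<le> - X i \<omega>" by eventually_elim (auto simp: indicator_def split: if_splits)
    have "expectation (\<lambda>\<omega>. - X i \<omega>) = 0" using X_centered[OF i] by simp
    then have "AE \<omega> in M. - X i \<omega> = 0"
      using integral_nonneg_eq_0_iff_AE[of M "\<lambda>\<omega>. - X i \<omega>"] neg X_integrable[OF i] by auto
    then show ?thesis by eventually_elim auto
  next
    case 2
    then have "AE \<omega> in M. 1 - ?f (X i \<omega>) = 0"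
      using integral_nonneg_eq_0_iff_AE[of M "\<lambda>\<omega>. 1 - ?f (X i \<omega>)"] int by (auto simp: indicator_def)
    then have "AE \<omega> in M. 0 \<le> X i \<omega>" by eventually_elim (auto simp: indicator_def split: if_splits)
    then show ?thesis
      using integral_nonneg_eq_0_iff_AE[of M "X i"] X_centered[OF i] X_integrable[OF i] by auto
  qed
qed

lemma sum_X_centered: "expectation (sum_X n X) = 0"
  unfolding sum_X_def[abs_def] by (subst Bochner_Integration.integral_sum) (auto intro!: X_integrable sum.neutral X_centered simp del: One_nat_def)

lemma variance_S_eq: "variance_S M n X = expectation (\<lambda>\<omega>. (sum_X n X \<omega>)\<^sup>2)"
  unfolding variance_S_def using sum_X_centered by simp

lemma kappa_ge_1: "1 \<le> K"
proof (rule ccontr)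
  assume "\<not> 1 \<le> K"
  then have 0: "kappa n A A2 = 0" by simp
  have "AE \<omega> in M. \<forall>i\<in>{1..n}. X i \<omega> = 0"
  proof (rule AE_finite_allI)
    fix i assume i: "i \<in> {1..n}"
    have "finite (A i)" using A_subset[OF i] finite_subset by blast
    then have "A i = {}" using card_A_le[OF i] 0 by simp
    then show "AE \<omega> in M. X i \<omega> = 0" by (rule AE_zero_if_no_neighbours[OF i])
  qed simp
  then have "AE \<omega> in M. (sum_X n X \<omega>)\<^sup>2 = 0" by eventually_elim (simp add: sum_X_def)
  then have "expectation (\<lambda>\<omega>. (sum_X n X \<omega>)\<^sup>2) = 0" by (rule integral_eq_zero_AE)
  then show False using variance_pos by (simp add: variance_S_eq)
qed

sublocale dependency_neighbourhoods n A A2 K \<tau>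
  using A_subset A2_subset card_A_le card_N_le card_A2_le card_D_le kappa_ge_1
  by unfold_locales (simp_all del: One_nat_def)

lemma self_normalizer_eq: "self_normalizer n X A \<omega> = sqrt (max (norm_sq (\<lambda>i. X i \<omega>)) 0)"
proof -
  let ?v = "\<lambda>i. X i \<omega>"
  have Y: "(\<Sum>i\<in>{1..n}. nbhd_sum X A i \<omega>) = K * in_weighted ?v"
    unfolding nbhd_sum_def sum_nbhd_swap in_weighted_def lin_def sum_distrib_left
    using k_neq_0 by (intro sum.cong refl) simp
  have "(\<Sum>i\<in>{1..n}. X i \<omega> * nbhd_sum X A i \<omega> - mean_of n X \<omega> * mean_of n (nbhd_sum X A) \<omega>)
     = quad ?v - real n * (mean_of n X \<omega> * mean_of n (nbhd_sum X A) \<omega>)"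
    by (simp add: sum_subtractf quad_def nbhd_sum_def sum_distrib_left)
  also have "real n * (mean_of n X \<omega> * mean_of n (nbhd_sum X A) \<omega>) = mean_term ?v"
    unfolding mean_of_def Y mean_term_def total_def lin_def using n_ge_1 by (simp add: field_simps)
  finally show ?thesis by (simp add: self_normalizer_def norm_sq_def)
qed

definition \<sigma> :: real where "\<sigma> = sd_S M n X"

lemma \<sigma>_pos: "0 < \<sigma>" and \<sigma>_square: "\<sigma>\<^sup>2 = variance_S M n X"
  using variance_pos by (auto simp: \<sigma>_def sd_S_def)

lemma sum_X_scaled: "sum_X n (\<lambda>i \<omega>. X i \<omega> / \<sigma>) \<omega> = sum_X n X \<omega> / \<sigma>"
  by (simp add: sum_X_def sum_divide_distrib)

lemma indep_scaled:
  assumes "indep_var (PiM I (\<lambda>_. borel)) (\<lambda>\<omega>. \<lambda>k\<in>I. X k \<omega>) (PiM J (\<lambda>_. borel)) (\<lambda>\<omega>. \<lambda>k\<in>J. X k \<omega>)"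
  shows "indep_var (PiM I (\<lambda>_. borel)) (\<lambda>\<omega>. \<lambda>k\<in>I. X k \<omega> / \<sigma>) (PiM J (\<lambda>_. borel)) (\<lambda>\<omega>. \<lambda>k\<in>J. X k \<omega> / \<sigma>)"
proof -
  have m: "(\<lambda>v. \<lambda>k\<in>I. v k / \<sigma>) \<in> measurable (PiM I (\<lambda>_. borel)) (PiM I (\<lambda>_. borel))" for I :: "nat set"
    by (intro measurable_restrict borel_measurable_divide measurable_component_singleton) auto
  have "(\<lambda>v. \<lambda>k\<in>I. v k / \<sigma>) \<circ> (\<lambda>\<omega>. \<lambda>k\<in>I. X k \<omega>) = (\<lambda>\<omega>. \<lambda>k\<in>I. X k \<omega> / \<sigma>)" for I
    by (auto simp: fun_eq_iff restrict_def)
  then show ?thesis using indep_var_compose[OF assms m m] by simp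
qed

lemma scaled_local_dependence: "local_dependence M n (\<lambda>i \<omega>. X i \<omega> / \<sigma>) A A2"
proof unfold_locales
  have c0: "expectation (\<lambda>\<omega>. sum_X n (\<lambda>i \<omega>. X i \<omega> / \<sigma>) \<omega>) = 0"
    unfolding sum_X_scaled using sum_X_centered by simp
  have "variance_S M n (\<lambda>i \<omega>. X i \<omega> / \<sigma>) = variance_S M n X / \<sigma>\<^sup>2"
    unfolding variance_S_def c0 sum_X_centered unfolding sum_X_scaled by (simp add: power_divide)
  then show "0 < variance_S M n (\<lambda>i \<omega>. X i \<omega> / \<sigma>)" using variance_pos \<sigma>_pos by simp
  show "integrable M (\<lambda>\<omega>. (sum_X n (\<lambda>i \<omega>. X i \<omega> / \<sigma>) \<omega>)\<^sup>2)"
    using variance_finite by (simp add: sum_X_scaled power_divide)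
qed (use n_ge_1 X_integrable X_centered A_subset A2_supset A2_subset A_indep A2_indep in
    \<open>simp_all add: indep_scaled del: One_nat_def\<close>)

lemma scaled_unit_variance:
  assumes "\<And>i. i \<in> {1..n} \<Longrightarrow> integrable M (\<lambda>\<omega>. X i \<omega> ^ 4)"
  shows "unit_variance_field M n (\<lambda>i \<omega>. X i \<omega> / \<sigma>) A A2 K \<tau>"
proof (intro unit_variance_field.intro scaled_local_dependence dependency_neighbourhoods_axioms unit_variance_field_axioms.intro)
  show "expectation (\<lambda>\<omega>. (sum_X n (\<lambda>i \<omega>. X i \<omega> / \<sigma>) \<omega>)\<^sup>2) = 1"
    unfolding sum_X_scaled power_divide using \<sigma>_square variance_pos by (simp add: variance_S_eq)
  show "integrable M (\<lambda>\<omega>. (X i \<omega> / \<sigma>) ^ 4)" if "i \<in> {1..n}" for i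
    using assms[OF that] by (simp add: power_divide)
qed

text \<open>The \<open>L\<^sup>4\<close> norm of \<open>X i\<close> as a real number.\<close>

definition a4 :: "nat \<Rightarrow> real" where "a4 i = (expectation (\<lambda>\<omega>. X i \<omega> ^ 4)) powr (1 / 4)"

lemma a4_fourth: "a4 i ^ 4 = expectation (\<lambda>\<omega>. X i \<omega> ^ 4)"
proof -
  have "0 \<le> expectation (\<lambda>\<omega>. X i \<omega> ^ 4)" by (intro Bochner_Integration.integral_nonneg) simp
  then show ?thesis unfolding a4_def
    by (cases "expectation (\<lambda>\<omega>. X i \<omega> ^ 4) = 0") (auto simp: powr_power)
qed

lemma a4_nonneg: "0 \<le> a4 i" by (simp add: a4_def)

text \<open>Lyapunov's inequality, from \<open>4 * x\<^sup>3 * c \<le> 3 * x\<^sup>4 + c\<^sup>4\<close> with the \<open>L\<^sup>4\<close> norm in the role of \<open>c\<close>.\<close>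

lemma third_moment_le:
  assumes i: "i \<in> {1..n}" and int: "integrable M (\<lambda>\<omega>. X i \<omega> ^ 4)"
  shows "integrable M (\<lambda>\<omega>. \<bar>X i \<omega>\<bar> ^ 3)" "expectation (\<lambda>\<omega>. \<bar>X i \<omega>\<bar> ^ 3) \<le> a4 i ^ 3"
proof -
  have y: "4 * (\<bar>X i \<omega>\<bar> ^ 3 * c) \<le> 3 * X i \<omega> ^ 4 + c ^ 4" if "0 \<le> c" for c \<omega>
    using young_31[of "\<bar>X i \<omega>\<bar>" c] that by simp
  show int3: "integrable M (\<lambda>\<omega>. \<bar>X i \<omega>\<bar> ^ 3)"
  proof (rule Bochner_Integration.integrable_bound)
    show "integrable M (\<lambda>\<omega>. 3 * X i \<omega> ^ 4 + 1)" using int by simp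
    show "(\<lambda>\<omega>. \<bar>X i \<omega>\<bar> ^ 3) \<in> borel_measurable M" using i by measurable
    show "AE \<omega> in M. norm (\<bar>X i \<omega>\<bar> ^ 3) \<le> norm (3 * X i \<omega> ^ 4 + 1)"
    proof (rule AE_I2)
      fix \<omega>
      have "0 \<le> X i \<omega> ^ 4" "0 \<le> \<bar>X i \<omega>\<bar> ^ 3" by simp_all
      moreover have "4 * \<bar>X i \<omega>\<bar> ^ 3 \<le> 3 * X i \<omega> ^ 4 + 1" using y[of 1 \<omega>] by simp
      ultimately have "\<bar>X i \<omega>\<bar> ^ 3 \<le> 3 * X i \<omega> ^ 4 + 1" by linarith
      then show "norm (\<bar>X i \<omega>\<bar> ^ 3) \<le> norm (3 * X i \<omega> ^ 4 + 1)" by simp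
    qed
  qed
  show "expectation (\<lambda>\<omega>. \<bar>X i \<omega>\<bar> ^ 3) \<le> a4 i ^ 3"
  proof (cases "a4 i = 0")
    case True
    then have "expectation (\<lambda>\<omega>. X i \<omega> ^ 4) = 0" using a4_fourth[of i] by simp
    then have "AE \<omega> in M. X i \<omega> ^ 4 = 0" using integral_nonneg_eq_0_iff_AE[OF int] by simp
    then have "AE \<omega> in M. \<bar>X i \<omega>\<bar> ^ 3 = 0" by eventually_elim simp
    then have "expectation (\<lambda>\<omega>. \<bar>X i \<omega>\<bar> ^ 3) = 0" by (rule integral_eq_zero_AE)
    then show ?thesis using a4_nonneg[of i] by simp
  next
    case False
    then have pos: "0 < a4 i" using a4_nonneg[of i] by simp
    have "expectation (\<lambda>\<omega>. 4 * (\<bar>X i \<omega>\<bar> ^ 3 * a4 i)) \<le> expectation (\<lambda>\<omega>. 3 * X i \<omega> ^ 4 + a4 i ^ 4)"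
      using int int3 by (intro integral_mono y a4_nonneg) auto
    also have "\<dots> = 4 * a4 i ^ 4" using int a4_fourth[of i] by (simp add: prob_space)
    finally have "expectation (\<lambda>\<omega>. \<bar>X i \<omega>\<bar> ^ 3) * a4 i \<le> a4 i ^ 3 * a4 i"
      by (simp add: power3_eq_cube power4_eq_xxxx)
    then show ?thesis using pos by (simp add: mult_le_cancel_right)
  qed
qed

definition real_moment_bound :: real where
  "real_moment_bound = K\<^sup>2 / \<sigma> ^ 3 * (\<Sum>i\<in>{1..n}. a4 i ^ 3)
     + sqrt K * (K + sqrt \<tau>) / \<sigma>\<^sup>2 * (\<Sum>i\<in>{1..n}. a4 i ^ 4) powr (1 / 2)"

text \<open>The number \<open>b\<close> has to be positive, so a summand \<open>e / 24000\<close> is added to the moment bound and removed in the limit.\<close>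

lemma kolmogorov_bound:
  assumes int: "\<And>i. i \<in> {1..n} \<Longrightarrow> integrable M (\<lambda>\<omega>. X i \<omega> ^ 4)"
    and W: "is_self_normalized_sum M n X A W"
  shows "\<bar>prob {\<omega>\<in>space M. W \<omega> \<le> z} - cdf std_normal_distribution z\<bar> \<le> 24000 * real_moment_bound"
proof (rule field_le_epsilon)
  fix e :: real assume e: "0 < e"
  let ?x = "\<lambda>i \<omega>. X i \<omega> / \<sigma>"
  interpret N: real_distribution std_normal_distribution by (rule real_dist_normal_dist)
  interpret U: unit_variance_field M n ?x A A2 K \<tau> by (rule scaled_unit_variance[OF int])
  define b1 where "b1 = K\<^sup>2 / \<sigma> ^ 3 * (\<Sum>i\<in>{1..n}. a4 i ^ 3)"
  define b2 where "b2 = sqrt K * (K + sqrt \<tau>) / \<sigma>\<^sup>2 * (\<Sum>i\<in>{1..n}. a4 i ^ 4) powr (1 / 2)"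
  have b1: "0 \<le> b1" unfolding b1_def using \<sigma>_pos a4_nonneg by (intro mult_nonneg_nonneg sum_nonneg) auto
  have b2: "0 \<le> b2" unfolding b2_def using \<sigma>_pos by simp
  define b where "b = b1 + b2 + e / 24000"
  have b: "24000 * real_moment_bound + e = 24000 * b"
    by (simp add: b_def real_moment_bound_def b1_def b2_def)
  have b0: "0 < b" using b1 b2 e by (simp add: b_def)
  show "\<bar>prob {\<omega>\<in>space M. W \<omega> \<le> z} - cdf std_normal_distribution z\<bar> \<le> 24000 * real_moment_bound + e"
  proof (cases "3072 * b \<le> 1")
    case False
    have "0 \<le> cdf std_normal_distribution z" "cdf std_normal_distribution z \<le> 1"
      by (auto simp: cdf_def)
    moreover have "0 \<le> prob {\<omega>\<in>space M. W \<omega> \<le> z}" "prob {\<omega>\<in>space M. W \<omega> \<le> z} \<le> 1" by auto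
    ultimately show ?thesis using False b0 unfolding b by linarith
  next
    case True
    have "normalized_field M n ?x A A2 K \<tau> b"
    proof (intro normalized_field.intro normalized_field_axioms.intro U.unit_variance_field_axioms b0 True)
      have "expectation (\<lambda>\<omega>. cube_sum (\<lambda>i. X i \<omega> / \<sigma>)) = (\<Sum>i\<in>{1..n}. expectation (\<lambda>\<omega>. \<bar>X i \<omega>\<bar> ^ 3)) / \<sigma> ^ 3"
        unfolding cube_sum_def using third_moment_le(1)[OF _ int] \<sigma>_pos
        by (simp add: power_divide Bochner_Integration.integral_sum sum_divide_distrib del: One_nat_def)
      also have "\<dots> \<le> (\<Sum>i\<in>{1..n}. a4 i ^ 3) / \<sigma> ^ 3"
        using \<sigma>_pos by (intro divide_right_mono sum_mono third_moment_le(2) int) auto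
      finally have "K\<^sup>2 * expectation (\<lambda>\<omega>. cube_sum (\<lambda>i. X i \<omega> / \<sigma>)) \<le> K\<^sup>2 * ((\<Sum>i\<in>{1..n}. a4 i ^ 3) / \<sigma> ^ 3)"
        by (intro mult_left_mono) auto
      also have "\<dots> = b1" by (simp add: b1_def)
      finally show "K\<^sup>2 * expectation (\<lambda>\<omega>. cube_sum (\<lambda>i. X i \<omega> / \<sigma>)) \<le> b" using b2 e by (simp add: b_def)
      have S0: "0 \<le> (\<Sum>i\<in>{1..n}. a4 i ^ 4)" by (intro sum_nonneg) auto
      have "expectation (\<lambda>\<omega>. fourth_sum (\<lambda>i. X i \<omega> / \<sigma>)) = (\<Sum>i\<in>{1..n}. a4 i ^ 4) / \<sigma> ^ 4"
        unfolding fourth_sum_def a4_fourth using int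
        by (simp add: power_divide Bochner_Integration.integral_sum sum_divide_distrib del: One_nat_def)
      then have "K * (K\<^sup>2 + \<tau>) * expectation (\<lambda>\<omega>. fourth_sum (\<lambda>i. X i \<omega> / \<sigma>)) = K * (K\<^sup>2 + \<tau>) * ((\<Sum>i\<in>{1..n}. a4 i ^ 4) / \<sigma> ^ 4)"
        by simp
      also have "\<dots> \<le> K * (K + sqrt \<tau>)\<^sup>2 * ((\<Sum>i\<in>{1..n}. a4 i ^ 4) / \<sigma> ^ 4)"
        using S0 \<sigma>_pos by (intro mult_right_mono mult_left_mono) (auto simp: power2_sum)
      also have "\<dots> = b2\<^sup>2"
        using S0 by (simp add: b2_def power_mult_distrib power_divide powr_half_sqrt flip: power_mult)
      also have "\<dots> \<le> b\<^sup>2" using b1 b2 e by (intro power_mono) (auto simp: b_def)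
      finally show "K * (K\<^sup>2 + \<tau>) * expectation (\<lambda>\<omega>. fourth_sum (\<lambda>i. X i \<omega> / \<sigma>)) \<le> b\<^sup>2" .
    qed
    then interpret F: normalized_field M n ?x A A2 K \<tau> b .
    show ?thesis unfolding b
    proof (rule F.kolmogorov_version)
      show "W \<in> borel_measurable M" using W by (simp add: is_self_normalized_sum_def)
      fix \<omega> assume \<omega>: "\<omega> \<in> space M" and pos: "0 < norm_sq (\<lambda>i. X i \<omega> / \<sigma>)"
      have scale: "norm_sq (\<lambda>i. X i \<omega> / \<sigma>) = norm_sq (\<lambda>i. X i \<omega>) / \<sigma>\<^sup>2"
        unfolding norm_sq_def quad_def mean_term_def total_def in_weighted_def lin_def
        by (simp add: sum_divide_distrib[symmetric] diff_divide_distrib power2_eq_square)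
      then have pos': "0 < norm_sq (\<lambda>i. X i \<omega>)" using pos \<sigma>_pos by (simp add: zero_less_divide_iff)
      then have sn: "self_normalizer n X A \<omega> = sqrt (norm_sq (\<lambda>i. X i \<omega>))" by (simp add: self_normalizer_eq)
      then have "W \<omega> = sum_X n X \<omega> / sqrt (norm_sq (\<lambda>i. X i \<omega>))"
        using W \<omega> pos' by (simp add: is_self_normalized_sum_def)
      also have "\<dots> = total (\<lambda>i. X i \<omega> / \<sigma>) / sqrt (norm_sq (\<lambda>i. X i \<omega> / \<sigma>))"
        unfolding scale U.total_eq sum_X_scaled using \<sigma>_pos by (simp add: real_sqrt_divide)
      finally show "W \<omega> = total (\<lambda>i. X i \<omega> / \<sigma>) / sqrt (norm_sq (\<lambda>i. X i \<omega> / \<sigma>))" .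
    qed
  qed
qed

lemma Lp_norm_4_finite:
  assumes "i \<in> {1..n}" "integrable M (\<lambda>\<omega>. X i \<omega> ^ 4)"
  shows "Lp_norm M 4 (X i) = ennreal (a4 i)"
proof -
  have "(\<integral>\<^sup>+\<omega>. ennreal (\<bar>X i \<omega>\<bar> powr 4) \<partial>M) = (\<integral>\<^sup>+\<omega>. ennreal (X i \<omega> ^ 4) \<partial>M)"
    by (intro nn_integral_cong) (simp add: powr_numeral)
  also have "\<dots> = ennreal (expectation (\<lambda>\<omega>. X i \<omega> ^ 4))"
    using assms(2) by (intro nn_integral_eq_integral) auto
  finally show ?thesis
    by (simp add: Lp_norm_def ennreal_powr_def a4_def Bochner_Integration.integral_nonneg)
qed

lemma Lp_norm_4_infinite:
  assumes "i \<in> {1..n}" "\<not> integrable M (\<lambda>\<omega>. X i \<omega> ^ 4)"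
  shows "Lp_norm M 4 (X i) = \<infinity>"
proof -
  have "(\<integral>\<^sup>+\<omega>. ennreal (\<bar>X i \<omega>\<bar> powr 4) \<partial>M) = (\<integral>\<^sup>+\<omega>. ennreal (X i \<omega> ^ 4) \<partial>M)"
    by (intro nn_integral_cong) (simp add: powr_numeral)
  also have "\<dots> = \<infinity>"
  proof (rule ccontr)
    assume "(\<integral>\<^sup>+\<omega>. ennreal (X i \<omega> ^ 4) \<partial>M) \<noteq> \<infinity>"
    then have "integrable M (\<lambda>\<omega>. X i \<omega> ^ 4)"
      using assms(1) by (intro integrableI_nonneg) (auto simp: less_top)
    then show False using assms(2) by simp
  qed
  finally show ?thesis by (simp add: Lp_norm_def ennreal_powr_def)
qed

lemma Lp_norm_2_square:
  assumes i: "i \<in> {1..n}" and int: "integrable M (\<lambda>\<omega>. (X i \<omega>)\<^sup>2)"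
  shows "(Lp_norm M 2 (X i))\<^sup>2 = ennreal (expectation (\<lambda>\<omega>. (X i \<omega>)\<^sup>2))"
proof -
  have 0: "0 \<le> expectation (\<lambda>\<omega>. (X i \<omega>)\<^sup>2)" by (intro Bochner_Integration.integral_nonneg) simp
  have "(\<integral>\<^sup>+\<omega>. ennreal (\<bar>X i \<omega>\<bar> powr 2) \<partial>M) = (\<integral>\<^sup>+\<omega>. ennreal ((X i \<omega>)\<^sup>2) \<partial>M)"
    by (intro nn_integral_cong) (simp add: powr_numeral)
  also have "\<dots> = ennreal (expectation (\<lambda>\<omega>. (X i \<omega>)\<^sup>2))"
    using int by (intro nn_integral_eq_integral) auto
  finally have "Lp_norm M 2 (X i) = ennreal (sqrt (expectation (\<lambda>\<omega>. (X i \<omega>)\<^sup>2)))"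
    using 0 by (simp add: Lp_norm_def ennreal_powr_def powr_half_sqrt)
  then show ?thesis using 0 by (simp add: ennreal_power)
qed

lemma Lp_norm_2_nonzero:
  assumes i: "i \<in> {1..n}" and "\<not> integrable M (\<lambda>\<omega>. X i \<omega> ^ 4)"
  shows "Lp_norm M 2 (X i) \<noteq> 0"
proof
  assume 0: "Lp_norm M 2 (X i) = 0"
  let ?I = "\<integral>\<^sup>+\<omega>. ennreal (\<bar>X i \<omega>\<bar> powr 2) \<partial>M"
  have "?I \<noteq> \<infinity>" "enn2real ?I powr (1 / 2) = 0"
    using 0 by (auto simp: Lp_norm_def ennreal_powr_def split: if_splits)
  then have "?I = 0" by (auto simp: enn2real_eq_0_iff)
  moreover have "(\<lambda>\<omega>. ennreal (\<bar>X i \<omega>\<bar> powr 2)) \<in> borel_measurable M" using i by measurable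
  ultimately have "AE \<omega> in M. ennreal (\<bar>X i \<omega>\<bar> powr 2) = 0" by (simp add: nn_integral_0_iff_AE)
  then have "AE \<omega> in M. X i \<omega> ^ 4 = 0" by eventually_elim (simp add: ennreal_eq_0_iff)
  then have "integrable M (\<lambda>\<omega>. X i \<omega> ^ 4) = integrable M (\<lambda>\<omega>. 0 :: real)"
    using i by (intro integrable_cong_AE) auto
  then show False using assms(2) by simp
qed

text \<open>If some fourth moment is infinite, then the moment bound is infinite and the factors in front of it are not \<open>0\<close>: by \<open>kappa_ge_1\<close>, and
  because a variable with infinite fourth moment has a nonzero \<open>L\<^sup>2\<close> norm.\<close>

lemma berry_esseen_bound:
  assumes W: "is_self_normalized_sum M n X A W"
  shows "ennreal \<bar>prob {\<omega>\<in>space M. W \<omega> \<le> z} - cdf std_normal_distribution z\<bar>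
    \<le> ennreal 24000 * lambda_ratio M n X A A2 * moment_bound M n X A A2"
proof (cases "\<forall>i\<in>{1..n}. integrable M (\<lambda>\<omega>. X i \<omega> ^ 4)")
  case True
  then have int: "integrable M (\<lambda>\<omega>. X i \<omega> ^ 4)" if "i \<in> {1..n}" for i using that by blast
  interpret U: unit_variance_field M n "\<lambda>i \<omega>. X i \<omega> / \<sigma>" A A2 K \<tau> by (rule scaled_unit_variance[OF int])
  have int2: "integrable M (\<lambda>\<omega>. (X i \<omega>)\<^sup>2)" if "i \<in> {1..n}" for i
  proof -
    have "integrable M (\<lambda>\<omega>. (X i \<omega> / \<sigma>)\<^sup>2)"
      using U.deg_integrable[OF U.deg_power[OF U.deg_X[OF that], of 2]] by simp
    then have "integrable M (\<lambda>\<omega>. \<sigma>\<^sup>2 * (X i \<omega> / \<sigma>)\<^sup>2)" by (rule integrable_mult_right)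
    then show ?thesis using \<sigma>_pos by (simp add: power_divide)
  qed
  have "lambda_ratio M n X A A2 = ennreal (K / \<sigma>\<^sup>2) * (\<Sum>i\<in>{1..n}. ennreal (expectation (\<lambda>\<omega>. (X i \<omega>)\<^sup>2)))"
    unfolding lambda_ratio_def \<sigma>_def[symmetric]
    by (intro arg_cong2[where f="(*)"] refl sum.cong Lp_norm_2_square int2)
  also have "\<dots> = ennreal (K / \<sigma>\<^sup>2) * ennreal (\<Sum>i\<in>{1..n}. expectation (\<lambda>\<omega>. (X i \<omega>)\<^sup>2))"
    by (subst sum_ennreal) (auto intro: Bochner_Integration.integral_nonneg)
  also have "\<dots> = ennreal (K / \<sigma>\<^sup>2 * (\<Sum>i\<in>{1..n}. expectation (\<lambda>\<omega>. (X i \<omega>)\<^sup>2)))"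
    by (rule ennreal_mult[symmetric]) (auto intro!: sum_nonneg Bochner_Integration.integral_nonneg)
  also have "K / \<sigma>\<^sup>2 * (\<Sum>i\<in>{1..n}. expectation (\<lambda>\<omega>. (X i \<omega>)\<^sup>2)) = U.lam"
    by (simp add: U.lam_def power_divide sum_divide_distrib[symmetric])
  finally have lam: "lambda_ratio M n X A A2 = ennreal U.lam" .
  have S3: "(\<Sum>i\<in>{1..n}. (Lp_norm M 4 (X i)) ^ 3) = ennreal (\<Sum>i\<in>{1..n}. a4 i ^ 3)"
    using Lp_norm_4_finite[OF _ int] a4_nonneg
    by (subst sum_ennreal[symmetric]) (auto simp: ennreal_power simp del: One_nat_def)
  have S4: "(\<Sum>i\<in>{1..n}. (Lp_norm M 4 (X i)) ^ 4) = ennreal (\<Sum>i\<in>{1..n}. a4 i ^ 4)"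
    using Lp_norm_4_finite[OF _ int] a4_nonneg
    by (subst sum_ennreal[symmetric]) (auto simp: ennreal_power simp del: One_nat_def)
  have S0: "0 \<le> (\<Sum>i\<in>{1..n}. a4 i ^ 3)" "0 \<le> (\<Sum>i\<in>{1..n}. a4 i ^ 4)"
    using a4_nonneg by (auto intro!: sum_nonneg)
  have mb: "moment_bound M n X A A2 = ennreal real_moment_bound"
  proof -
    have split: "ennreal (p * q + r * s) = ennreal p * ennreal q + ennreal r * ennreal s"
      if "0 \<le> p" "0 \<le> q" "0 \<le> r" "0 \<le> s" for p q r s
      using that by (simp add: ennreal_plus ennreal_mult)
    have "ennreal_powr (ennreal (\<Sum>i\<in>{1..n}. a4 i ^ 4)) (1 / 2) = ennreal ((\<Sum>i\<in>{1..n}. a4 i ^ 4) powr (1 / 2))"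
      unfolding ennreal_powr_def using S0 by simp
    moreover have "0 \<le> K\<^sup>2 / \<sigma> ^ 3" "0 \<le> sqrt K * (K + sqrt \<tau>) / \<sigma>\<^sup>2" using \<sigma>_pos by auto
    ultimately show ?thesis
      unfolding moment_bound_def S3 S4 real_moment_bound_def \<sigma>_def[symmetric]
      using S0 by (subst split) auto
  qed
  have r0: "0 \<le> real_moment_bound" unfolding real_moment_bound_def using S0 \<sigma>_pos by simp
  have "\<bar>prob {\<omega>\<in>space M. W \<omega> \<le> z} - cdf std_normal_distribution z\<bar> \<le> 24000 * real_moment_bound"
    by (rule kolmogorov_bound[OF int W])
  also have "\<dots> \<le> 24000 * U.lam * real_moment_bound"
    using U.lam_ge_1 r0 by (intro mult_right_mono) auto
  finally have "ennreal \<bar>prob {\<omega>\<in>space M. W \<omega> \<le> z} - cdf std_normal_distribution z\<bar> \<le> ennreal (24000 * U.lam * real_moment_bound)"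
    by (rule ennreal_leI)
  also have "\<dots> = ennreal 24000 * lambda_ratio M n X A A2 * moment_bound M n X A A2"
    unfolding lam mb using U.lam_ge_1 r0 by (simp add: ennreal_mult)
  finally show ?thesis .
next
  case False
  then obtain i where i: "i \<in> {1..n}" and ni: "\<not> integrable M (\<lambda>\<omega>. X i \<omega> ^ 4)" by blast
  have "(Lp_norm M 2 (X i))\<^sup>2 \<noteq> 0" using Lp_norm_2_nonzero[OF i ni] by simp
  then have "(\<Sum>i\<in>{1..n}. (Lp_norm M 2 (X i))\<^sup>2) \<noteq> 0" using i by auto
  moreover have "0 < K / (sd_S M n X)\<^sup>2" using kappa_ge_1 \<sigma>_pos unfolding \<sigma>_def by simp
  ultimately have lam: "lambda_ratio M n X A A2 \<noteq> 0"
    unfolding lambda_ratio_def by (auto simp: ennreal_eq_0_iff not_le)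
  have "(Lp_norm M 4 (X i)) ^ 3 = \<infinity>" using Lp_norm_4_infinite[OF i ni] by (simp add: power3_eq_cube ennreal_top_mult)
  then have S: "(\<Sum>i\<in>{1..n}. (Lp_norm M 4 (X i)) ^ 3) = \<infinity>"
    using i by (subst sum.remove[of _ i]) (auto simp del: One_nat_def)
  have "0 < K\<^sup>2 / (sd_S M n X) ^ 3" using kappa_ge_1 \<sigma>_pos unfolding \<sigma>_def by simp
  then have T: "ennreal (K\<^sup>2 / (sd_S M n X) ^ 3) * (\<Sum>i\<in>{1..n}. (Lp_norm M 4 (X i)) ^ 3) = \<infinity>"
    unfolding S by (simp add: ennreal_mult_top ennreal_eq_0_iff not_le)
  have "moment_bound M n X A A2 = \<infinity>" unfolding moment_bound_def T by simp
  then have "ennreal 24000 * lambda_ratio M n X A A2 * moment_bound M n X A A2 = \<infinity>"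
    using lam by (simp add: ennreal_mult_top)
  then show ?thesis by simp
qed

end

lemma berry_esseen_constant_24000: "berry_esseen_constant TYPE('a) 24000"
  unfolding berry_esseen_constant_def
  by (intro allI impI SUP_least local_dependence.berry_esseen_bound)

section \<open>Transfer to the space of sequences\<close>

text \<open>The joint law of \<open>(W, X 1, \<dots>, X n)\<close> lives on sequences, with \<open>W\<close> in coordinate \<open>0\<close>. Hypotheses and bound depend on this law only, so a constant
  for sample spaces of sequences is a constant for all sample spaces.\<close>

definition encode :: "nat \<Rightarrow> ('a \<Rightarrow> real) \<Rightarrow> (nat \<Rightarrow> 'a \<Rightarrow> real) \<Rightarrow> 'a \<Rightarrow> nat \<Rightarrow> real" where
  "encode n W X \<omega> i = (if i = 0 then W \<omega> else if i \<le> n then X i \<omega> else 0)"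

abbreviation coord :: "nat \<Rightarrow> (nat \<Rightarrow> real) \<Rightarrow> real" where "coord \<equiv> \<lambda>i x. x i"

lemma (in prob_space) indep_var_distr:
  assumes T: "T \<in> measurable M N" and f: "f \<in> measurable N S" and g: "g \<in> measurable N S'"
    and ind: "indep_var S (\<lambda>\<omega>. f (T \<omega>)) S' (\<lambda>\<omega>. g (T \<omega>))"
  shows "prob_space.indep_var (distr M N T) S f S' g"
proof -
  interpret D: prob_space "distr M N T" by (rule prob_space_distr[OF T])
  have fg: "(\<lambda>x. (f x, g x)) \<in> measurable N (S \<Otimes>\<^sub>M S')" using f g by measurable
  have "distr (distr M N T) S f \<Otimes>\<^sub>M distr (distr M N T) S' g = distr (distr M N T) (S \<Otimes>\<^sub>M S') (\<lambda>x. (f x, g x))"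
    using ind unfolding indep_var_distribution_eq
    by (simp add: distr_distr[OF f T] distr_distr[OF g T] distr_distr[OF fg T] comp_def)
  then show ?thesis unfolding D.indep_var_distribution_eq using f g by simp
qed

context local_dependence
begin

context
  fixes W :: "'a \<Rightarrow> real" and M'
  assumes W: "is_self_normalized_sum M n X A W"
  defines M'_def: "M' \<equiv> distr M (PiM UNIV (\<lambda>_. borel)) (encode n W X)"
begin

lemma W_meas [measurable]: "W \<in> borel_measurable M" using W by (simp add: is_self_normalized_sum_def)

lemma encode_measurable [measurable]: "encode n W X \<in> measurable M (PiM UNIV (\<lambda>_. borel))"
proof (rule measurable_PiM_single')
  fix i
  have "(\<lambda>\<omega>. encode n W X \<omega> i) = (if i = 0 then W else if i \<le> n then X i else (\<lambda>_. 0))"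
    by (auto simp: encode_def fun_eq_iff)
  then show "(\<lambda>\<omega>. encode n W X \<omega> i) \<in> borel_measurable M"
    using X_meas[of i] by auto
qed auto

lemma encode_coord: "i \<in> {1..n} \<Longrightarrow> encode n W X \<omega> i = X i \<omega>" by (simp add: encode_def)

lemma coord_measurable [measurable]: "coord i \<in> borel_measurable (PiM UNIV (\<lambda>_. borel))"
  by (rule measurable_component_singleton) simp

lemma integral_encode:
  fixes f :: "(nat \<Rightarrow> real) \<Rightarrow> real"
  assumes "f \<in> borel_measurable (PiM UNIV (\<lambda>_. borel))"
  shows "integral\<^sup>L M' f = expectation (\<lambda>\<omega>. f (encode n W X \<omega>))"
    and "integrable M' f \<longleftrightarrow> integrable M (\<lambda>\<omega>. f (encode n W X \<omega>))"
  unfolding M'_def by (rule integral_distr[OF encode_measurable assms], rule integrable_distr_eq[OF encode_measurable assms])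

lemma sum_X_encode: "sum_X n coord (encode n W X \<omega>) = sum_X n X \<omega>"
  unfolding sum_X_def by (intro sum.cong refl encode_coord)

lemma sum_X_coord_measurable [measurable]: "sum_X n coord \<in> borel_measurable (PiM UNIV (\<lambda>_. borel))"
  unfolding sum_X_def[abs_def] by measurable

lemma nbhd_sum_encode: "i \<in> {1..n} \<Longrightarrow> nbhd_sum coord A i (encode n W X \<omega>) = nbhd_sum X A i \<omega>"
  unfolding nbhd_sum_def by (intro sum.cong refl encode_coord) (use A_subset in blast)

lemma self_normalizer_encode: "self_normalizer n coord A (encode n W X \<omega>) = self_normalizer n X A \<omega>"
proof -
  have "mean_of n coord (encode n W X \<omega>) = mean_of n X \<omega>"
    using sum_X_encode[of \<omega>] by (simp add: mean_of_def sum_X_def)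
  moreover have "mean_of n (nbhd_sum coord A) (encode n W X \<omega>) = mean_of n (nbhd_sum X A) \<omega>"
    unfolding mean_of_def by (intro arg_cong2[where f="(*)"] sum.cong refl nbhd_sum_encode)
  ultimately show ?thesis unfolding self_normalizer_def
    by (intro arg_cong[where f=sqrt] arg_cong2[where f=max] refl sum.cong) (simp only: nbhd_sum_encode encode_coord)
qed

lemma variance_encode: "variance_S M' n coord = variance_S M n X"
  unfolding variance_S_def by (simp add: integral_encode sum_X_encode)

lemma sd_encode: "sd_S M' n coord = sd_S M n X" by (simp add: sd_S_def variance_encode)

lemma Lp_norm_encode: "i \<in> {1..n} \<Longrightarrow> Lp_norm M' p (coord i) = Lp_norm M p (X i)"
  unfolding Lp_norm_def M'_def by (subst nn_integral_distr) (simp_all only: encode_coord, measurable)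

lemma indep_encode:
  assumes "I \<subseteq> {1..n}" "J \<subseteq> {1..n}"
    and "indep_var (PiM I (\<lambda>_. borel)) (\<lambda>\<omega>. \<lambda>k\<in>I. X k \<omega>) (PiM J (\<lambda>_. borel)) (\<lambda>\<omega>. \<lambda>k\<in>J. X k \<omega>)"
  shows "prob_space.indep_var M' (PiM I (\<lambda>_. borel)) (\<lambda>x. \<lambda>k\<in>I. x k) (PiM J (\<lambda>_. borel)) (\<lambda>x. \<lambda>k\<in>J. x k)"
  unfolding M'_def
proof (rule indep_var_distr[OF encode_measurable])
  show "(\<lambda>x. \<lambda>k\<in>I. x k) \<in> measurable (PiM UNIV (\<lambda>_. borel)) (PiM I (\<lambda>_. borel :: real measure))" for I :: "nat set"
    by (intro measurable_restrict measurable_component_singleton) auto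
  then show "(\<lambda>x. \<lambda>k\<in>J. x k) \<in> measurable (PiM UNIV (\<lambda>_. borel)) (PiM J (\<lambda>_. borel :: real measure))" .
  have "(\<lambda>k\<in>I. encode n W X \<omega> k) = (\<lambda>k\<in>I. X k \<omega>)" if "I \<subseteq> {1..n}" for I \<omega>
    using that by (intro restrict_ext encode_coord) auto
  then show "indep_var (PiM I (\<lambda>_. borel)) (\<lambda>\<omega>. \<lambda>k\<in>I. encode n W X \<omega> k) (PiM J (\<lambda>_. borel)) (\<lambda>\<omega>. \<lambda>k\<in>J. encode n W X \<omega> k)"
    using assms by simp
qed

lemma local_dependence_encode: "local_dependence M' n coord A A2"
proof (intro local_dependence.intro local_dependence_axioms.intro)
  show "prob_space M'" unfolding M'_def by (rule prob_space_distr) measurable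
  show "1 \<le> n" by (rule n_ge_1)
  fix i assume i: "i \<in> {1..n}"
  show "coord i \<in> borel_measurable M'" unfolding M'_def by simp
  show "integrable M' (coord i)" "integral\<^sup>L M' (coord i) = 0"
    using X_integrable[OF i] X_centered[OF i] by (simp_all only: integral_encode coord_measurable encode_coord[OF i])
  show "A i \<subseteq> {1..n}" by (rule A_subset[OF i])
  show "prob_space.indep_var M' (PiM {i} (\<lambda>_. borel)) (\<lambda>\<omega>. \<lambda>k\<in>{i}. \<omega> k) (PiM ({1..n} - A i) (\<lambda>_. borel)) (\<lambda>\<omega>. \<lambda>k\<in>{1..n} - A i. \<omega> k)"
    using i by (intro indep_encode A_indep) auto
  fix j assume j: "j \<in> A i"
  show "A i \<subseteq> A2 i j" by (rule A2_supset[OF i j])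
  show "A2 i j \<subseteq> {1..n}" by (rule A2_subset[OF i j])
  have "{i, j} \<subseteq> {1..n}" using i j A_subset[OF i] by blast
  then show "prob_space.indep_var M' (PiM {i, j} (\<lambda>_. borel)) (\<lambda>\<omega>. \<lambda>k\<in>{i, j}. \<omega> k)
      (PiM ({1..n} - A2 i j) (\<lambda>_. borel)) (\<lambda>\<omega>. \<lambda>k\<in>{1..n} - A2 i j. \<omega> k)"
    by (intro indep_encode A2_indep i j) auto
next
  show "integrable M' (\<lambda>\<omega>. (sum_X n coord \<omega>)\<^sup>2)"
    using variance_finite by (simp add: integral_encode sum_X_encode)
  show "0 < variance_S M' n coord" using variance_pos by (simp add: variance_encode)
qed

lemma lambda_ratio_encode: "lambda_ratio M' n coord A A2 = lambda_ratio M n X A A2"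
  unfolding lambda_ratio_def sd_encode
  by (intro arg_cong2[where f="(*)"] refl sum.cong) (simp only: Lp_norm_encode)

lemma moment_bound_encode: "moment_bound M' n coord A A2 = moment_bound M n X A A2"
proof -
  have "(\<Sum>i\<in>{1..n}. (Lp_norm M' 4 (coord i)) ^ p) = (\<Sum>i\<in>{1..n}. (Lp_norm M 4 (X i)) ^ p)" for p
    by (intro sum.cong refl) (simp only: Lp_norm_encode)
  then show ?thesis unfolding moment_bound_def sd_encode by simp
qed

lemma berry_esseen_from_encode:
  assumes C: "berry_esseen_constant TYPE(nat \<Rightarrow> real) C"
  shows "(SUP z. ennreal \<bar>measure M {\<omega> \<in> space M. W \<omega> \<le> z} - cdf std_normal_distribution z\<bar>)
    \<le> ennreal C * lambda_ratio M n X A A2 * moment_bound M n X A A2"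
proof -
  \<comment> \<open>off the range of the encoding, coordinate \<open>0\<close> need not be the quotient, which a version has to equal at every point\<close>
  define W' where "W' x = (if self_normalizer n coord A x = 0 then x 0 else sum_X n coord x / self_normalizer n coord A x)" for x
  have nm: "nbhd_sum coord A i \<in> borel_measurable (PiM UNIV (\<lambda>_. borel))" for i
    unfolding nbhd_sum_def[abs_def] by measurable
  have [measurable]: "self_normalizer n coord A \<in> borel_measurable (PiM UNIV (\<lambda>_. borel))"
    unfolding self_normalizer_def[abs_def] mean_of_def using nm by measurable
  have W'_meas [measurable]: "W' \<in> borel_measurable (PiM UNIV (\<lambda>_. borel))"
    unfolding W'_def[abs_def] by measurable
  have "is_self_normalized_sum M' n coord A W'"
    unfolding is_self_normalized_sum_def using W'_meas by (auto simp: M'_def W'_def)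
  with C local_dependence_encode
  have "(SUP z. ennreal \<bar>measure M' {x \<in> space M'. W' x \<le> z} - cdf std_normal_distribution z\<bar>)
    \<le> ennreal C * lambda_ratio M' n coord A A2 * moment_bound M' n coord A A2"
    unfolding berry_esseen_constant_def by blast
  moreover have "W' (encode n W X \<omega>) = W \<omega>" if "\<omega> \<in> space M" for \<omega>
    using W that unfolding W'_def self_normalizer_encode sum_X_encode is_self_normalized_sum_def by (auto simp: encode_def)
  then have "measure M' {x \<in> space M'. W' x \<le> z} = measure M {\<omega> \<in> space M. W \<omega> \<le> z}" for z
  proof -
    let ?N = "PiM UNIV (\<lambda>_. borel) :: (nat \<Rightarrow> real) measure"
    have S: "{x \<in> space ?N. W' x \<le> z} \<in> sets ?N" by measurable
    have "encode n W X -` {x \<in> space ?N. W' x \<le> z} \<inter> space M = {\<omega> \<in> space M. W \<omega> \<le> z}"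
      using \<open>\<And>\<omega>. \<omega> \<in> space M \<Longrightarrow> W' (encode n W X \<omega>) = W \<omega>\<close> by (auto simp: space_PiM)
    then show ?thesis unfolding M'_def space_distr measure_distr[OF encode_measurable S] by simp
  qed
  ultimately show ?thesis by (simp add: lambda_ratio_encode moment_bound_encode)
qed

end

end

theorem theorem2p2:
  shows "(\<exists>C>0. berry_esseen_constant TYPE(nat \<Rightarrow> real) C) \<and>
    (\<forall>C. berry_esseen_constant TYPE(nat \<Rightarrow> real) C \<longrightarrow> berry_esseen_constant TYPE('a) C)"
proof (intro conjI allI impI)
  show "\<exists>C>0. berry_esseen_constant TYPE(nat \<Rightarrow> real) C"
    using berry_esseen_constant_24000 by (intro exI[of _ 24000]) simp
next
  fix C assume C: "berry_esseen_constant TYPE(nat \<Rightarrow> real) C"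
  show "berry_esseen_constant TYPE('a) C"
    unfolding berry_esseen_constant_def
    by (intro allI impI local_dependence.berry_esseen_from_encode[OF _ _ C])
qed

end
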